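(* Let $\chi\in\mathbb C((z^{1/2}))$ and $i,j\in\{1,2\}$. Then $F^{T_i}(\chi)\otimes F_{-1}^{T_j}$ is a $\Theta$-twisted $V_{-2}(sl_2)$-module (equivalently, a restricted $\widehat{sl_2}[\Theta]$-module of level $-2$), with the action described in the context. In particular, if $\lambda\in\{\tfrac12\}\cup(\mathbb C\setminus\tfrac12\mathbb Z)$, then $F^{T_i}(\frac\lambda z)\otimes F_{-1}^{T_j}$ is an irreducible $\widehat{sl_2}[\Theta]$-module at the critical level isomorphic to $$L((2\lambda-2)\Lambda_0-2\lambda\Lambda_1)\ \text{ if } i=j,\qquad L(-2\lambda\Lambda_0+(2\lambda-2)\Lambda_1)\ \text{ if } i\ne j.$$ Hence $F^{T_i}(\frac1{2z})\otimes F_{-1}^{T_j}\cong L(-\Lambda_0-\Lambda_1)$ for all $i,j$.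
   Context: **The spaces $F^{T_i}(\chi)$.** Let $CL^{tw}$ be the associative algebra generated by $\Phi(r)$, $r\in\tfrac12\mathbb Z$, with $\{\Phi(r),\Phi(s)\}=-(-1)^{2r}\delta_{r+s,0}$. For $i=1,2$ let $F^{T_i}$ be the irreducible $CL^{tw}$-module generated by $\mathbf 1$ with $\Phi(r)\mathbf 1=0$ for $r>0$ and $\Phi(0)\mathbf 1=(-1)^i\frac1{\sqrt{-2}}\mathbf 1$ (where $\sqrt{-2}=\sqrt2\sqrt{-1}$); as a vector space $F^{T_i}=\bigwedge(\Phi(r)\mid r<0)$. Put $\Phi(z)=\sum_{r\in\frac12\mathbb Z}\Phi(r)z^{-r-1/2}$. For $\chi\in\mathbb C((z^{1/2}))$ write $\chi=\chi^{(1)}+\chi^{(2)}$ with $\chi^{(1)}$ (resp. $\chi^{(2)}$) the part with integer (resp. half-odd-integer) powers of $z$. $F^{T_i}(\chi)$ is the space $F^{T_i}$ equipped with the fields $G(z)=\partial_z\Phi(z)+\chi(z)\Phi(z)$ and $T(z)=\chi^{(2)}(z)\,\mathrm{Id}$. **The modules $F_{-1}^{T_j}$.** Let $[\beta(k),\beta(l)]=-k\delta_{k+l,0}$, $k,l\in\frac12+\mathbb Z$, with Fock space $M_{\frac12+\mathbb Z}(1)=\mathbb C[\beta(-\frac12),\beta(-\frac32),\dots]$. $F_{-1}^{T_j}=M_{\frac12+\mathbb Z}(1)$ with $\beta(z)=\sum_{k\in\frac12+\mathbb Z}\beta(k)z^{-k-1}$ and $$Y_{tw}(e^{\beta},z)=-(2\sqrt{-1})(-1)^j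 z^{1/2}\exp\Big(\sum_{k\in\frac12+\mathbb Z_{\ge0}}\tfrac{\beta(-k)}{k}z^{k}\Big)\exp\Big(-\sum_{k\in\frac12+\mathbb Z_{\ge0}}\tfrac{\beta(k)}{k}z^{-k}\Big).$$ **The Lie algebra $\widehat{sl_2}[\Theta]$** has basis $K$ (central), $h(m)$, $x^-(m)$ ($m\in\frac12+\mathbb Z$), $x^+(r)$ ($r\in\mathbb Z$), with, for $m,n\in\frac12+\mathbb Z$, $r,s\in\mathbb Z$: $[h(m),h(n)]=2m\delta_{m+n,0}K$, $[h(m),x^+(r)]=2x^-(m+r)$, $[h(m),x^-(n)]=2x^+(m+n)$, $[x^+(r),x^+(s)]=2r\delta_{r+s,0}K$, $[x^+(r),x^-(m)]=-2h(m+r)$, $[x^-(m),x^-(n)]=-2m\delta_{m+n,0}K$. Put $X_+(z)=\frac12\big(\sum_{n\in\mathbb Z}x^+(n)z^{-n-1}+\sum_{n\in\frac12+\mathbb Z}x^-(n)z^{-n-1}\big)$, $h(z)=\sum_{n\in\frac12+\mathbb Z}h(n)z^{-n-1}$. $V_{-2}(sl_2)$ is the universal affine vertex algebra of level $-2$ and $\Theta$ its automorphism with $e\leftrightarrow f$, $h\mapsto-h$; $\Theta$-twisted $V_{-2}(sl_2)$-modules are the same as restricted $\widehat{sl_2}[\Theta]$-modules with $K=-2$. **Action.** On $F^{T_i}(\chi)\otimes F_{-1}^{T_j}$, $K=-2$, $X_+(z)=\frac1{\sqrt2}G(z)\otimes Y_{tw}(e^\beta,z)$ (factors tensored without signs),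 $h(z)=-2\beta(z)+2T(z)$. **Highest weight modules.** $L(\frac k2(\Lambda_0+\Lambda_1)+a(\Lambda_1-\Lambda_0))$ is the irreducible module with $K=k$ generated by $v$ with $x^+(n)v=x^-(p)v=h(m)v=0$ for all $n,m,p>0$ and $x^+(0)v=av$.
   Formalization: L(...) is taken to be the graded irreducible highest weight module, i.e. one that also admits a degree derivation d with dv=0, because at the critical level the listed conditions alone do not determine the module up to isomorphism. *)

theory Defs
  imports
    "HOL-Library.Poly_Mapping"
    "HOL-Library.FSet"
    "HOL-Computational_Algebra.Formal_Laurent_Series"
begin

(* Conventions on half-integers.  A family indexed by (1/2)Z is indexed by the doubled
   integer: n stands for n/2.  A family indexed by 1/2 + Z is indexed by the integer part:
   l stands for l + 1/2.  Formal series in z^(1/2) are indexed by doubled exponents: the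
   value at n is the coefficient of z^(n/2). *)

section \<open>Free complex vector spaces\<close>

definition smul :: "complex \<Rightarrow> ('a \<Rightarrow>\<^sub>0 complex) \<Rightarrow> ('a \<Rightarrow>\<^sub>0 complex)" where
  "smul c v = Poly_Mapping.map ((*) c) v"

abbreviation bvec :: "'a \<Rightarrow> ('a \<Rightarrow>\<^sub>0 complex)" where
  "bvec a \<equiv> Poly_Mapping.single a 1"

(* linear extension of a map given on the basis *)
definition lin :: "('a \<Rightarrow> ('b \<Rightarrow>\<^sub>0 complex)) \<Rightarrow> ('a \<Rightarrow>\<^sub>0 complex) \<Rightarrow> ('b \<Rightarrow>\<^sub>0 complex)" where
  "lin f v = (\<Sum>a\<in>Poly_Mapping.keys v. smul (Poly_Mapping.lookup v a) (f a))"

(* The tensor product of the spaces with bases 'a and 'b is the space with basis 'a \<times> 'b. *)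
definition tens :: "('a \<Rightarrow>\<^sub>0 complex) \<Rightarrow> ('b \<Rightarrow>\<^sub>0 complex) \<Rightarrow> ('a \<times> 'b \<Rightarrow>\<^sub>0 complex)" where
  "tens u v = lin (\<lambda>a. lin (\<lambda>b. bvec (a, b)) v) u"

definition tens_op :: "(('a \<Rightarrow>\<^sub>0 complex) \<Rightarrow> ('a \<Rightarrow>\<^sub>0 complex)) \<Rightarrow> (('b \<Rightarrow>\<^sub>0 complex) \<Rightarrow> ('b \<Rightarrow>\<^sub>0 complex))
    \<Rightarrow> ('a \<times> 'b \<Rightarrow>\<^sub>0 complex) \<Rightarrow> ('a \<times> 'b \<Rightarrow>\<^sub>0 complex)" where
  "tens_op A B = lin (\<lambda>(a, b). tens (A (bvec a)) (B (bvec b)))"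

lemma lookup_smul [simp]: "Poly_Mapping.lookup (smul c v) a = c * Poly_Mapping.lookup v a"
  by (simp add: smul_def Poly_Mapping.map.rep_eq when_def)

lemma vector_space_smul: "vector_space smul"
  by unfold_locales (auto intro!: poly_mapping_eqI simp: lookup_add algebra_simps)

lemma lookup_sum': "Poly_Mapping.lookup (sum f A) b = (\<Sum>a\<in>A. Poly_Mapping.lookup (f a) b)"
  by (induction A rule: infinite_finite_induct) (auto simp: lookup_add)

lemma lin_superset:
  assumes "finite A" "Poly_Mapping.keys v \<subseteq> A"
  shows "lin f v = (\<Sum>a\<in>A. smul (Poly_Mapping.lookup v a) (f a))"
  unfolding lin_def using assms
  by (intro sum.mono_neutral_left) (auto intro!: poly_mapping_eqI simp: in_keys_iff)

lemma lin_add: "lin f (u + v) = lin f u + lin f v"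
proof -
  let ?A = "Poly_Mapping.keys u \<union> Poly_Mapping.keys v"
  have "lin f (u + v) = (\<Sum>a\<in>?A. smul (Poly_Mapping.lookup (u + v) a) (f a))"
    by (rule lin_superset) (auto dest!: subsetD[OF Poly_Mapping.keys_add])
  also have "\<dots> = (\<Sum>a\<in>?A. smul (Poly_Mapping.lookup u a) (f a)) + (\<Sum>a\<in>?A. smul (Poly_Mapping.lookup v a) (f a))"
    by (auto intro!: poly_mapping_eqI
        simp: lookup_add lookup_sum' sum.distrib[symmetric] algebra_simps)
  also have "\<dots> = lin f u + lin f v"
    by (subst (1 2) lin_superset[where A = ?A]) auto
  finally show ?thesis .
qed

lemma lin_smul: "lin f (smul c v) = smul c (lin f v)"
proof -
  have "lin f (smul c v) = (\<Sum>a\<in>Poly_Mapping.keys v. smul (Poly_Mapping.lookup (smul c v) a) (f a))"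
    by (rule lin_superset) (auto simp: in_keys_iff)
  then show ?thesis
    by (auto intro!: poly_mapping_eqI simp: lin_def lookup_sum' sum_distrib_left algebra_simps)
qed

lemma linear_lin: "Vector_Spaces.linear smul smul (lin f)"
  by (simp add: Vector_Spaces.linear_iff vector_space_smul lin_add lin_smul)

lemma lin_zero [simp]: "lin f 0 = 0"
  by (simp add: lin_def)

lemma lin_single [simp]: "lin f (Poly_Mapping.single a c) = smul c (f a)"
  by (subst lin_superset[where A = "{a}"]) auto

lemma smul_zero [simp]: "smul c 0 = 0" "smul 0 v = 0"
  by (auto intro!: poly_mapping_eqI)

lemma smul_one [simp]: "smul 1 v = v"
  by (auto intro!: poly_mapping_eqI)

lemma smul_smul [simp]: "smul a (smul b v) = smul (a * b) v"
  by (auto intro!: poly_mapping_eqI)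

lemma smul_single: "smul c (Poly_Mapping.single a d) = Poly_Mapping.single a (c * d)"
  by (auto intro!: poly_mapping_eqI simp: lookup_single when_def)

lemma smul_add_left: "smul (a + b) v = smul a v + smul b v"
  and smul_add_right: "smul a (u + v) = smul a u + smul a v"
  and smul_minus_left: "smul (- a) v = - smul a v"
  by (auto intro!: poly_mapping_eqI simp: lookup_add algebra_simps)

lemma lin_ext:
  assumes "Vector_Spaces.linear smul smul f" "Vector_Spaces.linear smul smul g"
    and "\<And>a. f (bvec a) = g (bvec a)"
  shows "f v = g v"
proof -
  interpret f: Vector_Spaces.linear smul smul f by fact
  interpret g: Vector_Spaces.linear smul smul g by fact
  have v: "v = (\<Sum>a\<in>Poly_Mapping.keys v. smul (Poly_Mapping.lookup v a) (bvec a))"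
    by (rule poly_mapping_eqI)
      (simp add: lookup_sum' lookup_single when_def if_distrib sum.delta in_keys_iff
        cong: if_cong)
  show ?thesis
    by (subst (1 2) v) (simp add: f.sum g.sum f.scale g.scale assms(3))
qed

section \<open>Formal series of operators\<close>

(* The sums Sum_any below are taken pointwise; for the fields used here only finitely many
   summands are nonzero on each vector, so Sum_any is the honest sum. *)

type_synonym 'a series = "int \<Rightarrow> ('a \<Rightarrow>\<^sub>0 complex) \<Rightarrow> ('a \<Rightarrow>\<^sub>0 complex)"

definition ser_scale :: "complex \<Rightarrow> 'a series \<Rightarrow> 'a series" where
  "ser_scale c A n v = smul c (A n v)"

definition ser_add :: "'a series \<Rightarrow> 'a series \<Rightarrow> 'a series" where
  "ser_add A B n v = A n v + B n v"

definition ser_shift :: "int \<Rightarrow> 'a series \<Rightarrow> 'a series" \<comment> \<open>multiplication by \<open>z\<^bsup>k/2\<^esup>\<close>\<close> where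
  "ser_shift k A n v = A (n - k) v"

definition ser_mult :: "'a series \<Rightarrow> 'a series \<Rightarrow> 'a series" where
  "ser_mult A B n v = Sum_any (\<lambda>p. A p (B (n - p) v))"

definition ser_one :: "'a series" where
  "ser_one n v = (if n = 0 then v else 0)"

primrec ser_pow :: "'a series \<Rightarrow> nat \<Rightarrow> 'a series" where
  "ser_pow A 0 = ser_one"
| "ser_pow A (Suc m) = ser_mult A (ser_pow A m)"

definition ser_exp :: "'a series \<Rightarrow> 'a series" where
  "ser_exp A n v = Sum_any (\<lambda>m. smul (1 / fact m) (ser_pow A m n v))"

definition ser_deriv :: "'a series \<Rightarrow> 'a series" \<comment> \<open>\<open>d/dz\<close>\<close> where
  "ser_deriv A n v = smul (of_int (n + 2) / 2) (A (n + 2) v)"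

(* chi in C((z^(1/2))) is a Laurent series in the variable z^(1/2). *)
definition ser_fls :: "complex fls \<Rightarrow> 'a series" where
  "ser_fls \<chi> n v = smul (fls_nth \<chi> n) v"

definition ser_tens :: "'a series \<Rightarrow> 'b series \<Rightarrow> ('a \<times> 'b) series" where
  "ser_tens A B n v = Sum_any (\<lambda>p. tens_op (A p) (B (n - p)) v)"

section \<open>The twisted Clifford modules\<close>

(* The basis vector bvec S, S = {p1 < ... < pk}, is the monomial
   Phi(-(p1+1)/2) ... Phi(-(pk+1)/2) 1 of the exterior algebra.
   Phi i n is the action of Phi(n/2) on F^(T_i). *)

type_synonym clifford_basis = "nat fset"

definition koszul_sign :: "nat \<Rightarrow> nat fset \<Rightarrow> complex" where
  "koszul_sign p S = (-1) ^ card {q. q |\<in>| S \<and> q < p}"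

definition Phi_basis :: "nat \<Rightarrow> int \<Rightarrow> nat fset \<Rightarrow> (clifford_basis \<Rightarrow>\<^sub>0 complex)" where
  "Phi_basis i n S =
    (if n < 0 then
       (let p = nat (- n - 1) in
        if p |\<in>| S then 0 else smul (koszul_sign p S) (bvec (finsert p S)))
     else if n = 0 then
       smul ((-1) ^ i * (1 / (complex_of_real (sqrt 2) * \<i>)) * (-1) ^ fcard S) (bvec S)
     else
       (let p = nat (n - 1) in
        if p |\<in>| S then smul (- ((-1) powi n) * koszul_sign p S) (bvec (S |-| {|p|})) else 0))"

definition Phi :: "nat \<Rightarrow> int \<Rightarrow> (clifford_basis \<Rightarrow>\<^sub>0 complex) \<Rightarrow> (clifford_basis \<Rightarrow>\<^sub>0 complex)" where
  "Phi i n = lin (Phi_basis i n)"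

definition FT_vac :: "clifford_basis \<Rightarrow>\<^sub>0 complex" where
  "FT_vac = bvec {||}"

definition Phi_field :: "nat \<Rightarrow> clifford_basis series" where
  "Phi_field i n = Phi i (- n - 1)"

definition half_part :: "complex fls \<Rightarrow> complex fls" \<comment> \<open>\<open>\<chi> \<mapsto> \<chi>\<^sup>(\<^sup>2\<^sup>)\<close>\<close> where
  "half_part \<chi> = Abs_fls (\<lambda>n. if odd n then fls_nth \<chi> n else 0)"

lemma fls_nth_half_part: "fls_nth (half_part \<chi>) n = (if odd n then fls_nth \<chi> n else 0)"
proof -
  have "eventually (\<lambda>n. fls_nth \<chi> (- int n) = 0) cofinite"
    using fls_nth[of \<chi>] by simp
  then have "\<forall>\<^sub>\<infinity>n::nat. (if odd (- int n) then fls_nth \<chi> (- int n) else 0) = 0"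
    by (rule eventually_mono) auto
  then show ?thesis unfolding half_part_def by (subst Abs_fls_inverse) auto
qed

definition G_field :: "complex fls \<Rightarrow> nat \<Rightarrow> clifford_basis series" where
  "G_field \<chi> i =
    ser_add (ser_deriv (Phi_field i)) (ser_mult (ser_fls \<chi>) (Phi_field i))"

definition T_field :: "complex fls \<Rightarrow> clifford_basis series" where
  "T_field \<chi> = ser_fls (half_part \<chi>)"

lemma Phi_basis_eq: "Phi i n (bvec S) = Phi_basis i n S"
  by (simp add: Phi_def)

lemma linear_Phi: "Vector_Spaces.linear smul smul (Phi i n)"
  unfolding Phi_def by (rule linear_lin)

lemma Phi_add: "Phi i n (u + v) = Phi i n u + Phi i n v"
  and Phi_smul: "Phi i n (smul c v) = smul c (Phi i n v)"
  by (simp_all add: Phi_def lin_add lin_smul)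

lemma koszul_sign_sq: "koszul_sign p S * koszul_sign p S = 1"
  by (simp add: koszul_sign_def flip: power_mult_distrib)

lemma finite_below: "finite {q. q |\<in>| S \<and> q < (p::nat)}"
  by (rule finite_subset[of _ "{..<p}"]) auto

lemma koszul_sign_finsert:
  "p |\<notin>| S \<Longrightarrow> koszul_sign q (finsert p S) = (if p < q then - koszul_sign q S else koszul_sign q S)"
proof -
  assume p: "p |\<notin>| S"
  have "{r. r |\<in>| finsert p S \<and> r < q} =
     (if p < q then insert p {r. r |\<in>| S \<and> r < q} else {r. r |\<in>| S \<and> r < q})"
    by auto
  with p show ?thesis by (simp add: koszul_sign_def finite_below)
qed

lemma koszul_sign_fminus:
  "p |\<in>| S \<Longrightarrow>
     koszul_sign q (S |-| {|p|}) = (if p < q then - koszul_sign q S else koszul_sign q S)"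
  using koszul_sign_finsert[of p "S |-| {|p|}" q] by (auto simp: finsert_absorb)

text \<open>\<open>Phi i\<close> is the irreducible module of the Clifford algebra generated by \<open>FT_vac\<close>.\<close>

lemma Phi_vac: "n > 0 \<Longrightarrow> Phi i n FT_vac = 0"
  "Phi i 0 FT_vac = smul ((-1) ^ i * (1 / (complex_of_real (sqrt 2) * \<i>))) FT_vac"
  by (simp_all add: FT_vac_def Phi_basis_eq Phi_basis_def Let_def fcard.rep_eq)

lemma Phi_creat:
  "Phi i (- int p - 1) (bvec S) =
     (if p |\<in>| S then 0 else smul (koszul_sign p S) (bvec (finsert p S)))"
  by (simp add: Phi_basis_eq Phi_basis_def Let_def)

lemma Phi_annih:
  "Phi i (int p + 1) (bvec S) =
     (if p |\<in>| S then smul (- ((-1) powi (int p + 1)) * koszul_sign p S) (bvec (S |-| {|p|})) else 0)"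
  by (simp add: Phi_basis_eq Phi_basis_def Let_def)

lemma Phi_zero:
  "Phi i 0 (bvec S) = smul ((-1) ^ i * (1 / (complex_of_real (sqrt 2) * \<i>)) * (-1) ^ fcard S) (bvec S)"
  by (simp add: Phi_basis_eq Phi_basis_def)

lemma Phi_0 [simp]: "Phi i n 0 = 0"
  by (simp add: Phi_def)

lemma smul_add_same: "smul a v + smul b v = smul (a + b) v"
  by (simp add: smul_add_left)

lemma fcard_minus_sign: "p |\<in>| S \<Longrightarrow> (-1::complex) ^ fcard S = - ((-1) ^ fcard (S |-| {|p|}))"
proof -
  assume "p |\<in>| S"
  then have "fcard S = Suc (fcard (S |-| {|p|}))"
    by (metis fcard_Suc_fminus1)
  then show ?thesis by simp
qed

lemma Phi_clifford_basis_le: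
  assumes "m \<le> n"
  shows "Phi i m (Phi i n (bvec S)) + Phi i n (Phi i m (bvec S)) =
     smul (if m + n = 0 then - ((-1) powi m) else 0) (bvec S)"
proof -
  consider (nn) p q where "m = - int p - 1" "n = - int q - 1"
    | (nz) p where "m = - int p - 1" "n = 0"
    | (np) p q where "m = - int p - 1" "n = int q + 1"
    | (zz) "m = 0" "n = 0"
    | (zp) q where "m = 0" "n = int q + 1"
    | (pp) p q where "m = int p + 1" "n = int q + 1"
  proof -
    have *: "(\<exists>p. k = - int p - 1) \<or> k = 0 \<or> (\<exists>p. k = int p + 1)" for k
    proof -
      consider "k < 0" | "k = 0" | "k > 0" by linarith
      then show ?thesis
      proof cases
        case 1 then have "k = - int (nat (- k - 1)) - 1" by simp
        then show ?thesis by blast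
      next
        case 3 then have "k = int (nat (k - 1)) + 1" by simp
        then show ?thesis by blast
      qed simp
    qed
    show ?thesis using *[of m] *[of n] assms that by (elim disjE exE) auto
  qed
  then show ?thesis
  proof cases
    case nn
    then show ?thesis
      by (cases p q rule: linorder_cases)
        (auto simp: Phi_creat Phi_smul koszul_sign_finsert finsert_commute smul_add_same
          mult.commute)
  next
    case nz
    then show ?thesis
      by (auto simp: Phi_creat Phi_zero Phi_smul smul_add_same fcard_finsert_disjoint mult.commute)
  next
    case np
    have [simp]: "(-1::complex) powi (- int q - 1) = (-1) powi (int q + 1)"
      using power_int_minus_one_minus[of "int q + 1", where 'a = complex] by simp
    have [simp]: "finsert q (S |-| {|q|}) = S" if "q |\<in>| S"
      using that by auto
    have [simp]: "(finsert p S) |-| {|q|} = finsert p (S |-| {|q|})" if "p \<noteq> q"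
      using that by auto
    have [simp]: "finsert q S |-| {|q|} = S" if "q |\<notin>| S"
      using that by auto
    have a: "koszul_sign q S * (koszul_sign q S * x) = x" for x
      by (simp add: koszul_sign_sq flip: mult.assoc)
    have b: "koszul_sign q S * (x * koszul_sign q S) = x" for x
      by (simp add: koszul_sign_sq mult.left_commute)
    show ?thesis
    proof (cases "p = q")
      case True
      then show ?thesis using np
        by (auto simp: Phi_creat Phi_annih Phi_smul koszul_sign_finsert koszul_sign_fminus
          koszul_sign_sq a b finsert_absorb mult.assoc)
    next
      case False
      then show ?thesis using np
        by (cases p q rule: linorder_cases)
          (auto simp: Phi_creat Phi_annih Phi_smul koszul_sign_finsert koszul_sign_fminus
          smul_add_same mult_ac)
    qed
  next
    case zz
    have "(-1::complex) ^ i * (-1) ^ i = 1" "(-1::complex) ^ fcard S * (-1) ^ fcard S = 1"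
      by (simp_all flip: power_mult_distrib)
    moreover have "complex_of_real (sqrt 2) * complex_of_real (sqrt 2) = 2"
      by (simp flip: of_real_mult)
    ultimately have "((-1) ^ i * (1 / (complex_of_real (sqrt 2) * \<i>)) * (-1) ^ fcard S) *
        ((-1) ^ i * (1 / (complex_of_real (sqrt 2) * \<i>)) * (-1) ^ fcard S) = - (1 / 2)"
      by (simp add: field_simps)
    with zz show ?thesis
      by (simp add: Phi_zero Phi_smul smul_add_same)
  next
    case zp
    then show ?thesis
      using fcard_minus_sign[of q S]
      by (auto simp: Phi_annih Phi_zero Phi_smul smul_add_same mult_ac)
  next
    case pp
    have "S |-| {|q|} |-| {|p|} = S |-| {|p|} |-| {|q|}" by auto
    with pp show ?thesis
      by (cases p q rule: linorder_cases)
        (auto simp: Phi_annih Phi_smul koszul_sign_fminus smul_add_same mult_ac)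
  qed
qed

theorem Phi_clifford:
  "Phi i m (Phi i n v) + Phi i n (Phi i m v) =
     smul (if m + n = 0 then - ((-1) powi m) else 0) v"
proof -
  have basis: "Phi i m (Phi i n (bvec S)) + Phi i n (Phi i m (bvec S)) =
     smul (if m + n = 0 then - ((-1) powi m) else 0) (bvec S)" for S
  proof (cases "m \<le> n")
    case False
    have "(-1::complex) powi n = (-1) powi m" if "m + n = 0"
    proof -
      from that have "n = - m" by simp
      then show ?thesis by (simp add: power_int_minus_one_minus)
    qed
    then show ?thesis
      using Phi_clifford_basis_le[of n m i S] False by (auto simp: add.commute)
  qed (rule Phi_clifford_basis_le)
  show ?thesis
    by (rule lin_ext[where f = "\<lambda>v. Phi i m (Phi i n v) + Phi i n (Phi i m v)"])
      (simp_all only: basis Vector_Spaces.linear_iff vector_space_smul Phi_add Phi_smul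
        smul_add_right smul_smul, simp_all add: ac_simps)
qed

theorem Phi_irreducible:
  assumes U: "module.subspace smul U" "\<And>n u. u \<in> U \<Longrightarrow> Phi i n u \<in> U" and "u \<in> U" "u \<noteq> 0"
  shows "U = UNIV"
proof -
  interpret vector_space smul by (rule vector_space_smul)
  have scaled: "bvec S \<in> U" if "smul c (bvec S) \<in> U" "c \<noteq> 0" for S :: "nat fset" and c
    using subspace_scale[OF U(1) that(1), of "1 / c"] that(2) by simp
  have lookup_annih: "Poly_Mapping.lookup (Phi i (int p + 1) v) S =
     (if p |\<in>| S then 0 else - ((-1) powi (int p + 1)) * koszul_sign p (finsert p S)
        * Poly_Mapping.lookup v (finsert p S))" (is "?l v = ?r v") for p v S
  proof -
    have "smul (?l v) (bvec ()) = smul (?r v) (bvec ())"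
    proof (rule lin_ext[where v = v])
      fix R :: "nat fset"
      have "R |-| {|p|} = S \<longleftrightarrow> R = finsert p S" if "p |\<in>| R" "p |\<notin>| S"
        using that by auto
      moreover have "p |\<notin>| R |-| {|p|}" by auto
      ultimately show "smul (?l (bvec R)) (bvec ()) = smul (?r (bvec R)) (bvec ())"
        by (cases "p |\<in>| R") (auto simp: Phi_annih lookup_single when_def)
    qed (auto simp: Vector_Spaces.linear_iff vector_space_smul Phi_add Phi_smul lookup_add
        algebra_simps smul_add_left)
    then have "Poly_Mapping.lookup (smul (?l v) (bvec ())) () =
        Poly_Mapping.lookup (smul (?r v) (bvec ())) ()"
      by (rule arg_cong)
    then show ?thesis by simp
  qed
  have vac: "FT_vac \<in> U" if "v \<in> U" "v \<noteq> 0" "\<forall>S\<in>Poly_Mapping.keys v. fcard S \<le> N" for v N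
    using that
  proof (induction N arbitrary: v)
    case 0
    then have sub: "Poly_Mapping.keys v \<subseteq> {{||}}" by (auto simp: fcard_0_eq)
    with \<open>v \<noteq> 0\<close> have c: "Poly_Mapping.lookup v {||} \<noteq> 0" by (metis keys_eq_empty subset_singletonD in_keys_iff insertI1)
    have "v = smul (Poly_Mapping.lookup v {||}) (bvec {||})"
      using sub by (intro poly_mapping_eqI) (auto simp: lookup_single when_def in_keys_iff)
    with 0 c show ?case unfolding FT_vac_def using scaled by metis
  next
    case (Suc N)
    show ?case
    proof (cases "Poly_Mapping.keys v \<subseteq> {{||}}")
      case True
      then have "\<forall>S\<in>Poly_Mapping.keys v. fcard S \<le> N"
        by (auto simp: fcard.rep_eq)
      then show ?thesis using Suc.IH Suc.prems by blast
    next
      case False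
      then obtain S p where S: "S \<in> Poly_Mapping.keys v" "p |\<in>| S" by (auto simp: fset_eq_iff)
      let ?w = "Phi i (int p + 1) v"
      have fin: "finsert p (S |-| {|p|}) = S" using S by auto
      have ks: "koszul_sign p S \<noteq> 0" by (simp add: koszul_sign_def)
      have "Poly_Mapping.lookup ?w (S |-| {|p|}) \<noteq> 0"
        using S ks by (simp add: lookup_annih fin in_keys_iff del: finsert_fminus_single)
      then have "?w \<noteq> 0" by auto
      moreover have "fcard T \<le> N" if "T \<in> Poly_Mapping.keys ?w" for T
      proof -
        have "p |\<notin>| T" "finsert p T \<in> Poly_Mapping.keys v"
          using that by (auto simp: in_keys_iff lookup_annih split: if_splits)
        with Suc.prems(3) show ?thesis by (auto simp: fcard_finsert_disjoint)
      qed
      ultimately show ?thesis using Suc.IH U(2) Suc.prems(1) by blast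
    qed
  qed
  have "FT_vac \<in> U"
    by (rule vac[OF assms(3,4), of "Max (fcard ` Poly_Mapping.keys u)"]) auto
  then have basis: "bvec S \<in> U" for S
  proof (induction S)
    case (insert p S)
    then have "smul (koszul_sign p S) (bvec (finsert p S)) \<in> U"
      using U(2)[of "bvec S" "- int p - 1"] by (simp add: Phi_creat)
    then show ?case by (rule scaled) (simp add: koszul_sign_def)
  qed (simp add: FT_vac_def)
  have "v \<in> U" for v
  proof -
    have "v = lin bvec v"
      by (rule lin_ext) (simp_all add: Vector_Spaces.linear_iff vector_space_smul lin_add lin_smul)
    also have "\<dots> \<in> U"
      unfolding lin_def by (intro subspace_sum subspace_scale U basis)
    finally show ?thesis .
  qed
  then show ?thesis by auto
qed

section \<open>The modules \<open>F\<^bsub>-1\<^esub>\<close>\<close>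

(* Polynomials in the variables beta(-(m + 1/2)), m a natural number.
   beta l is the action of beta(l + 1/2). *)

type_synonym fock_basis = "nat \<Rightarrow>\<^sub>0 nat"

definition fock_deriv :: "nat \<Rightarrow> (fock_basis \<Rightarrow>\<^sub>0 complex) \<Rightarrow> (fock_basis \<Rightarrow>\<^sub>0 complex)" where
  "fock_deriv m =
    lin (\<lambda>e. Poly_Mapping.single (e - Poly_Mapping.single m 1) (of_nat (Poly_Mapping.lookup e m)))"

definition beta :: "int \<Rightarrow> (fock_basis \<Rightarrow>\<^sub>0 complex) \<Rightarrow> (fock_basis \<Rightarrow>\<^sub>0 complex)" where
  "beta l v =
    (if l < 0 then bvec (Poly_Mapping.single (nat (- l - 1)) 1) * v
     else smul (- (of_int l + 1 / 2)) (fock_deriv (nat l) v))"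

abbreviation fock_var :: "nat \<Rightarrow> (fock_basis \<Rightarrow>\<^sub>0 complex)" where
  "fock_var m \<equiv> bvec (Poly_Mapping.single m 1)"

lemma mult_smul: "u * smul c v = smul c (u * v)" for u v :: "fock_basis \<Rightarrow>\<^sub>0 complex"
  by (simp add: smul_def mult_map_scale_conv_mult mult_ac)

lemma fock_deriv_linear:
  "fock_deriv m (u + v) = fock_deriv m u + fock_deriv m v"
  "fock_deriv m (smul c v) = smul c (fock_deriv m v)"
  by (simp_all add: fock_deriv_def lin_add lin_smul)

lemma fock_deriv_single:
  "fock_deriv m (Poly_Mapping.single e c) =
     Poly_Mapping.single (e - Poly_Mapping.single m 1) (c * of_nat (Poly_Mapping.lookup e m))"
  by (simp add: fock_deriv_def smul_single)

lemma fock_deriv_var: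
  "fock_deriv m (fock_var p * v) = smul (if m = p then 1 else 0) v + fock_var p * fock_deriv m v"
proof (rule lin_ext[where f = "\<lambda>v. fock_deriv m (fock_var p * v)"])
  fix e :: fock_basis
  show "fock_deriv m (fock_var p * bvec e) =
      smul (if m = p then 1 else 0) (bvec e) + fock_var p * fock_deriv m (bvec e)"
  proof (cases "m = p")
    case True
    have "Poly_Mapping.single p 1 + (e - Poly_Mapping.single p 1) = e"
      if "Poly_Mapping.lookup e p \<noteq> 0"
      using that by (intro poly_mapping_eqI)
        (auto simp: lookup_add lookup_minus lookup_single when_def)
    with True show ?thesis
      by (cases "Poly_Mapping.lookup e p = 0")
        (simp_all add: mult_single fock_deriv_single lookup_add flip: single_add)
  next
    case False
    then have "Poly_Mapping.single p 1 + e - Poly_Mapping.single m 1 =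
        Poly_Mapping.single p 1 + (e - Poly_Mapping.single m 1)"
      by (intro poly_mapping_eqI) (auto simp: lookup_add lookup_minus lookup_single when_def)
    with False show ?thesis
      by (simp add: mult_single fock_deriv_single lookup_add lookup_single)
  qed
qed (auto simp: Vector_Spaces.linear_iff vector_space_smul fock_deriv_linear mult_smul
    smul_add_right distrib_left add_ac)

lemma fock_deriv_commute: "fock_deriv m (fock_deriv n v) = fock_deriv n (fock_deriv m v)"
proof (rule lin_ext[where f = "\<lambda>v. fock_deriv m (fock_deriv n v)"])
  fix e :: fock_basis
  have "e - Poly_Mapping.single n 1 - Poly_Mapping.single m 1 =
      e - Poly_Mapping.single m 1 - Poly_Mapping.single n 1"
    by (intro poly_mapping_eqI) (simp add: lookup_minus)
  then show "fock_deriv m (fock_deriv n (bvec e)) = fock_deriv n (fock_deriv m (bvec e))"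
    by (cases "m = n") (simp_all add: fock_deriv_single lookup_minus lookup_single mult_ac)
qed (auto simp: Vector_Spaces.linear_iff vector_space_smul fock_deriv_linear)

theorem beta_heisenberg:
  "beta k (beta l v) - beta l (beta k v) =
     smul (if k + l + 1 = 0 then - (of_int k + 1 / 2) else 0) v"
proof -
  have *: "beta k (beta l v) - beta l (beta k v) =
      smul (if k + l + 1 = 0 then - (of_int k + 1 / 2) else 0) v" if "k \<ge> 0" "l < 0" for k l
  proof -
    from that have "nat k = nat (- l - 1) \<longleftrightarrow> k + l + 1 = 0" by auto
    with that show ?thesis
      by (auto simp: beta_def fock_deriv_linear fock_deriv_var mult_smul smul_add_right
          simp del: One_nat_def)
  qed
  consider "k < 0" "l < 0" | "k \<ge> 0" "l \<ge> 0" | "k \<ge> 0" "l < 0" | "k < 0" "l \<ge> 0" by linarith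
  then show ?thesis
  proof cases
    case 1
    then show ?thesis by (simp add: beta_def mult.left_commute)
  next
    case 2
    then show ?thesis
      by (simp add: beta_def fock_deriv_linear fock_deriv_commute[of "nat k"] mult.commute)
  next
    case 3
    then show ?thesis by (rule *)
  next
    case 4
    then have "beta k (beta l v) - beta l (beta k v) =
        smul (- (if l + k + 1 = 0 then - (of_int l + 1 / 2) else 0)) v"
      using *[of l k] by (simp only: smul_minus_left flip: *) simp
    moreover have "complex_of_int l = - complex_of_int k - 1" if "k + l + 1 = 0"
    proof -
      from that have "l = - k - 1" by simp
      then show ?thesis by simp
    qed
    ultimately show ?thesis by (simp add: add.commute[of l k])
  qed
qed

definition beta_field :: "fock_basis series" where
  "beta_field n v = (if odd n then beta ((- n - 3) div 2) v else 0)"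

definition exponent_creat :: "fock_basis series" where
  "exponent_creat n v =
    (if odd n \<and> n > 0 then smul (1 / (of_int n / 2)) (beta ((- n - 1) div 2) v) else 0)"

definition exponent_annih :: "fock_basis series" where
  "exponent_annih n v =
    (if odd n \<and> n < 0 then smul (- (1 / (of_int (- n) / 2))) (beta ((- n - 1) div 2) v) else 0)"

definition Y_tw :: "nat \<Rightarrow> fock_basis series" where
  "Y_tw j = ser_scale (- (2 * \<i>) * (-1) ^ j)
     (ser_shift 1 (ser_mult (ser_exp exponent_creat) (ser_exp exponent_annih)))"

section \<open>The twisted affine Lie algebra\<close>

(* h_elt l = h(l + 1/2), xm_elt l = x^-(l + 1/2), xp_elt r = x^+(r) *)
datatype sl2_basis = K_elt | h_elt int | xm_elt int | xp_elt int

type_synonym sl2_hat = "sl2_basis \<Rightarrow>\<^sub>0 complex"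

fun basis_bracket :: "sl2_basis \<Rightarrow> sl2_basis \<Rightarrow> sl2_hat" where
  "basis_bracket K_elt _ = 0"
| "basis_bracket _ K_elt = 0"
| "basis_bracket (h_elt m) (h_elt n) =
     Poly_Mapping.single K_elt (if m + n + 1 = 0 then 2 * (of_int m + 1 / 2) else 0)"
| "basis_bracket (h_elt m) (xp_elt r) = Poly_Mapping.single (xm_elt (m + r)) 2"
| "basis_bracket (h_elt m) (xm_elt n) = Poly_Mapping.single (xp_elt (m + n + 1)) 2"
| "basis_bracket (xp_elt r) (xp_elt s) =
     Poly_Mapping.single K_elt (if r + s = 0 then 2 * of_int r else 0)"
| "basis_bracket (xp_elt r) (xm_elt m) = Poly_Mapping.single (h_elt (m + r)) (-2)"
| "basis_bracket (xm_elt m) (xm_elt n) =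
     Poly_Mapping.single K_elt (if m + n + 1 = 0 then - 2 * (of_int m + 1 / 2) else 0)"
| "basis_bracket (xp_elt r) (h_elt m) = Poly_Mapping.single (xm_elt (m + r)) (-2)"
| "basis_bracket (xm_elt n) (h_elt m) = Poly_Mapping.single (xp_elt (m + n + 1)) (-2)"
| "basis_bracket (xm_elt m) (xp_elt r) = Poly_Mapping.single (h_elt (m + r)) 2"

definition bracket :: "sl2_hat \<Rightarrow> sl2_hat \<Rightarrow> sl2_hat" where
  "bracket x y = lin (\<lambda>a. lin (\<lambda>b. basis_bracket a b) y) x"

lemma bracket_linear:
  "bracket (x + x') y = bracket x y + bracket x' y"
  "bracket x (y + y') = bracket x y + bracket x y'"
  "bracket (smul c x) y = smul c (bracket x y)"
  "bracket x (smul c y) = smul c (bracket x y)"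
  "bracket (- x) y = - bracket x y"
  "bracket x (- y) = - bracket x y"
  "bracket 0 y = 0" "bracket x 0 = 0"
proof -
  have add: "lin (\<lambda>a. f a + g a) v = lin f v + lin g v"
    for f g :: "sl2_basis \<Rightarrow> sl2_hat" and v
    by (simp add: lin_def smul_add_right sum.distrib)
  have scale: "lin (\<lambda>a. smul c (f a)) v = smul c (lin f v)"
    for f :: "sl2_basis \<Rightarrow> sl2_hat" and v c
    by (rule poly_mapping_eqI)
      (simp add: lin_def lookup_sum' sum_distrib_left algebra_simps)
  have neg: "- w = smul (-1) w" for w :: sl2_hat
    by (simp add: smul_minus_left)
  show "bracket (x + x') y = bracket x y + bracket x' y"
    "bracket x (y + y') = bracket x y + bracket x y'"
    "bracket (smul c x) y = smul c (bracket x y)"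
    "bracket x (smul c y) = smul c (bracket x y)"
    "bracket (- x) y = - bracket x y"
    "bracket x (- y) = - bracket x y"
    "bracket 0 y = 0" "bracket x 0 = 0"
    by (simp_all add: bracket_def neg lin_add lin_smul add scale) (simp add: lin_def)
qed

lemma bracket_basis [simp]:
  "bracket (Poly_Mapping.single a c) (Poly_Mapping.single b d) = smul (c * d) (basis_bracket a b)"
  by (simp add: bracket_def)

lemma sum_eq_zeroD:
  fixes a b c :: int
  shows "a + b = 0 \<Longrightarrow> a = - b" "a + (b + 1) = 0 \<Longrightarrow> a = - b - 1"
    "a + (b + (c + 1)) = 0 \<Longrightarrow> a = - b - c - 1"
  by simp_all

lemma bracket_antisym: "bracket x y = - bracket y x"
proof -
  have 1: "bracket (bvec a) (bvec b) = - bracket (bvec b) (bvec a)" for a b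
    by (cases a; cases b)
      (auto simp: algebra_simps single_uminus[symmetric]
        intro!: arg_cong[where f = "Poly_Mapping.single _"],
        (drule sum_eq_zeroD, clarify, simp add: algebra_simps)+)
  have lin: "Vector_Spaces.linear smul smul (bracket x)"
    "Vector_Spaces.linear smul smul (\<lambda>x. bracket x y)"
    "Vector_Spaces.linear smul smul (\<lambda>x. - bracket x y)"
    "Vector_Spaces.linear smul smul (\<lambda>y. - bracket x y)" for x y
    by (simp_all add: Vector_Spaces.linear_iff vector_space_smul bracket_linear)
      (simp_all flip: smul_minus_left add: smul_add_right poly_mapping_eqI)
  have 2: "bracket (bvec a) y = - bracket y (bvec a)" for a y
    by (rule lin_ext[OF lin(1) lin(3)]) (rule 1)
  show ?thesis
    by (rule lin_ext[OF lin(2) lin(4)]) (rule 2)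
qed

lemma bracket_alternating: "bracket x x = 0"
proof (rule poly_mapping_eqI)
  fix b
  have "Poly_Mapping.lookup (bracket x x) b = - Poly_Mapping.lookup (bracket x x) b"
    by (subst bracket_antisym) simp
  then show "Poly_Mapping.lookup (bracket x x) b = Poly_Mapping.lookup 0 b" by simp
qed

lemma bracket_jacobi:
  "bracket x (bracket y z) + bracket y (bracket z x) + bracket z (bracket x y) = 0"
proof -
  let ?J = "\<lambda>x y z. bracket x (bracket y z) + bracket y (bracket z x) + bracket z (bracket x y)"
  have lin0: "Vector_Spaces.linear smul smul (\<lambda>_::sl2_hat. 0::sl2_hat)"
    by (simp add: Vector_Spaces.linear_iff vector_space_smul)
  have lin: "Vector_Spaces.linear smul smul (\<lambda>x. ?J x y z)"
    "Vector_Spaces.linear smul smul (\<lambda>y. ?J x y z)"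
    "Vector_Spaces.linear smul smul (\<lambda>z. ?J x y z)" for x y z
    by (simp_all add: Vector_Spaces.linear_iff vector_space_smul bracket_linear smul_add_right)
  have 0: "?J (bvec a) (bvec b) (bvec c) = 0" for a b c
    by (cases a; cases b; cases c)
      (auto simp: bracket_linear smul_single algebra_simps single_add[symmetric],
        (drule sum_eq_zeroD(3), clarify, simp add: algebra_simps)+)
  have 1: "?J (bvec a) (bvec b) z = 0" for a b z
    by (rule lin_ext[OF lin(3) lin0]) (rule 0)
  have 2: "?J (bvec a) y z = 0" for a y z
    by (rule lin_ext[OF lin(2) lin0]) (rule 1)
  show ?thesis
    by (rule lin_ext[OF lin(1) lin0]) (rule 2)
qed

type_synonym 'v action = "sl2_hat \<Rightarrow> 'v \<Rightarrow> 'v"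

definition lie_module :: "(complex \<Rightarrow> 'v::ab_group_add \<Rightarrow> 'v) \<Rightarrow> 'v action \<Rightarrow> bool" where
  "lie_module scl \<rho> \<longleftrightarrow>
     vector_space scl \<and>
     (\<forall>x. Vector_Spaces.linear scl scl (\<rho> x)) \<and>
     (\<forall>v. Vector_Spaces.linear smul scl (\<lambda>x. \<rho> x v)) \<and>
     (\<forall>x y v. \<rho> (bracket x y) v = \<rho> x (\<rho> y v) - \<rho> y (\<rho> x v))"

definition has_level :: "(complex \<Rightarrow> 'v::ab_group_add \<Rightarrow> 'v) \<Rightarrow> 'v action \<Rightarrow> complex \<Rightarrow> bool" where
  "has_level scl \<rho> k \<longleftrightarrow> (\<forall>v. \<rho> (bvec K_elt) v = scl k v)"

definition restricted :: "'v::ab_group_add action \<Rightarrow> bool" where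
  "restricted \<rho> \<longleftrightarrow> (\<forall>v. \<exists>N. \<forall>n\<ge>N.
     \<rho> (bvec (h_elt n)) v = 0 \<and> \<rho> (bvec (xm_elt n)) v = 0 \<and> \<rho> (bvec (xp_elt n)) v = 0)"

(* Theta-twisted V_{-2}(sl_2)-modules are, by the standard identification, the restricted
   modules of level -2. *)
definition twisted_module :: "(complex \<Rightarrow> 'v::ab_group_add \<Rightarrow> 'v) \<Rightarrow> 'v action \<Rightarrow> bool" where
  "twisted_module scl \<rho> \<longleftrightarrow> lie_module scl \<rho> \<and> restricted \<rho> \<and> has_level scl \<rho> (-2)"

definition submodule ::
  "(complex \<Rightarrow> 'v::ab_group_add \<Rightarrow> 'v) \<Rightarrow> 'v action \<Rightarrow> 'v set \<Rightarrow> bool" where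
  "submodule scl \<rho> U \<longleftrightarrow> module.subspace scl U \<and> (\<forall>x. \<forall>u\<in>U. \<rho> x u \<in> U)"

definition irreducible_module ::
  "(complex \<Rightarrow> 'v::ab_group_add \<Rightarrow> 'v) \<Rightarrow> 'v action \<Rightarrow> bool" where
  "irreducible_module scl \<rho> \<longleftrightarrow>
     lie_module scl \<rho> \<and> (\<exists>v::'v. v \<noteq> 0) \<and> (\<forall>U. submodule scl \<rho> U \<longrightarrow> U = {0} \<or> U = UNIV)"

definition generated_by ::
  "(complex \<Rightarrow> 'v::ab_group_add \<Rightarrow> 'v) \<Rightarrow> 'v action \<Rightarrow> 'v \<Rightarrow> bool" where
  "generated_by scl \<rho> v \<longleftrightarrow> (\<forall>U. submodule scl \<rho> U \<and> v \<in> U \<longrightarrow> U = UNIV)"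

definition module_iso :: "(complex \<Rightarrow> 'v::ab_group_add \<Rightarrow> 'v) \<Rightarrow> 'v action
    \<Rightarrow> (complex \<Rightarrow> 'w::ab_group_add \<Rightarrow> 'w) \<Rightarrow> 'w action \<Rightarrow> bool" where
  "module_iso scl \<rho> scl' \<rho>' \<longleftrightarrow>
     (\<exists>f. Vector_Spaces.linear scl scl' f \<and> bij f \<and> (\<forall>x v. f (\<rho> x v) = \<rho>' x (f v)))"

section \<open>Highest weight modules\<close>

definition highest_weight_vector ::
  "(complex \<Rightarrow> 'v::ab_group_add \<Rightarrow> 'v) \<Rightarrow> 'v action \<Rightarrow> complex \<Rightarrow> 'v \<Rightarrow> bool" where
  "highest_weight_vector scl \<rho> a v \<longleftrightarrow> v \<noteq> 0 \<and>
     (\<forall>n>0. \<rho> (bvec (xp_elt n)) v = 0) \<and>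
     (\<forall>l\<ge>0. \<rho> (bvec (xm_elt l)) v = 0) \<and>
     (\<forall>l\<ge>0. \<rho> (bvec (h_elt l)) v = 0) \<and>
     \<rho> (bvec (xp_elt 0)) v = scl a v"

(* d acts as the degree derivation t d/dt, normalised by d v = 0. *)
definition degree_operator ::
  "(complex \<Rightarrow> 'v::ab_group_add \<Rightarrow> 'v) \<Rightarrow> 'v action \<Rightarrow> 'v \<Rightarrow> ('v \<Rightarrow> 'v) \<Rightarrow> bool" where
  "degree_operator scl \<rho> v d \<longleftrightarrow> Vector_Spaces.linear scl scl d \<and> d v = 0 \<and>
     (\<forall>u. d (\<rho> (bvec K_elt) u) = \<rho> (bvec K_elt) (d u)) \<and>
     (\<forall>r u. d (\<rho> (bvec (xp_elt r)) u) - \<rho> (bvec (xp_elt r)) (d u)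
        = scl (of_int r) (\<rho> (bvec (xp_elt r)) u)) \<and>
     (\<forall>l u. d (\<rho> (bvec (xm_elt l)) u) - \<rho> (bvec (xm_elt l)) (d u)
        = scl (of_int l + 1 / 2) (\<rho> (bvec (xm_elt l)) u)) \<and>
     (\<forall>l u. d (\<rho> (bvec (h_elt l)) u) - \<rho> (bvec (h_elt l)) (d u)
        = scl (of_int l + 1 / 2) (\<rho> (bvec (h_elt l)) u))"

(* (scl, rho) is a realisation of L(c0 Lambda_0 + c1 Lambda_1), where
   c0 Lambda_0 + c1 Lambda_1 = (k/2) (Lambda_0 + Lambda_1) + a (Lambda_1 - Lambda_0).
   The degree operator is part of the definition: at the critical level the modes of the
   Sugawara field are central, and the remaining conditions do not determine the module
   (for lambda = 1/2 or 2 lambda not in Z, and any complex mu, the module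
   F^(T_i)(lambda/z + mu) (x) F_{-1}^(T_j) satisfies them).
   As usual for affine weights, L is the graded one. *)
definition is_L :: "(complex \<Rightarrow> 'v::ab_group_add \<Rightarrow> 'v) \<Rightarrow> 'v action \<Rightarrow> complex \<Rightarrow> complex \<Rightarrow> bool" where
  "is_L scl \<rho> c0 c1 \<longleftrightarrow> (\<exists>k a v d.
     c0 = k / 2 - a \<and> c1 = k / 2 + a \<and>
     irreducible_module scl \<rho> \<and> has_level scl \<rho> k \<and> generated_by scl \<rho> v \<and>
     highest_weight_vector scl \<rho> a v \<and> degree_operator scl \<rho> v d)"

(* L(c0 Lambda_0 + c1 Lambda_1) is only defined up to isomorphism: (scl, rho) is a realisation
   of it, and is isomorphic to every realisation on the type 'w. *)
definition iso_to_L :: "'w::ab_group_add itself \<Rightarrow> (complex \<Rightarrow> 'v::ab_group_add \<Rightarrow> 'v) \<Rightarrow> 'v action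
    \<Rightarrow> complex \<Rightarrow> complex \<Rightarrow> bool" where
  "iso_to_L (_ :: 'w itself) scl \<rho> c0 c1 \<longleftrightarrow> is_L scl \<rho> c0 c1 \<and>
     (\<forall>(scl' :: complex \<Rightarrow> 'w \<Rightarrow> 'w) \<rho>'. is_L scl' \<rho>' c0 c1 \<longrightarrow> module_iso scl \<rho> scl' \<rho>')"

section \<open>The action on the tensor product\<close>

type_synonym FF_basis = "clifford_basis \<times> fock_basis"
type_synonym FF_space = "FF_basis \<Rightarrow>\<^sub>0 complex"

definition FF_X :: "complex fls \<Rightarrow> nat \<Rightarrow> nat \<Rightarrow> FF_basis series" where
  "FF_X \<chi> i j =
     ser_scale (1 / complex_of_real (sqrt 2)) (ser_tens (G_field \<chi> i) (Y_tw j))"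

definition FF_h :: "complex fls \<Rightarrow> FF_basis series" where
  "FF_h \<chi> = ser_add (ser_scale (-2) (ser_tens ser_one beta_field))
                    (ser_scale 2 (ser_tens (T_field \<chi>) ser_one))"

fun FF_basis_act :: "complex fls \<Rightarrow> nat \<Rightarrow> nat \<Rightarrow> sl2_basis \<Rightarrow> FF_space \<Rightarrow> FF_space" where
  "FF_basis_act \<chi> i j K_elt v = smul (-2) v"
| "FF_basis_act \<chi> i j (h_elt l) v = FF_h \<chi> (- 2 * l - 3) v"
| "FF_basis_act \<chi> i j (xm_elt l) v = smul 2 (FF_X \<chi> i j (- 2 * l - 3) v)"
| "FF_basis_act \<chi> i j (xp_elt r) v = smul 2 (FF_X \<chi> i j (- 2 * r - 2) v)"

definition FF :: "complex fls \<Rightarrow> nat \<Rightarrow> nat \<Rightarrow> FF_space action" where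
  "FF \<chi> i j x v = lin (\<lambda>b. FF_basis_act \<chi> i j b v) x"

(* The generating series X_+(z) and h(z) of an action. *)
definition X_plus :: "('a \<Rightarrow>\<^sub>0 complex) action \<Rightarrow> 'a series" where
  "X_plus \<rho> n v = smul (1 / 2)
     (if even n then \<rho> (bvec (xp_elt ((- n - 2) div 2))) v
      else \<rho> (bvec (xm_elt ((- n - 3) div 2))) v)"

definition h_series :: "('a \<Rightarrow>\<^sub>0 complex) action \<Rightarrow> 'a series" where
  "h_series \<rho> n v = (if odd n then \<rho> (bvec (h_elt ((- n - 3) div 2))) v else 0)"

(* fls_X is z^(1/2) *)
definition over_z :: "complex \<Rightarrow> complex fls" where
  "over_z c = fls_const c / fls_X ^ 2"

lemma fls_nth_over_z: "fls_nth (over_z c) n = (if n = -2 then c else 0)"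
proof -
  have "fls_const c / (fls_X ^ 2 :: complex fls) = fls_shift 2 (fls_const c)"
    by (simp add: divide_inverse fls_inverse_X_power fls_X_inv_power_times_conv_shift)
  then show ?thesis by (simp add: over_z_def)
qed

end

theory Submission
  imports Defs
begin

text \<open>
  The vertex operator satisfies \<open>[\<beta>(k), Y(z)] = - z^k Y(z)\<close> for all \<open>k\<close>, and this together with its
  vacuum coefficient determines it: moving creation operators to the left and annihilation
  operators to the right reduces every matrix coefficient to vacuum ones. The same principle applies
  to the defects of all identities to be proved. For the commutator of two fields \<open>X\<^sub>+\<close> it leaves the
  vacuum coefficient, in which two vertex operators contribute the factor
  \<open>ts (t + s) / (t - s)\<close> with \<open>t = z^(1/2)\<close>, \<open>s = w^(1/2)\<close>; its expansions in the two regions differ by a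
  delta function, so that only a finite alternating sum of the scalars \<open>{G(r), G(s)}\<close> survives.

  A submodule is stable under the Heisenberg algebra, hence of the form \<open>F \<otimes> M\<close>, and the vacuum
  coefficient of \<open>X\<^sub>+\<close> shows that \<open>F\<close> is stable under \<open>G\<close>. For \<open>\<chi> = \<lambda>/z\<close> the modes of \<open>G\<close> are
  multiples of the \<open>\<Phi>(r)\<close>, nonzero for \<open>r \<noteq> 0\<close> under the assumption on \<open>\<lambda>\<close>, and these act irreducibly.
  Two graded irreducible modules with the same highest weight are isomorphic because the
  submodule of their direct sum generated by the pair of highest weight vectors is a graph: its
  degree zero part is a line.
\<close>

section \<open>Linear operators on free vector spaces\<close>

text \<open>The factor \<open>(t + s) / (t - s)\<close> is antisymmetric, so anticommuting modes of
  \<open>G\<close> give commutator relations for \<open>X_+\<close>, although the factors are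
  tensored without signs. The anticommutator of \<open>G(t)\<close> and \<open>G(s)\<close> is
  supported at \<open>t = -s\<close>; the numerator lowers the order of this distribution by one, so
  that \<open>\<chi>(t) \<chi>(-t)\<close> drops out and only a first derivative (the level) and the
  half-odd part of \<chi> (the scalar part of \<open>h\<close>) remain. The obstacle is the
  denominator: \<open>G(t) G(s)\<close> times a delta function at \<open>t = s\<close> has infinite
  sums as coefficients. Hence the two expansions are compared after multiplication by
  \<open>1 - s/t\<close>, where only finite sums occur. What this loses is a series constant along
  each line of fixed total exponent, hence symmetric in \<open>t\<close> and \<open>s\<close>, while
  the expression compared is antisymmetric. In the uniqueness part, comparing two given modules
  inside their direct sum avoids a universal highest weight module and its PBW basis.\<close>

abbreviation linop :: "(('a \<Rightarrow>\<^sub>0 complex) \<Rightarrow> ('b \<Rightarrow>\<^sub>0 complex)) \<Rightarrow> bool" where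
  "linop \<equiv> Vector_Spaces.linear smul smul"

lemma linop_iff: "linop f \<longleftrightarrow> (\<forall>u v. f (u + v) = f u + f v) \<and> (\<forall>c v. f (smul c v) = smul c (f v))"
  by (simp add: Vector_Spaces.linear_iff vector_space_smul)

lemma linopI:
  "(\<And>u v. f (u + v) = f u + f v) \<Longrightarrow> (\<And>c v. f (smul c v) = smul c (f v)) \<Longrightarrow> linop f"
  by (simp add: linop_iff)

lemma linop_add: "linop f \<Longrightarrow> f (u + v) = f u + f v"
  and linop_smul: "linop f \<Longrightarrow> f (smul c v) = smul c (f v)"
  by (simp_all add: linop_iff)

lemma linop_zero: "linop f \<Longrightarrow> f 0 = 0"
  using linop_smul[of f 0 0] by simp

lemma neg_eq_smul: "- v = smul (-1) v"
  by (simp add: smul_minus_left)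

lemma linop_minus: "linop f \<Longrightarrow> f (- v) = - f v"
  by (simp add: neg_eq_smul linop_smul)

lemma linop_diff: "linop f \<Longrightarrow> f (u - v) = f u - f v"
  using linop_add[of f u "- v"] by (simp add: linop_minus)

lemma smul_minus_right: "smul c (- v) = - smul c v"
  and smul_diff_right: "smul c (u - v) = smul c u - smul c v"
  and smul_diff_left: "smul (a - b) v = smul a v - smul b v"
  by (rule poly_mapping_eqI, simp add: lookup_minus right_diff_distrib left_diff_distrib)+

lemma linop_sum: "linop f \<Longrightarrow> f (sum g A) = (\<Sum>x\<in>A. f (g x))"
  by (induction A rule: infinite_finite_induct) (auto simp: linop_zero linop_add)

lemma linop_smul_const: "linop (smul c)"
  by (rule linopI) (auto simp: smul_add_right mult.commute)

lemma smul_sum: "smul c (sum f A) = (\<Sum>x\<in>A. smul c (f x))"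
  by (rule linop_sum[OF linop_smul_const])

lemma linop_id: "linop (\<lambda>v. v)"
  by (simp add: linop_iff)

lemma linop_const_zero: "linop (\<lambda>v. 0)"
  by (simp add: linop_iff)

lemma linop_comp: "linop f \<Longrightarrow> linop g \<Longrightarrow> linop (\<lambda>v. f (g v))"
  by (simp add: linop_iff)

lemma linop_plus: "linop f \<Longrightarrow> linop g \<Longrightarrow> linop (\<lambda>v. f v + g v)"
  by (simp add: linop_iff smul_add_right)

lemma linop_minus_fun: "linop f \<Longrightarrow> linop g \<Longrightarrow> linop (\<lambda>v. f v - g v)"
  by (simp add: linop_iff smul_diff_right)

lemma linop_uminus_fun: "linop f \<Longrightarrow> linop (\<lambda>v. - f v)"
  by (simp add: linop_iff smul_minus_right)

lemma linop_scaled: "linop f \<Longrightarrow> linop (\<lambda>v. smul c (f v))"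
  by (simp add: linop_iff smul_add_right mult.commute)

lemma linop_sum_fun: "(\<And>x. x \<in> A \<Longrightarrow> linop (f x)) \<Longrightarrow> linop (\<lambda>v. \<Sum>x\<in>A. f x v)"
  by (simp add: linop_iff sum.distrib smul_sum)

lemma linop_if: "linop f \<Longrightarrow> linop g \<Longrightarrow> linop (\<lambda>v. if P then f v else g v)"
  by (cases P) simp_all

lemmas linop_intros = linop_if linear_lin linop_id linop_const_zero linop_plus linop_minus_fun
  linop_uminus_fun linop_scaled linop_sum_fun

lemma lin_bvec: "lin bvec v = v"
  by (rule lin_ext) (simp_all add: linop_intros)

lemma basis_induct [case_names zero add]:
  assumes "P 0" "\<And>u a c. P u \<Longrightarrow> P (smul c (bvec a) + u)"
  shows "P v"
proof -
  have "P (\<Sum>a\<in>A. smul (Poly_Mapping.lookup v a) (bvec a))" if "finite A" for A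
    using that by induction (use assms in auto)
  from this[of "Poly_Mapping.keys v"] show ?thesis
    using lin_bvec[of v] by (simp add: lin_def)
qed

text \<open>\<open>Sum_any\<close> is 0 on an infinite support, and \<open>g\<close> could make an
  infinite support finite; so finiteness is required of \<open>f\<close> itself.\<close>

lemma linop_Sum_any:
  assumes "linop g" "finite {p. f p \<noteq> 0}"
  shows "g (Sum_any f) = Sum_any (\<lambda>p. g (f p))"
proof -
  have "{p. g (f p) \<noteq> 0} \<subseteq> {p. f p \<noteq> 0}"
    using linop_zero[OF assms(1)] by auto
  then show ?thesis
    by (simp add: Sum_any.expand_set[of f] Sum_any.expand_superset[OF assms(2)] linop_sum[OF assms(1)])
qed

lemma linop_Sum_any_fun:
  assumes "\<And>p. linop (F p)" "\<And>v. finite {p. F p v \<noteq> 0}"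
  shows "linop (\<lambda>v. Sum_any (\<lambda>p. F p v))"
proof (rule linopI)
  fix u v
  show "Sum_any (\<lambda>p. F p (u + v)) = Sum_any (\<lambda>p. F p u) + Sum_any (\<lambda>p. F p v)"
    by (simp add: linop_add[OF assms(1)] Sum_any.distrib assms(2))
next
  fix c v
  show "Sum_any (\<lambda>p. F p (smul c v)) = smul c (Sum_any (\<lambda>p. F p v))"
    by (simp add: linop_smul[OF assms(1)] linop_Sum_any[OF linop_smul_const assms(2)])
qed

lemma Sum_any_diff:
  fixes f g :: "'b \<Rightarrow> ('a \<Rightarrow>\<^sub>0 complex)"
  assumes "finite {p. f p \<noteq> 0}" "finite {p. g p \<noteq> 0}"
  shows "Sum_any (\<lambda>p. f p - g p) = Sum_any f - Sum_any g"
  using Sum_any.distrib[of f "\<lambda>p. - g p"] linop_Sum_any[OF linop_uminus_fun[OF linop_id] assms(2)] assms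
  by simp

lemma Sum_any_sum:
  assumes "finite A" "\<And>p. p \<notin> A \<Longrightarrow> f p = 0"
  shows "Sum_any f = sum f A"
  by (rule Sum_any.expand_superset) (use assms in auto)

lemma Sum_any_reindex:
  assumes "bij h"
  shows "Sum_any (\<lambda>p. f (h p)) = Sum_any f"
proof -
  have "{p. f p \<noteq> 0} = h ` {p. f (h p) \<noteq> 0}"
    using assms by (auto simp: bij_def surj_def image_iff)
  then have "Sum_any f = sum f (h ` {p. f (h p) \<noteq> 0})"
    by (simp add: Sum_any.expand_set)
  also have "\<dots> = (\<Sum>p | f (h p) \<noteq> 0. f (h p))"
    by (subst sum.reindex) (use assms in \<open>auto simp: bij_def inj_on_def\<close>)
  finally show ?thesis by (simp add: Sum_any.expand_set)
qed

section \<open>Tensor products\<close>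

lemma lookup_tens [simp]:
  "Poly_Mapping.lookup (tens u v) (a, b) = Poly_Mapping.lookup u a * Poly_Mapping.lookup v b"
proof -
  have "Poly_Mapping.lookup (lin (\<lambda>b. bvec (a', b)) v) (a, b) =
      (if a' = a then Poly_Mapping.lookup v b else 0)" for a'
    by (simp add: lin_def lookup_sum' lookup_single when_def in_keys_iff if_distrib cong: if_cong)
  then show ?thesis
    by (simp add: tens_def lin_def[of _ u] lookup_sum' in_keys_iff if_distrib[of "(*) _"] cong: if_cong del: if_split)
qed

lemma tens_eqI: "(\<And>a b. Poly_Mapping.lookup u (a, b) = Poly_Mapping.lookup v (a, b)) \<Longrightarrow> u = v"
  by (rule poly_mapping_eqI) auto

lemma tens_bvec [simp]: "tens (bvec a) (bvec b) = bvec (a, b)"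
  by (rule tens_eqI) (simp add: lookup_single when_def)

lemma tens_bilinear:
  "tens (u + u') v = tens u v + tens u' v" "tens u (v + v') = tens u v + tens u v'"
  "tens (smul c u) v = smul c (tens u v)" "tens u (smul c v) = smul c (tens u v)"
  "tens 0 v = 0" "tens u 0 = 0"
  by (auto intro!: tens_eqI simp: lookup_add algebra_simps)

lemma linop_tens_left: "linop f \<Longrightarrow> linop (\<lambda>u. tens (f u) v)"
  and linop_tens_right: "linop g \<Longrightarrow> linop (\<lambda>v. tens u (g v))"
  by (simp_all add: linop_iff tens_bilinear)

lemma linop_tens_op: "linop (tens_op A B)"
  by (simp add: tens_op_def linear_lin)

lemma tens_op_bvec: "tens_op A B (bvec (a, b)) = tens (A (bvec a)) (B (bvec b))"
  by (simp add: tens_op_def)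

lemma tens_op_tens:
  assumes "linop A" "linop B"
  shows "tens_op A B (tens u v) = tens (A u) (B v)"
proof (rule lin_ext[where v = u])
  show "linop (\<lambda>u. tens_op A B (tens u v))" "linop (\<lambda>u. tens (A u) (B v))"
    by (auto intro!: linop_tens_left linop_comp[OF linop_tens_op] assms linop_id)
  fix a
  show "tens_op A B (tens (bvec a) v) = tens (A (bvec a)) (B v)"
    by (rule lin_ext[where v = v])
      (auto intro!: linop_tens_right linop_comp[OF linop_tens_op] assms linop_id simp: tens_op_bvec)
qed

lemma tens_ext:
  assumes "linop f" "linop g" "\<And>a b. f (tens (bvec a) (bvec b)) = g (tens (bvec a) (bvec b))"
  shows "f v = g v"
  by (rule lin_ext[OF assms(1,2)]) (use assms(3) in \<open>auto simp del: tens_bvec simp flip: tens_bvec\<close>)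

section \<open>Fields\<close>

text \<open>The usual condition on a field: on each vector only finitely many negative powers occur.
  It makes products with Laurent series and tensor products honest finite sums.\<close>

definition truncated :: "'a series \<Rightarrow> bool" where
  "truncated A \<longleftrightarrow> (\<forall>n. linop (A n)) \<and> (\<forall>v. \<exists>N. \<forall>n<N. A n v = 0)"

lemma truncated_linop: "truncated A \<Longrightarrow> linop (A n)"
  by (simp add: truncated_def)

lemma truncatedE:
  assumes "truncated A"
  obtains N where "\<And>n. n < N \<Longrightarrow> A n v = 0"
  using assms unfolding truncated_def by blast

lemma truncatedI:
  assumes "\<And>n. linop (A n)" "\<And>a. \<exists>N. \<forall>n<N. A n (bvec a) = 0"
  shows "truncated A"
  unfolding truncated_def
proof (intro conjI allI assms(1))
  fix v
  show "\<exists>N. \<forall>n<N. A n v = 0"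
  proof (induction v rule: basis_induct)
    case zero
    then show ?case by (simp add: linop_zero[OF assms(1)])
  next
    case (add u a c)
    obtain N where N: "\<forall>n<N. A n u = 0" using add by blast
    obtain N' where N': "\<forall>n<N'. A n (bvec a) = 0" using assms(2) by blast
    show ?case
      by (rule exI[of _ "min N N'"])
        (use N N' in \<open>auto simp: linop_add[OF assms(1)] linop_smul[OF assms(1)]\<close>)
  qed
qed

text \<open>A general tensor has no factors to apply truncation to, so separate bounds for the two
  series are collected over its basis vectors by taking minima.\<close>

lemma ser_tens_bounds:
  assumes "truncated A" "truncated B"
  shows "\<exists>N N'. \<forall>p q. p < N \<or> q < N' \<longrightarrow> tens_op (A p) (B q) v = 0"
proof (induction v rule: basis_induct)
  case zero
  then show ?case by (simp add: linop_zero[OF linop_tens_op])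
next
  case (add u x c)
  obtain a b where x: "x = (a, b)" by force
  obtain N N' where N: "\<forall>p q. p < N \<or> q < N' \<longrightarrow> tens_op (A p) (B q) u = 0" using add by blast
  obtain L where L: "\<And>p. p < L \<Longrightarrow> A p (bvec a) = 0" using truncatedE[OF assms(1)] by blast
  obtain L' where L': "\<And>p. p < L' \<Longrightarrow> B p (bvec b) = 0" using truncatedE[OF assms(2)] by blast
  show ?case
    by (rule exI[of _ "min N L"], rule exI[of _ "min N' L'"])
      (use N L L' in \<open>auto simp: x linop_add[OF linop_tens_op] linop_smul[OF linop_tens_op]
        tens_op_bvec tens_bilinear\<close>)
qed

lemma ser_tens_finite:
  assumes "truncated A" "truncated B"
  shows "finite {p. tens_op (A p) (B (n - p)) v \<noteq> 0}"
proof -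
  obtain N N' where "\<forall>p q. p < N \<or> q < N' \<longrightarrow> tens_op (A p) (B q) v = 0"
    using ser_tens_bounds[OF assms] by blast
  then have "{p. tens_op (A p) (B (n - p)) v \<noteq> 0} \<subseteq> {N..n - N'}"
    by force
  then show ?thesis by (rule finite_subset) simp
qed

lemma linop_ser_tens: "truncated A \<Longrightarrow> truncated B \<Longrightarrow> linop (ser_tens A B n)"
  unfolding ser_tens_def by (rule linop_Sum_any_fun[OF linop_tens_op ser_tens_finite])

lemma truncated_ser_tens:
  assumes "truncated A" "truncated B"
  shows "truncated (ser_tens A B)"
  unfolding truncated_def
proof (intro conjI allI linop_ser_tens assms)
  fix v
  obtain N N' where N: "\<forall>p q. p < N \<or> q < N' \<longrightarrow> tens_op (A p) (B q) v = 0"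
    using ser_tens_bounds[OF assms] by blast
  have "ser_tens A B n v = 0" if "n < N + N'" for n
  proof -
    have "tens_op (A p) (B (n - p)) v = 0" for p
      using N that by (cases "p < N") auto
    then show ?thesis by (simp add: ser_tens_def)
  qed
  then show "\<exists>M. \<forall>n<M. ser_tens A B n v = 0" by blast
qed

lemma ser_tens_tens:
  assumes "truncated A" "truncated B"
  shows "ser_tens A B n (tens u v) = Sum_any (\<lambda>p. tens (A p u) (B (n - p) v))"
  by (simp add: ser_tens_def tens_op_tens truncated_linop assms)

lemma lookup_Sum_any:
  assumes "finite {p. f p \<noteq> 0}"
  shows "Poly_Mapping.lookup (Sum_any f) b = Sum_any (\<lambda>p. Poly_Mapping.lookup (f p) b)"
proof -
  have "{p. Poly_Mapping.lookup (f p) b \<noteq> 0} \<subseteq> {p. f p \<noteq> 0}" by auto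
  then show ?thesis
    by (simp add: Sum_any.expand_set[of f] Sum_any.expand_superset[OF assms] lookup_sum')
qed

section \<open>The Heisenberg algebra on the Fock space\<close>

text \<open>Monomials grow by one variable at a time, which is the action of one creation
  operator.\<close>

lemma fock_basis_induct [case_names zero add]:
  fixes e :: fock_basis
  assumes "P 0" "\<And>e m. P e \<Longrightarrow> P (e + Poly_Mapping.single m 1)"
  shows "P e"
proof -
  have single: "P (e + Poly_Mapping.single m k)" if "P e" for e m k
  proof (induction k)
    case 0
    then show ?case using that by simp
  next
    case (Suc k)
    have "e + Poly_Mapping.single m (Suc k) =
        (e + Poly_Mapping.single m k) + Poly_Mapping.single m 1"
      by (simp add: add.assoc flip: single_add)
    with assms(2)[OF Suc] show ?case by simp
  qed
  show ?thesis
  proof (induction e rule: update_induct)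
    case (update f a b)
    then have "Poly_Mapping.update a b f = f + Poly_Mapping.single a b"
      by (intro poly_mapping_eqI)
        (auto simp: lookup_update lookup_add lookup_single when_def in_keys_iff)
    with single[OF update(3)] show ?case by simp
  qed (rule assms(1))
qed

lemma linop_beta: "linop (beta l)"
  by (simp add: linop_iff beta_def distrib_left mult_smul fock_deriv_linear smul_add_right
      mult.commute[where 'a = complex])

lemma beta_creat_bvec: "beta (- int m - 1) (bvec e) = bvec (e + Poly_Mapping.single m 1)"
  by (simp add: beta_def mult_single add.commute)

text \<open>Differentiation read on coefficients. The factor never vanishes, so coefficients of
  \<open>w\<close> at higher monomials can be recovered from those of its derivatives.\<close>

lemma lookup_beta_annih:
  "Poly_Mapping.lookup (beta (int m) w) e =
     - (of_nat m + 1 / 2) * (of_nat (Poly_Mapping.lookup e m) + 1) *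
     Poly_Mapping.lookup w (e + Poly_Mapping.single m 1)"
proof (induction w rule: basis_induct)
  case zero
  then show ?case by (simp add: linop_zero[OF linop_beta])
next
  case (add u a c)
  have a: "a - Poly_Mapping.single m 1 = e \<longleftrightarrow> a = e + Poly_Mapping.single m 1"
    if "Poly_Mapping.lookup a m \<noteq> 0"
  proof
    assume *: "a - Poly_Mapping.single m 1 = e"
    show "a = e + Poly_Mapping.single m 1"
      unfolding *[symmetric] using that
      by (intro poly_mapping_eqI) (auto simp: lookup_add lookup_minus lookup_single when_def)
  qed auto
  have "Poly_Mapping.lookup (beta (int m) (bvec a)) e =
     - (of_nat m + 1 / 2) * (of_nat (Poly_Mapping.lookup e m) + 1) *
     Poly_Mapping.lookup (bvec a) (e + Poly_Mapping.single m 1)"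
    using a by (cases "Poly_Mapping.lookup a m = 0")
      (auto simp: beta_def fock_deriv_single lookup_single when_def lookup_add)
  with add show ?case
    by (simp only: linop_add[OF linop_beta] linop_smul[OF linop_beta] lookup_add lookup_smul
        distrib_left mult.left_commute[of c])
qed

lemma lookup_beta_creat_zero:
  assumes "l < 0"
  shows "Poly_Mapping.lookup (beta l w) 0 = 0"
proof (induction w rule: basis_induct)
  case zero
  then show ?case by (simp add: linop_zero[OF linop_beta])
next
  case (add u a c)
  have l: "l = - int (nat (- l - 1)) - 1" using assms by simp
  have "a + Poly_Mapping.single m 1 \<noteq> (0 :: fock_basis)" for m :: nat
    by (metis add_is_0 lookup_add lookup_single_eq lookup_zero zero_neq_one)
  then have "Poly_Mapping.lookup (beta l (bvec a)) 0 = 0"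
    by (subst l, subst beta_creat_bvec) (simp add: lookup_single when_def)
  with add show ?case
    by (simp add: linop_add[OF linop_beta] linop_smul[OF linop_beta] lookup_add)
qed

lemma beta_commutator:
  "beta k (beta l v) = beta l (beta k v) + smul (if k + l + 1 = 0 then - (of_int k + 1 / 2) else 0) v"
  using beta_heisenberg[of k l v] by (simp add: algebra_simps)

section \<open>Heisenberg operators on a tensor product with the Fock space\<close>

definition tbeta :: "int \<Rightarrow> ('a \<times> fock_basis \<Rightarrow>\<^sub>0 complex) \<Rightarrow> ('a \<times> fock_basis \<Rightarrow>\<^sub>0 complex)" where
  "tbeta l = tens_op (\<lambda>v. v) (beta l)"

lemma linop_tbeta: "linop (tbeta l)"
  by (simp add: tbeta_def linop_tens_op)

lemma tbeta_tens: "tbeta l (tens u v) = tens u (beta l v)"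
  by (simp add: tbeta_def tens_op_tens linop_id linop_beta)

lemma tbeta_creat_bvec: "tbeta (- int m - 1) (bvec (a, e)) = bvec (a, e + Poly_Mapping.single m 1)"
  by (simp add: tbeta_def tens_op_bvec beta_creat_bvec)

lemma tbeta_commutator:
  "tbeta k (tbeta l v) =
     tbeta l (tbeta k v) + smul (if k + l + 1 = 0 then - (of_int k + 1 / 2) else 0) v"
proof (rule tens_ext[where f = "\<lambda>v. tbeta k (tbeta l v)"])
  show "linop (\<lambda>v. tbeta k (tbeta l v))"
    "linop (\<lambda>v. tbeta l (tbeta k v) + smul (if k + l + 1 = 0 then - (of_int k + 1 / 2) else 0) v)"
    by (simp_all only: linop_plus linop_comp linop_tbeta linop_smul_const)
qed (simp only: tbeta_tens beta_commutator[of k l] tens_bilinear)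

lemma lookup_tbeta_annih:
  "Poly_Mapping.lookup (tbeta (int m) w) (a, e) =
     - (of_nat m + 1 / 2) * (of_nat (Poly_Mapping.lookup e m) + 1) *
     Poly_Mapping.lookup w (a, e + Poly_Mapping.single m 1)"
proof (induction w rule: basis_induct)
  case (add u x c)
  have "Poly_Mapping.lookup (tbeta (int m) (bvec x)) (a, e) =
     - (of_nat m + 1 / 2) * (of_nat (Poly_Mapping.lookup e m) + 1) *
     Poly_Mapping.lookup (bvec x) (a, e + Poly_Mapping.single m 1)"
    by (cases x) (simp add: tbeta_def tens_op_bvec lookup_beta_annih lookup_single when_def)
  with add show ?case
    by (simp only: linop_add[OF linop_tbeta] linop_smul[OF linop_tbeta] lookup_add lookup_smul
        distrib_left mult.left_commute[of c])
qed (simp add: linop_zero[OF linop_tbeta])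

lemma lookup_tbeta_annih_eq_0:
  "Poly_Mapping.lookup (tbeta (int m) w) (a, e) = 0 \<longleftrightarrow>
     Poly_Mapping.lookup w (a, e + Poly_Mapping.single m 1) = 0"
proof -
  have "of_nat m + 1 / 2 \<noteq> (0 :: complex)" "of_nat (Poly_Mapping.lookup e m) + 1 \<noteq> (0 :: complex)"
    by (simp_all add: complex_eq_iff)
  then show ?thesis
    unfolding lookup_tbeta_annih mult_eq_0_iff neg_equal_0_iff_equal by blast
qed

lemma lookup_tbeta_creat_zero:
  assumes "l < 0"
  shows "Poly_Mapping.lookup (tbeta l w) (a, 0) = 0"
proof (induction w rule: basis_induct)
  case (add u x c)
  have "Poly_Mapping.lookup (tbeta l (bvec x)) (a, 0) = 0"
    by (cases x) (simp add: tbeta_def tens_op_bvec lookup_beta_creat_zero assms)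
  with add show ?case
    by (simp add: linop_add[OF linop_tbeta] linop_smul[OF linop_tbeta] lookup_add)
qed (simp add: linop_zero[OF linop_tbeta])

lemma tbeta_annih_vac: "l \<ge> 0 \<Longrightarrow> tbeta l (bvec (a, 0)) = 0"
  unfolding tbeta_def tens_op_bvec beta_def fock_deriv_single by (simp add: tens_bilinear)

text \<open>Commuting creation operators to the left and annihilation operators to the right reduces
  all matrix coefficients of a family that is stable under commutators with \<open>tbeta\<close> to vacuum
  matrix coefficients.\<close>

lemma covariant_family_zero:
  fixes Z :: "'x \<Rightarrow> ('a \<times> fock_basis \<Rightarrow>\<^sub>0 complex) \<Rightarrow> ('a \<times> fock_basis \<Rightarrow>\<^sub>0 complex)"
  assumes lin: "\<And>x. linop (Z x)"
    and cov: "\<And>x l. \<exists>c y c' y'. \<forall>v. tbeta l (Z x v) - Z x (tbeta l v) = smul c (Z y v) + smul c' (Z y' v)"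
    and vac: "\<And>x a b. Poly_Mapping.lookup (Z x (bvec (a, 0))) (b, 0) = 0"
  shows "Z x v = 0"
proof -
  \<comment> \<open>Proved for all \<open>x\<close> at once, because the commutator leads to other
    members of the family. An annihilation operator kills the vacuum argument, so applying it to the
    result gives a combination of members with vacuum argument.\<close>
  have 1: "\<forall>x. Poly_Mapping.lookup (Z x (bvec (a, 0))) (b, e) = 0" for a b e
  proof (induction e rule: fock_basis_induct)
    case zero
    then show ?case using vac by simp
  next
    case (add e m)
    show ?case
    proof
      fix x
      obtain c y c' y' where
        "\<forall>v. tbeta (int m) (Z x v) - Z x (tbeta (int m) v) = smul c (Z y v) + smul c' (Z y' v)"
        using cov[of "int m" x] by (elim exE)
      from spec[OF this, of "bvec (a, 0)"]
      have "tbeta (int m) (Z x (bvec (a, 0))) =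
          smul c (Z y (bvec (a, 0))) + smul c' (Z y' (bvec (a, 0)))"
        by (simp add: tbeta_annih_vac linop_zero[OF lin])
      then have "Poly_Mapping.lookup (tbeta (int m) (Z x (bvec (a, 0)))) (b, e) = 0"
        using add by (simp add: lookup_add)
      then show "Poly_Mapping.lookup (Z x (bvec (a, 0))) (b, e + Poly_Mapping.single m 1) = 0"
        by (simp only: lookup_tbeta_annih_eq_0)
    qed
  qed
  \<comment> \<open>The same on the argument side: a creation operator that builds up the argument
    is moved to the left.\<close>
  have 2: "\<forall>x. Z x (bvec (a, e)) = 0" for a e
  proof (induction e rule: fock_basis_induct)
    case zero
    show ?case using 1 by (auto intro!: tens_eqI)
  next
    case (add e m)
    show ?case
    proof
      fix x
      obtain c y c' y' where "\<forall>v. tbeta (- int m - 1) (Z x v) - Z x (tbeta (- int m - 1) v) =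
          smul c (Z y v) + smul c' (Z y' v)"
        using cov[of "- int m - 1" x] by (elim exE)
      from spec[OF this, of "bvec (a, e)"] show "Z x (bvec (a, e + Poly_Mapping.single m 1)) = 0"
        using add by (simp add: tbeta_creat_bvec linop_zero[OF linop_tbeta])
    qed
  qed
  show ?thesis
    by (rule lin_ext[OF lin linop_const_zero]) (simp add: 2 split_paired_all)
qed

section \<open>Exponentials of one-sided series\<close>

text \<open>Covers both exponents of the vertex operator: \<sigma> is 1 for creation and -1 for
  annihilation. There is no constant term, so the \<open>m\<close>-th power starts in degree
  \<open>m\<close> and each coefficient of the exponential is a finite sum.\<close>

locale one_sided =
  fixes \<sigma> :: int and S :: "'a series"
  assumes sign: "\<sigma> = 1 \<or> \<sigma> = -1"
    and linop_coeff: "linop (S n)"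
    and coeff_eq_zero: "\<sigma> * n < 1 \<Longrightarrow> S n v = 0"
begin

lemma ser_pow_eq_zero: "\<sigma> * n < int m \<Longrightarrow> ser_pow S m n v = 0"
proof (induction m arbitrary: n)
  case 0
  then show ?case by (auto simp: ser_one_def)
next
  case (Suc m)
  have "S p (ser_pow S m (n - p) v) = 0" for p
  proof (cases "\<sigma> * p < 1")
    case False
    then have "\<sigma> * (n - p) < int m" using Suc.prems by (simp add: right_diff_distrib)
    then show ?thesis by (simp add: Suc.IH linop_zero[OF linop_coeff])
  qed (simp add: coeff_eq_zero)
  then show ?case by (simp add: ser_mult_def)
qed

text \<open>The bound \<open>K\<close> is left free so that recursions at different exponents can be
  put over one range.\<close>

lemma ser_pow_Suc:
  assumes "\<bar>n\<bar> \<le> K"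
  shows "ser_pow S (Suc m) n v = (\<Sum>p\<in>{-K..K}. S p (ser_pow S m (n - p) v))"
proof -
  have "S p (ser_pow S m (n - p) v) = 0" if "p \<notin> {-K..K}" for p
  proof (cases "\<sigma> * p < 1")
    case False
    then have "\<sigma> * (n - p) < int m" using that assms sign by auto
    then show ?thesis by (simp add: ser_pow_eq_zero linop_zero[OF linop_coeff])
  qed (simp add: coeff_eq_zero)
  then show ?thesis
    by (simp add: ser_mult_def) (rule Sum_any_sum, auto)
qed

lemma linop_ser_pow: "linop (ser_pow S m n)"
proof (induction m arbitrary: n)
  case 0
  show ?case by (simp add: linop_iff ser_one_def)
next
  case (Suc m)
  have "linop (\<lambda>v. \<Sum>p\<in>{-\<bar>n\<bar>..\<bar>n\<bar>}. S p (ser_pow S m (n - p) v))"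
    by (intro linop_intros linop_comp[OF linop_coeff] Suc.IH)
  then show ?case by (simp only: ser_pow_Suc[OF order_refl, symmetric])
qed

lemma ser_exp_sum:
  assumes "nat \<bar>n\<bar> \<le> M"
  shows "ser_exp S n v = (\<Sum>m\<le>M. smul (1 / fact m) (ser_pow S m n v))"
  unfolding ser_exp_def
proof (rule Sum_any_sum)
  fix m
  assume "m \<notin> {..M}"
  then have "\<sigma> * n < int m" using assms sign by auto
  then show "smul (1 / fact m) (ser_pow S m n v) = 0" by (simp add: ser_pow_eq_zero)
qed simp

lemma linop_ser_exp: "linop (ser_exp S n)"
proof -
  have "linop (\<lambda>v. \<Sum>m\<le>nat \<bar>n\<bar>. smul (1 / fact m) (ser_pow S m n v))"
    by (intro linop_intros linop_ser_pow)
  then show ?thesis by (simp only: ser_exp_sum[OF order_refl, symmetric])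
qed

lemma ser_exp_eq_zero: "\<sigma> * n < 0 \<Longrightarrow> ser_exp S n v = 0"
  by (simp add: ser_exp_sum[OF order_refl] ser_pow_eq_zero)

lemma ser_exp_killed:
  assumes "\<And>p. S p v = 0"
  shows "ser_exp S n v = ser_one n v"
proof -
  have [simp]: "S p (ser_one q v) = 0" for p q
    by (simp add: ser_one_def assms linop_zero[OF linop_coeff])
  have "ser_pow S (Suc m) n v = 0" for m n
    by (induction m arbitrary: n) (simp_all add: ser_mult_def linop_zero[OF linop_coeff])
  then have "ser_pow S m n v = 0" if "m \<noteq> 0" for m
    using that by (cases m) (simp_all del: ser_pow.simps)
  then have "(\<Sum>m\<le>nat \<bar>n\<bar>. smul (1 / fact m) (ser_pow S m n v)) =
      (\<Sum>m\<in>{0}. smul (1 / fact m) (ser_pow S m n v))"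
    by (intro sum.mono_neutral_right) auto
  then show ?thesis by (simp add: ser_exp_sum[OF order_refl])
qed

context
  fixes b s \<kappa>
  assumes b: "linop b"
    and comm: "b (S p v) = S p (b v) + (if p = \<kappa> then smul s v else 0)"
begin

text \<open>The commutator of \<open>b\<close> with the series is a scalar times one power of the
  variable. It commutes with everything, so \<open>b\<close> acts on powers as a derivation. At
  \<open>m = 0\<close> the truncated \<open>m - 1\<close> is harmless, since its factor is
  0.\<close>

lemma ser_pow_commutator:
  "b (ser_pow S m n v) = ser_pow S m n (b v) + smul (of_nat m * s) (ser_pow S (m - 1) (n - \<kappa>) v)"
proof (induction m arbitrary: n)
  case 0
  then show ?case by (simp add: ser_one_def linop_zero[OF b])
next
  case (Suc m)
  define K where "K = \<bar>n\<bar> + \<bar>\<kappa>\<bar>"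
  have K: "\<bar>n\<bar> \<le> K" "\<bar>n - \<kappa>\<bar> \<le> K" "\<kappa> \<in> {-K..K}" by (auto simp: K_def)
  \<comment> \<open>At \<open>m = 0\<close> both sides vanish through the factor
    \<open>of_nat m\<close>; otherwise the sum is the recursion for \<open>ser_pow S m\<close> at
    exponent \<open>n - \<kappa>\<close>.\<close>
  have *: "smul (of_nat m * s) (\<Sum>p\<in>{-K..K}. S p (ser_pow S (m - 1) (n - p - \<kappa>) v)) =
      smul (of_nat m * s) (ser_pow S m (n - \<kappa>) v)"
  proof (cases m)
    case (Suc m')
    have "n - p - \<kappa> = n - \<kappa> - p" for p by simp
    then show ?thesis unfolding Suc by (simp only: ser_pow_Suc[OF K(2)] diff_Suc_1)
  qed simp
  have "b (ser_pow S (Suc m) n v) = (\<Sum>p\<in>{-K..K}. S p (ser_pow S m (n - p) (b v)) +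
      smul (of_nat m * s) (S p (ser_pow S (m - 1) (n - p - \<kappa>) v)) +
      (if p = \<kappa> then smul s (ser_pow S m (n - p) v) else 0))"
    unfolding ser_pow_Suc[OF K(1)]
    by (simp only: linop_sum[OF b] comm Suc.IH linop_add[OF linop_coeff] linop_smul[OF linop_coeff])
  also have "\<dots> = (\<Sum>p\<in>{-K..K}. S p (ser_pow S m (n - p) (b v))) +
      smul (of_nat m * s) (\<Sum>p\<in>{-K..K}. S p (ser_pow S (m - 1) (n - p - \<kappa>) v)) +
      smul s (ser_pow S m (n - \<kappa>) v)"
    using K(3) by (simp only: sum.distrib smul_sum sum.delta finite_atLeastAtMost_int if_True)
  also have "\<dots> = ser_pow S (Suc m) n (b v) +
      (smul (of_nat m * s) (ser_pow S m (n - \<kappa>) v) + smul s (ser_pow S m (n - \<kappa>) v))"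
    by (simp only: * ser_pow_Suc[OF K(1)] add.assoc)
  also have "smul (of_nat m * s) (ser_pow S m (n - \<kappa>) v) + smul s (ser_pow S m (n - \<kappa>) v) =
      smul (of_nat (Suc m) * s) (ser_pow S m (n - \<kappa>) v)"
    unfolding smul_add_same by (simp add: algebra_simps)
  finally show ?case by (simp only: diff_Suc_1)
qed

lemma ser_exp_commutator: "b (ser_exp S n v) = ser_exp S n (b v) + smul s (ser_exp S (n - \<kappa>) v)"
proof -
  \<comment> \<open>One bound for both exponentials; differentiating lowers the power, so the sum on
    the left runs one step further.\<close>
  define M where "M = nat \<bar>n\<bar> + nat \<bar>n - \<kappa>\<bar>"
  have M: "nat \<bar>n\<bar> \<le> Suc M" "nat \<bar>n - \<kappa>\<bar> \<le> M" by (auto simp: M_def)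
  have "b (ser_exp S n v) = ser_exp S n (b v) +
      (\<Sum>m\<le>Suc M. smul (1 / fact m * (of_nat m * s)) (ser_pow S (m - 1) (n - \<kappa>) v))"
    by (simp only: ser_exp_sum[OF M(1)] linop_sum[OF b] linop_smul[OF b] ser_pow_commutator
        smul_add_right sum.distrib smul_smul)
  also have "(\<Sum>m\<le>Suc M. smul (1 / fact m * (of_nat m * s)) (ser_pow S (m - 1) (n - \<kappa>) v)) =
      (\<Sum>m\<le>M. smul s (smul (1 / fact m) (ser_pow S m (n - \<kappa>) v)))"
  proof -
    have "1 / fact (Suc m) * (of_nat (Suc m) * s) = s * (1 / fact m)" for m
      by (simp del: of_nat_Suc)
    then show ?thesis
      by (subst sum.atMost_Suc_shift) (simp only: smul_smul diff_Suc_1, simp)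
  qed
  also have "\<dots> = smul s (ser_exp S (n - \<kappa>) v)"
    by (simp only: ser_exp_sum[OF M(2)] smul_sum)
  finally show ?thesis .
qed

end

end

text \<open>The vacuum is to stay the basis vector \<open>bvec 0\<close> and not to become the unit
  polynomial.\<close>

declare single_one [simp del]

section \<open>The twisted vertex operator\<close>

lemma linop_exponents: "linop (exponent_creat n)" "linop (exponent_annih n)"
  unfolding exponent_creat_def[abs_def] exponent_annih_def[abs_def]
  by (intro linop_intros linop_beta)+

interpretation creat: one_sided 1 exponent_creat
  by (rule one_sided.intro) (auto simp: linop_exponents exponent_creat_def)

interpretation annih: one_sided "-1" exponent_annih
  by (rule one_sided.intro) (auto simp: linop_exponents exponent_annih_def)

text \<open>The weight \<open>1/k\<close> in the exponent cancels the \<open>-k\<close> of the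
  Heisenberg relation to -1. The same value comes from the annihilation exponent for the negative
  modes; this makes the commutator with the vertex operator uniform in \<open>l\<close>.\<close>

lemma exponent_creat_commutator:
  "beta l (exponent_creat p v) = exponent_creat p (beta l v) +
     (if p = 2 * l + 1 then smul (if l \<ge> 0 then -1 else 0) v else 0)"
proof (cases "odd p \<and> p > 0")
  case True
  then obtain m where p: "p = 2 * m + 1" by (auto elim: oddE)
  with True have m: "m \<ge> 0" by simp
  define c :: complex where "c = of_int m + 1 / 2"
  have c: "c \<noteq> 0" using m by (simp add: c_def complex_eq_iff)
  have eq: "exponent_creat p w = smul (1 / c) (beta (- m - 1) w)" for w
  proof -
    have "of_int p / 2 = c" "(- p - 1) div 2 = - m - 1" by (simp_all add: p c_def add_divide_distrib)
    with True show ?thesis by (simp only: exponent_creat_def if_True simp_thms)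
  qed
  show ?thesis
  proof (cases "l = m")
    case True
    then show ?thesis
      using m c by (simp add: eq[unfolded p] linop_smul[OF linop_beta] beta_commutator[of m "- m - 1"]
          smul_add_right p flip: c_def)
  next
    case False
    then show ?thesis
      by (simp add: eq[unfolded p] linop_smul[OF linop_beta] beta_commutator[of l "- m - 1"] smul_add_right p)
  qed
qed (auto simp: exponent_creat_def linop_zero[OF linop_beta])

lemma exponent_annih_commutator:
  "beta l (exponent_annih p v) = exponent_annih p (beta l v) +
     (if p = 2 * l + 1 then smul (if l < 0 then -1 else 0) v else 0)"
proof (cases "odd p \<and> p < 0")
  case True
  define m where "m = (- p - 1) div 2"
  have p: "p = - (2 * m) - 1" using True by (auto simp: m_def elim!: oddE)
  with True have m: "m \<ge> 0" by simp
  define c :: complex where "c = of_int m + 1 / 2"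
  have c: "c \<noteq> 0" using m by (simp add: c_def complex_eq_iff)
  have eq: "exponent_annih p w = smul (- (1 / c)) (beta m w)" for w
  proof -
    have "of_int (- p) / 2 = c" by (simp add: p c_def add_divide_distrib add.commute)
    with True show ?thesis by (simp only: exponent_annih_def if_True simp_thms m_def)
  qed
  show ?thesis
  proof (cases "l = - m - 1")
    case True
    have "- (of_int (- m - 1) + 1 / 2) = c" by (simp add: c_def)
    with True show ?thesis
      using m c by (simp add: eq[unfolded p] linop_smul[OF linop_beta] beta_commutator[of "- m - 1" m]
          smul_add_right p)
  next
    case False
    then show ?thesis
      by (simp add: eq[unfolded p] linop_smul[OF linop_beta] beta_commutator[of l m] smul_add_right p)
  qed
qed (auto simp: exponent_annih_def linop_zero[OF linop_beta])

lemma exp_creat_commutator: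
  "beta l (ser_exp exponent_creat n v) = ser_exp exponent_creat n (beta l v) +
     smul (if l \<ge> 0 then -1 else 0) (ser_exp exponent_creat (n - (2 * l + 1)) v)"
  by (rule creat.ser_exp_commutator[OF linop_beta exponent_creat_commutator])

lemma exp_annih_commutator:
  "beta l (ser_exp exponent_annih n v) = ser_exp exponent_annih n (beta l v) +
     smul (if l < 0 then -1 else 0) (ser_exp exponent_annih (n - (2 * l + 1)) v)"
  by (rule annih.ser_exp_commutator[OF linop_beta exponent_annih_commutator])

lemma beta_annih_vac: "l \<ge> 0 \<Longrightarrow> beta l (bvec 0) = 0"
  unfolding beta_def fock_deriv_single by simp

lemma exp_annih_vac: "ser_exp exponent_annih n (bvec 0) = ser_one n (bvec 0)"
  by (rule annih.ser_exp_killed) (auto simp: exponent_annih_def beta_annih_vac)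

text \<open>Commuting past the creation operator of variable \<open>m\<close> shifts the exponent by
  \<open>2m + 1\<close>, so each variable lowers the bound by a finite amount.\<close>

lemma truncated_exp_annih: "truncated (ser_exp exponent_annih)"
proof (rule truncatedI)
  fix e :: fock_basis
  show "\<exists>N. \<forall>n<N. ser_exp exponent_annih n (bvec e) = 0"
  proof (induction e rule: fock_basis_induct)
    case zero
    show ?case by (rule exI[of _ 0]) (simp add: exp_annih_vac ser_one_def)
  next
    case (add e m)
    then obtain N where N: "\<forall>n<N. ser_exp exponent_annih n (bvec e) = 0" by blast
    show ?case
    proof (rule exI[of _ "N - 2 * int m - 1"], intro allI impI)
      fix n
      assume n: "n < N - 2 * int m - 1"
      show "ser_exp exponent_annih n (bvec (e + Poly_Mapping.single m 1)) = 0"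
        using N n exp_annih_commutator[of "- int m - 1" n "bvec e"]
        by (simp add: beta_creat_bvec linop_zero[OF linop_beta])
    qed
  qed
qed (rule annih.linop_ser_exp)

definition Y_const :: "nat \<Rightarrow> complex" where
  "Y_const j = - (2 * \<i>) * (-1) ^ j"

lemma Y_const_sq: "Y_const j * Y_const j = -4"
proof -
  have "((-1) ^ j * (-1) ^ j :: complex) = 1" by (simp flip: power_mult_distrib)
  moreover have "Y_const j * Y_const j = -4 * ((-1) ^ j * (-1) ^ j)"
    by (simp add: Y_const_def algebra_simps)
  ultimately show ?thesis by simp
qed

lemma Y_tw_eq: "Y_tw j n v = smul (Y_const j)
    (Sum_any (\<lambda>p. ser_exp exponent_creat p (ser_exp exponent_annih (n - 1 - p) v)))"
  by (simp add: Y_tw_def ser_scale_def ser_shift_def ser_mult_def Y_const_def)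

lemma Y_tw_summand_zero:
  assumes "\<And>n. n < N \<Longrightarrow> ser_exp exponent_annih n v = 0" "p \<notin> {0..m - N}"
  shows "ser_exp exponent_creat p (ser_exp exponent_annih (m - p) v) = 0"
proof (cases "p < 0")
  case False
  with assms(2) have "m - p < N" by auto
  then show ?thesis by (simp add: assms(1) linop_zero[OF creat.linop_ser_exp])
qed (simp add: creat.ser_exp_eq_zero)

lemma Y_tw_finite:
  "finite {p. ser_exp exponent_creat p (ser_exp exponent_annih (m - p) v) \<noteq> 0}"
proof -
  obtain N where N: "\<And>n. n < N \<Longrightarrow> ser_exp exponent_annih n v = 0"
    using truncatedE[OF truncated_exp_annih] by metis
  have "{p. ser_exp exponent_creat p (ser_exp exponent_annih (m - p) v) \<noteq> 0} \<subseteq> {0..m - N}"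
    using Y_tw_summand_zero[OF N] by blast
  then show ?thesis by (rule finite_subset) simp
qed

lemma linop_Y_tw: "linop (Y_tw j n)"
  unfolding Y_tw_eq[abs_def]
  by (intro linop_scaled linop_Sum_any_fun Y_tw_finite linop_comp[OF creat.linop_ser_exp]
      annih.linop_ser_exp)

lemma truncated_Y_tw: "truncated (Y_tw j)"
  unfolding truncated_def
proof (intro conjI allI linop_Y_tw)
  fix v
  obtain N where N: "\<And>n. n < N \<Longrightarrow> ser_exp exponent_annih n v = 0"
    using truncatedE[OF truncated_exp_annih] by metis
  have "Y_tw j n v = 0" if "n < N" for n
    using Y_tw_summand_zero[OF N, where m = "n - 1"] that by (simp add: Y_tw_eq)
  then show "\<exists>N. \<forall>n<N. Y_tw j n v = 0" by blast
qed

text \<open>A mode meets exactly one of the two exponents, according to the sign of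
  \<open>l\<close>, and both give the scalar -1.\<close>

lemma Y_tw_commutator: "beta l (Y_tw j n v) = Y_tw j n (beta l v) - Y_tw j (n - (2 * l + 1)) v"
proof -
  define F where "F m p = ser_exp exponent_creat p (ser_exp exponent_annih (m - p) v)" for m p
  define F' where "F' p = ser_exp exponent_creat p (ser_exp exponent_annih (n - 1 - p) (beta l v))" for p
  define k where "k = 2 * l + 1"
  have fin: "finite {p. F m p \<noteq> 0}" "finite {p. F' p \<noteq> 0}" for m
    by (simp_all add: F_def F'_def Y_tw_finite)
  have term_eq: "beta l (F (n - 1) p) = F' p +
      (if l < 0 then - F (n - 1 - k) p else - F (n - 1 - k) (p - k))" for p
    by (simp add: F_def F'_def k_def exp_creat_commutator exp_annih_commutator
        linop_add[OF creat.linop_ser_exp] linop_minus[OF creat.linop_ser_exp]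
        linop_zero[OF creat.linop_ser_exp]
        smul_minus_left algebra_simps)
  \<comment> \<open>For \<open>l \<ge> 0\<close> the shift by \<open>k\<close> falls on the creation
    factor and the summation index has to move along; for \<open>l < 0\<close> it falls on the
    annihilation factor and the index stays.\<close>
  have shift: "Sum_any (\<lambda>p. F (n - 1 - k) (p - k)) = Sum_any (F (n - 1 - k))"
    by (rule Sum_any_reindex) (rule o_bij[of "\<lambda>p. p + k"], auto)
  have fin_shift: "finite {p. F (n - 1 - k) (p - k) \<noteq> 0}"
    by (rule finite_subset[OF _ finite_imageI[OF fin(1)[of "n - 1 - k"], of "\<lambda>p. p + k"]])
      (auto simp: image_iff intro!: exI[of _ "_ - k"])
  have "beta l (Sum_any (F (n - 1))) = Sum_any F' - Sum_any (F (n - 1 - k))"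
    using fin_shift
    by (cases "l < 0")
      (simp_all add: linop_Sum_any[OF linop_beta fin(1)] term_eq Sum_any_diff fin shift)
  then have "beta l (smul (Y_const j) (Sum_any (F (n - 1)))) =
      smul (Y_const j) (Sum_any F') - smul (Y_const j) (Sum_any (F (n - 1 - k)))"
    by (simp add: linop_smul[OF linop_beta] smul_diff_right)
  moreover have "n - k - 1 = n - 1 - k" by simp
  ultimately show ?thesis
    unfolding Y_tw_eq F_def F'_def k_def by simp
qed

section \<open>Vacuum coefficients of one and of two vertex operators\<close>

lemma Y_tw_vac: "Y_tw j n (bvec 0) = smul (Y_const j) (ser_exp exponent_creat (n - 1) (bvec 0))"
proof -
  have "Sum_any (\<lambda>p. ser_exp exponent_creat p (ser_one (n - 1 - p) (bvec 0))) =
      (\<Sum>p\<in>{n - 1}. ser_exp exponent_creat p (ser_one (n - 1 - p) (bvec 0)))"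
    by (rule Sum_any_sum) (auto simp: ser_one_def linop_zero[OF creat.linop_ser_exp])
  then show ?thesis
    unfolding Y_tw_eq exp_annih_vac by (simp add: ser_one_def)
qed

lemma Y_tw_vac_eq_zero: "n < 1 \<Longrightarrow> Y_tw j n (bvec 0) = 0"
  unfolding Y_tw_vac by (simp add: creat.ser_exp_eq_zero)

lemma Y_tw_vac_1: "Y_tw j 1 (bvec 0) = smul (Y_const j) (bvec 0)"
proof -
  have "ser_exp exponent_creat 0 w = w" for w
    by (simp add: creat.ser_exp_sum[of 0 0] ser_one_def)
  then show ?thesis by (simp only: Y_tw_vac diff_self)
qed

text \<open>Only the empty product of creation operators has a vacuum coefficient; the prefactor
  \<open>z^(1/2)\<close> places it at \<open>n = 1\<close>.\<close>

lemma lookup_Y_tw_vac: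
  "Poly_Mapping.lookup (Y_tw j n (bvec 0)) 0 = (if n = 1 then Y_const j else 0)"
proof -
  have "Poly_Mapping.lookup (exponent_creat p w) 0 = 0" for p w
    by (auto simp: exponent_creat_def lookup_beta_creat_zero)
  then have "Poly_Mapping.lookup (ser_pow exponent_creat (Suc m) p w) 0 = 0" for m p w
    unfolding creat.ser_pow_Suc[OF order_refl] by (simp add: lookup_sum')
  then have pow: "Poly_Mapping.lookup (ser_pow exponent_creat m p (bvec 0)) 0 =
      (if m = 0 \<and> p = 0 then 1 else 0)" for m p
    by (cases m) (simp_all add: ser_one_def del: ser_pow.simps(2))
  have "Poly_Mapping.lookup (ser_exp exponent_creat p (bvec 0)) 0 = (if p = 0 then 1 else 0)" for p
    unfolding creat.ser_exp_sum[OF order_refl] lookup_sum' lookup_smul pow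
    by (simp add: if_distrib sum.delta cong: if_cong)
  then show ?thesis unfolding Y_tw_vac by simp
qed

text \<open>The common kernel of the annihilation operators is the vacuum line.\<close>

lemma fock_zeroI:
  assumes "\<And>m. beta (int m) w = 0" "Poly_Mapping.lookup w 0 = 0"
  shows "w = 0"
proof (rule poly_mapping_eqI)
  fix e
  show "Poly_Mapping.lookup w e = Poly_Mapping.lookup 0 e"
  proof (induction e rule: fock_basis_induct)
    case (add e m)
    have "of_nat m + 1 / 2 \<noteq> (0 :: complex)" "of_nat (Poly_Mapping.lookup e m) + 1 \<noteq> (0 :: complex)"
      by (simp_all add: complex_eq_iff)
    then show ?case
      using lookup_beta_annih[of m w e] assms(1)[of m]
      by (metis lookup_zero mult_eq_0_iff neg_equal_0_iff_equal)
  qed (use assms(2) in simp)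
qed

text \<open>On the vacuum, \<open>z\<close> times the derivative of the vertex operator is multiplication by the
  derivative of its exponent.\<close>

lemma Y_tw_vac_Euler:
  assumes "n \<le> K"
  shows "smul (of_nat n) (Y_tw j (int n + 1) (bvec 0)) =
    (\<Sum>l<K. smul 2 (beta (- int l - 1) (Y_tw j (int n - 2 * int l) (bvec 0))))"
  using assms
proof (induction n rule: less_induct)
  case (less n)
  define y where "y q = Y_tw j q (bvec 0)" for q
  have ann: "beta (int m) (y q) = - y (q - (2 * int m + 1))" for m :: nat and q
    using Y_tw_commutator[of "int m" j q "bvec 0"] beta_annih_vac[of "int m"]
    by (simp add: y_def linop_zero[OF linop_Y_tw])
  define D where "D n = smul (of_nat n) (y (int n + 1)) -
      (\<Sum>l<K. smul 2 (beta (- int l - 1) (y (int n - 2 * int l))))" for n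
  \<comment> \<open>\<open>D n\<close> has no vacuum coefficient, and \<open>beta (int m)\<close>
    maps it to \<open>- D (n - (2 * m + 1))\<close> or, when this index is negative, to 0.\<close>
  have "D n = 0"
  proof (rule fock_zeroI)
    show "Poly_Mapping.lookup (D n) 0 = 0"
      by (simp add: D_def y_def lookup_minus lookup_sum' lookup_Y_tw_vac lookup_beta_creat_zero)
  next
    fix m :: nat
    let ?k = "2 * m + 1"
    have comm: "beta (int m) (beta (- int l - 1) (y q)) =
        - beta (- int l - 1) (y (q - (2 * int m + 1))) + smul (if l = m then - (of_nat m + 1 / 2) else 0) (y q)"
      for l q
      by (auto simp: beta_commutator[of "int m" "- int l - 1"] ann linop_minus[OF linop_beta])
    \<comment> \<open>The Heisenberg scalar meets only the summand \<open>l = m\<close>; if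
      \<open>m\<close> is outside the range, \<open>n \<le> K\<close> makes the missing term
      vanish.\<close>
    have *: "(\<Sum>l<K. smul 2 (smul (if l = m then - (of_nat m + 1 / 2) else 0) (y (int n - 2 * int l)))) =
        - smul (of_nat ?k) (y (int n - 2 * int m))"
    proof (cases "m < K")
      case True
      have sc: "2 * - (of_nat m + 1 / 2) = - (of_nat ?k :: complex)" by simp
      have "(\<Sum>l<K. smul 2 (smul (if l = m then - (of_nat m + 1 / 2) else 0) (y (int n - 2 * int l)))) =
          (\<Sum>l<K. if l = m then - smul (of_nat ?k) (y (int n - 2 * int m)) else 0)"
        by (rule sum.cong) (auto simp only: smul_smul sc smul_minus_left smul_zero mult_zero_right split: if_split)
      with True show ?thesis by simp
    next
      case False
      with less.prems have "y (int n - 2 * int m) = 0" by (simp add: y_def Y_tw_vac_eq_zero)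
      with False show ?thesis by (auto intro!: sum.neutral)
    qed
    have idx: "int n - 2 * int l - (2 * int m + 1) = int n - int ?k - 2 * int l"
      "int n + 1 - (2 * int m + 1) = int n - 2 * int m" for l by simp_all
    have "beta (int m) (D n) = smul (of_nat n) (- y (int n - 2 * int m)) -
        (\<Sum>l<K. smul 2 (beta (int m) (beta (- int l - 1) (y (int n - 2 * int l)))))"
      by (simp only: D_def linop_diff[OF linop_beta] linop_sum[OF linop_beta]
          linop_smul[OF linop_beta] ann idx)
    also have "(\<Sum>l<K. smul 2 (beta (int m) (beta (- int l - 1) (y (int n - 2 * int l))))) =
        - (\<Sum>l<K. smul 2 (beta (- int l - 1) (y (int n - int ?k - 2 * int l)))) -
        smul (of_nat ?k) (y (int n - 2 * int m))"
      by (simp only: comm idx smul_add_right smul_minus_right sum.distrib sum_negf * add_uminus_conv_diff)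
    finally have "beta (int m) (D n) = - smul (of_nat n) (y (int n - 2 * int m)) +
        (\<Sum>l<K. smul 2 (beta (- int l - 1) (y (int n - int ?k - 2 * int l)))) +
        smul (of_nat ?k) (y (int n - 2 * int m))"
      by (simp add: smul_minus_right)
    also have "\<dots> = 0"
    proof (cases "?k \<le> n")
      case True
      then obtain n' where n': "n = n' + ?k" by (metis add.commute le_Suc_ex)
      have "smul (of_nat n') (y (int n' + 1)) =
          (\<Sum>l<K. smul 2 (beta (- int l - 1) (y (int n' - 2 * int l))))"
        unfolding y_def by (rule less.IH) (use less.prems n' in auto)
      moreover have "smul (of_nat n) (y (int n - 2 * int m)) =
          smul (of_nat n') (y (int n' + 1)) + smul (of_nat ?k) (y (int n - 2 * int m))"
        unfolding n' smul_add_left of_nat_add by (simp add: algebra_simps)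
      ultimately show ?thesis by (simp add: n' algebra_simps)
    next
      \<comment> \<open>Now \<open>n \<le> 2 * m\<close>, so every exponent that occurs lies below
        the lowest exponent 1 of the vertex operator on the vacuum.\<close>
      case False
      then have *: "y (int n - int ?k - 2 * int l) = 0" for l by (simp add: y_def Y_tw_vac_eq_zero)
      have "- smul (of_nat n) (y (int n - 2 * int m)) + smul (of_nat ?k) (y (int n - 2 * int m)) = 0"
      proof (cases "n = 2 * m")
        case True
        then show ?thesis by (simp add: y_def Y_tw_vac_eq_zero)
      qed (use False in \<open>simp add: y_def Y_tw_vac_eq_zero\<close>)
      then show ?thesis unfolding * by (simp add: linop_zero[OF linop_beta])
    qed
    finally show "beta (int m) (D n) = 0" .
  qed
  then show ?case by (simp add: D_def y_def)
qed

text \<open>The coefficient form of \<open>x f' = 2x / (1 - x^2) f\<close> for the contraction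
  factor \<open>f = (1 + x) / (1 - x) = 1 + 2x + 2x^2 + ...\<close>, where
  \<open>x = s/t\<close>.\<close>

lemma sum_weights:
  fixes n K :: nat
  assumes "n \<le> K"
  shows "(\<Sum>l<K. if 2 * l + 1 < n then 2 else if 2 * l + 1 = n then 1 else (0 :: complex)) = of_nat n"
  using assms
proof (induction n arbitrary: K rule: nat_less_induct)
  case (1 n)
  consider "n = 0" | "n = 1" | n' where "n = Suc (Suc n')" by (metis One_nat_def nat.exhaust)
  then show ?case
  proof cases
    case 2
    then show ?thesis using 1(2) by (cases K) (auto simp: sum.lessThan_Suc_shift)
  next
    case 3
    then obtain K' where K: "K = Suc K'" "n' \<le> K'" using 1(2) by (cases K) auto
    have "(\<Sum>l<K'. if 2 * l + 1 < n' then 2 else if 2 * l + 1 = n' then 1 else (0 :: complex)) = of_nat n'"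
      using 1(1) K 3 by auto
    with 3 show ?thesis unfolding K(1) sum.lessThan_Suc_shift by (simp cong: if_cong)
  qed simp
qed

text \<open>The Euler identity for the inner vertex operator becomes a recursion in \<open>q\<close>
  that is solved by the coefficients of \<open>(1 + x) / (1 - x)\<close>. The two prefactors
  \<open>z^(1/2)\<close> give \<open>p + q = 2\<close>, and the two constants give -4.\<close>

lemma lookup_Y_tw_Y_tw_vac:
  "Poly_Mapping.lookup (Y_tw j p (Y_tw j q (bvec 0))) 0 =
     (if p + q = 2 then if q < 1 then 0 else if q = 1 then -4 else -8 else 0)"
proof (cases "q < 1")
  case True
  then show ?thesis by (simp add: Y_tw_vac_eq_zero linop_zero[OF linop_Y_tw])
next
  case False
  define v where "v p q = Poly_Mapping.lookup (Y_tw j p (Y_tw j q (bvec 0))) 0" for p q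
  have "v p (int n + 1) = (if p + int n = 1 then if n = 0 then -4 else -8 else 0)" for p n
  proof (induction n arbitrary: p rule: less_induct)
    case (less n)
    show ?case
    proof (cases "n = 0")
      case True
      have "v p 1 = Y_const j * Poly_Mapping.lookup (Y_tw j p (bvec 0)) 0"
        by (simp only: Y_tw_vac_1 v_def linop_smul[OF linop_Y_tw] lookup_smul)
      with True show ?thesis by (simp only: lookup_Y_tw_vac) (simp add: Y_const_sq)
    next
      case False
      \<comment> \<open>A creation operator on the far left has no vacuum coefficient, so moving it
        there leaves only the exponent shift.\<close>
      have creat: "Poly_Mapping.lookup (Y_tw j p (beta (- int l - 1) w)) 0 =
          Poly_Mapping.lookup (Y_tw j (p + 2 * int l + 1) w) 0" for l w
        using arg_cong[OF Y_tw_commutator[of "- int l - 1" j p w], of "\<lambda>w. Poly_Mapping.lookup w 0"]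
        by (simp add: lookup_minus lookup_beta_creat_zero algebra_simps)
      have "of_nat n * v p (int n + 1) =
          Poly_Mapping.lookup (Y_tw j p (smul (of_nat n) (Y_tw j (int n + 1) (bvec 0)))) 0"
        by (simp only: v_def linop_smul[OF linop_Y_tw] lookup_smul)
      also have "\<dots> = (\<Sum>l<n. 2 * v (p + 2 * int l + 1) (int n - 2 * int l))"
        by (simp only: Y_tw_vac_Euler[OF order_refl] linop_sum[OF linop_Y_tw] linop_smul[OF linop_Y_tw]
            lookup_smul lookup_sum' creat v_def)
      \<comment> \<open>The -8 is twice the square -4 of \<open>Y_const j\<close>; what remains are
        the weights 1, 2, 2, ... of the contraction.\<close>
      also have "\<dots> = (\<Sum>l<n. (if p + int n = 1 then -8 else 0) *
          (if 2 * l + 1 < n then 2 else if 2 * l + 1 = n then 1 else 0))"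
      proof (rule sum.cong)
        fix l
        assume "l \<in> {..<n}"
        show "2 * v (p + 2 * int l + 1) (int n - 2 * int l) = (if p + int n = 1 then -8 else 0) *
          (if 2 * l + 1 < n then 2 else if 2 * l + 1 = n then 1 else 0)"
        proof (cases "2 * l + 1 \<le> n")
          case True
          then obtain n' where n': "n = n' + (2 * l + 1)" by (metis add.commute le_Suc_ex)
          then have "v (p + 2 * int l + 1) (int n' + 1) =
              (if p + int n = 1 then if n' = 0 then -4 else -8 else 0)"
            by (subst less.IH) (auto simp: algebra_simps)
          moreover have "int n - 2 * int l = int n' + 1" using n' by simp
          ultimately show ?thesis using n' by (auto simp: add.commute[of 1 "int n'"])
        next
          case False
          then have "v (p + 2 * int l + 1) (int n - 2 * int l) = 0"
            by (simp add: v_def Y_tw_vac_eq_zero linop_zero[OF linop_Y_tw])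
          with False show ?thesis by simp
        qed
      qed simp
      also have "\<dots> = of_nat n * (if p + int n = 1 then -8 else 0)"
        unfolding sum_distrib_left[symmetric] sum_weights[OF order_refl] by simp
      finally show ?thesis using False by simp
    qed
  qed
  from this[of p "nat (q - 1)"] False show ?thesis by (auto simp: v_def)
qed

section \<open>Anticommutators of the fermionic field\<close>

text \<open>The sign \<open>(-1)^(2r)\<close> of the Clifford relation at a doubled index.\<close>

definition parity_sign :: "int \<Rightarrow> complex" where
  "parity_sign n = (if even n then 1 else -1)"

lemma parity_sign_simps [simp]:
  "parity_sign (n + 1) = - parity_sign n" "parity_sign (n + 2) = parity_sign n"
  "parity_sign (- n) = parity_sign n"
  by (simp_all add: parity_sign_def)

lemma parity_sign_diff: "parity_sign (m - n) = parity_sign m * parity_sign n"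
  by (simp_all add: parity_sign_def)

lemma powi_minus_one: "(-1) powi n = parity_sign n"
  by (simp add: parity_sign_def power_int_minus_one_minus power_int_minus_left)

lemma fls_nth_below: "\<exists>N. \<forall>n<N. fls_nth \<chi> n = 0"
  using fls_eq0_below_subdegree by blast

lemma Phi_field_anticommutator:
  "Phi_field i m (Phi_field i n v) + Phi_field i n (Phi_field i m v) =
     smul (if m + n + 2 = 0 then parity_sign m else 0) v"
  using Phi_clifford[of i "- m - 1" "- n - 1" v]
  by (auto simp: Phi_field_def powi_minus_one parity_sign_def)

lemma linop_Phi_field: "linop (Phi_field i n)"
  by (simp add: Phi_field_def[abs_def] linear_Phi)

lemma truncated_Phi_field: "truncated (Phi_field i)"
proof (rule truncatedI)
  fix S :: "nat fset"
  obtain M where M: "\<And>p. p |\<in>| S \<Longrightarrow> p \<le> M"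
    using finite_nat_set_iff_bounded_le[of "fset S"] by auto
  have "Phi_field i n (bvec S) = 0" if "n < - int M - 2" for n
  proof -
    have "- n - 1 = int (nat (- n - 2)) + 1" using that by simp
    moreover have "nat (- n - 2) |\<notin>| S"
      using M[of "nat (- n - 2)"] that by auto
    ultimately show ?thesis
      unfolding Phi_field_def by (simp only: Phi_annih if_False)
  qed
  then show "\<exists>N. \<forall>n<N. Phi_field i n (bvec S) = 0" by blast
qed (rule linop_Phi_field)

lemma ser_mult_fls_finite:
  assumes "truncated A"
  shows "finite {p. smul (fls_nth \<chi> p) (A (n - p) v) \<noteq> 0}"
proof -
  obtain N where N: "\<And>n. n < N \<Longrightarrow> fls_nth \<chi> n = 0" using fls_nth_below by blast
  obtain N' where N': "\<And>n. n < N' \<Longrightarrow> A n v = 0" using truncatedE[OF assms] by blast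
  have "smul (fls_nth \<chi> p) (A (n - p) v) = 0" if "p < N \<or> n - p < N'" for p
    using that N N' by auto
  then have "{p. smul (fls_nth \<chi> p) (A (n - p) v) \<noteq> 0} \<subseteq> {N..n - N'}" by force
  then show ?thesis by (rule finite_subset) simp
qed

lemma G_field_eq:
  "G_field \<chi> i n v = smul (of_int (n + 2) / 2) (Phi_field i (n + 2) v) +
     Sum_any (\<lambda>p. smul (fls_nth \<chi> p) (Phi_field i (n - p) v))"
  by (simp add: G_field_def ser_add_def ser_deriv_def ser_mult_def ser_fls_def)

lemma linop_G_field: "linop (G_field \<chi> i n)"
  unfolding G_field_eq[abs_def]
  by (intro linop_plus linop_scaled linop_Sum_any_fun ser_mult_fls_finite truncated_Phi_field
      linop_Phi_field)

lemma truncated_G_field: "truncated (G_field \<chi> i)"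
  unfolding truncated_def
proof (intro conjI allI linop_G_field)
  fix v
  obtain N where N: "\<And>n. n < N \<Longrightarrow> fls_nth \<chi> n = 0" using fls_nth_below by blast
  obtain N' where N': "\<And>n. n < N' \<Longrightarrow> Phi_field i n v = 0"
    using truncatedE[OF truncated_Phi_field] by blast
  have "G_field \<chi> i n v = 0" if "n < min (N' - 2) (N + N')" for n
  proof -
    have "smul (fls_nth \<chi> p) (Phi_field i (n - p) v) = 0" for p
      using N[of p] N'[of "n - p"] that by (cases "p < N") auto
    then show ?thesis using N'[of "n + 2"] that by (simp add: G_field_eq)
  qed
  then show "\<exists>N. \<forall>n<N. G_field \<chi> i n v = 0" by blast
qed

lemma G_field_Phi_field_anticommutator:
  "G_field \<chi> i m (Phi_field i n v) + Phi_field i n (G_field \<chi> i m v) =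
     smul ((if m + n + 4 = 0 then of_int (m + 2) / 2 * parity_sign m else 0) +
       fls_nth \<chi> (m + n + 2) * parity_sign n) v"
proof -
  let ?f = "\<lambda>v p. smul (fls_nth \<chi> p) (Phi_field i (m - p) v)"
  note fin = ser_mult_fls_finite[OF truncated_Phi_field]
  have fin': "finite {p. Phi_field i n (?f v p) \<noteq> 0}"
    by (rule finite_subset[OF _ fin[of \<chi> i m v]]) (auto simp: linop_zero[OF linop_Phi_field])
  have "Sum_any (?f (Phi_field i n v)) + Phi_field i n (Sum_any (?f v)) =
      Sum_any (\<lambda>p. ?f (Phi_field i n v) p + Phi_field i n (?f v p))"
    by (simp add: linop_Sum_any[OF linop_Phi_field fin] Sum_any.distrib[OF fin fin'])
  also have "\<dots> = Sum_any (\<lambda>p. smul (fls_nth \<chi> p)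
      (smul (if m - p + n + 2 = 0 then parity_sign (m - p) else 0) v))"
    by (simp only: linop_smul[OF linop_Phi_field] smul_add_right[symmetric] Phi_field_anticommutator)
  also have "\<dots> = (\<Sum>p\<in>{m + n + 2}. smul (fls_nth \<chi> p)
      (smul (if m - p + n + 2 = 0 then parity_sign (m - p) else 0) v))"
    by (rule Sum_any_sum) auto
  also have "\<dots> = smul (fls_nth \<chi> (m + n + 2) * parity_sign n) v"
    by (simp add: parity_sign_def)
  finally have 1: "Sum_any (?f (Phi_field i n v)) + Phi_field i n (Sum_any (?f v)) =
      smul (fls_nth \<chi> (m + n + 2) * parity_sign n) v" .
  let ?c = "of_int (m + 2) / 2 :: complex"
  have "smul ?c (Phi_field i (m + 2) (Phi_field i n v)) + Phi_field i n (smul ?c (Phi_field i (m + 2) v)) =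
      smul ?c (smul (if m + n + 4 = 0 then parity_sign m else 0) v)"
    using Phi_field_anticommutator[of i "m + 2" n v]
    by (simp only: linop_smul[OF linop_Phi_field] smul_add_right[symmetric]) (simp add: algebra_simps)
  then have 2: "smul ?c (Phi_field i (m + 2) (Phi_field i n v)) + Phi_field i n (smul ?c (Phi_field i (m + 2) v)) =
      smul (if m + n + 4 = 0 then ?c * parity_sign m else 0) v"
    by simp
  have "G_field \<chi> i m (Phi_field i n v) + Phi_field i n (G_field \<chi> i m v) =
      (smul ?c (Phi_field i (m + 2) (Phi_field i n v)) + Phi_field i n (smul ?c (Phi_field i (m + 2) v))) +
      (Sum_any (?f (Phi_field i n v)) + Phi_field i n (Sum_any (?f v)))"
    by (simp only: G_field_eq linop_add[OF linop_Phi_field] ac_simps)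
  then show ?thesis unfolding 1 2 smul_add_left .
qed

text \<open>The coefficient of \<open>t^m\<close> in \<open>\<chi>(t) \<chi>(-t)\<close>, where
  \<open>t = z^(1/2)\<close>; the argument \<open>-t\<close> appears because the anticommutator of
  \<Phi> is supported at \<open>t = -s\<close>.\<close>

definition fls_twisted_square :: "complex fls \<Rightarrow> int \<Rightarrow> complex" where
  "fls_twisted_square \<chi> m = Sum_any (\<lambda>p. fls_nth \<chi> p * fls_nth \<chi> (m - p) * parity_sign p)"

lemma smul_Sum_any_left:
  assumes "finite {p. f p \<noteq> 0}"
  shows "Sum_any (\<lambda>p. smul (f p) v) = smul (Sum_any f) v"
proof -
  have "Sum_any (\<lambda>p. smul (f p) v) = (\<Sum>p | f p \<noteq> 0. smul (f p) v)"
    by (rule Sum_any_sum) (use assms in auto)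
  also have "\<dots> = smul (Sum_any f) v"
    unfolding Sum_any.expand_set
    by (rule poly_mapping_eqI) (simp add: lookup_sum' sum_distrib_right)
  finally show ?thesis .
qed

text \<open>The summands come from the two derivatives, from the two mixed terms, and from the two
  factors \<chi>.\<close>

definition G_scalar :: "complex fls \<Rightarrow> int \<Rightarrow> int \<Rightarrow> complex" where
  "G_scalar \<chi> m n =
     (if m + n + 6 = 0 then of_int (m + 2) * of_int (n + 2) / 4 * parity_sign m else 0) +
     fls_nth \<chi> (m + n + 4) * (of_int (n + 2) / 2 * parity_sign n + of_int (m + 2) / 2 * parity_sign m) +
     fls_twisted_square \<chi> (m + n + 2) * parity_sign n"

lemma G_field_anticommutator:
  "G_field \<chi> i m (G_field \<chi> i n v) + G_field \<chi> i n (G_field \<chi> i m v) = smul (G_scalar \<chi> m n) v"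
proof -
  let ?f = "\<lambda>v p. smul (fls_nth \<chi> p) (Phi_field i (n - p) v)"
  let ?g = "\<lambda>p. fls_nth \<chi> p * (if m + (n - p) + 4 = 0 then of_int (m + 2) / 2 * parity_sign m else 0)"
  let ?h = "\<lambda>p. parity_sign n * (fls_nth \<chi> p * fls_nth \<chi> (m + n + 2 - p) * parity_sign p)"
  note fin = ser_mult_fls_finite[OF truncated_Phi_field]
  have fin': "finite {p. G_field \<chi> i m (?f v p) \<noteq> 0}"
    by (rule finite_subset[OF _ fin[of \<chi> i n v]]) (auto simp: linop_zero[OF linop_G_field])
  obtain N where N: "\<And>n. n < N \<Longrightarrow> fls_nth \<chi> n = 0" using fls_nth_below by blast
  have "fls_nth \<chi> p * fls_nth \<chi> (M - p) * parity_sign p = 0" if "p < N \<or> M - p < N" for p M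
    using that N by auto
  then have "{p. fls_nth \<chi> p * fls_nth \<chi> (M - p) * parity_sign p \<noteq> 0} \<subseteq> {N..M - N}" for M
    by force
  then have finQ: "finite {p. fls_nth \<chi> p * fls_nth \<chi> (M - p) * parity_sign p \<noteq> 0}" for M
    by (rule finite_subset) simp
  have fing: "finite {p. ?g p \<noteq> 0}"
    by (rule finite_subset[of _ "{m + n + 4}"]) (auto split: if_splits)
  have finh: "finite {p. ?h p \<noteq> 0}"
    by (rule finite_subset[OF _ finQ[of "m + n + 2"]]) auto
  have "Sum_any (?f (G_field \<chi> i m v)) + G_field \<chi> i m (Sum_any (?f v)) =
      Sum_any (\<lambda>p. ?f (G_field \<chi> i m v) p + G_field \<chi> i m (?f v p))"
    by (simp add: linop_Sum_any[OF linop_G_field fin] Sum_any.distrib[OF fin fin'])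
  also have "\<dots> = Sum_any (\<lambda>p. smul (?g p + ?h p) v)"
  proof (rule arg_cong[where f = Sum_any], rule ext)
    fix p
    have "?f (G_field \<chi> i m v) p + G_field \<chi> i m (?f v p) =
        smul (fls_nth \<chi> p) (G_field \<chi> i m (Phi_field i (n - p) v) + Phi_field i (n - p) (G_field \<chi> i m v))"
      by (simp add: linop_smul[OF linop_G_field] smul_add_right add.commute)
    moreover have "m + (n - p) + 2 = m + n + 2 - p" by simp
    ultimately show "?f (G_field \<chi> i m v) p + G_field \<chi> i m (?f v p) = smul (?g p + ?h p) v"
      unfolding G_field_Phi_field_anticommutator smul_smul parity_sign_diff
      by (simp only: distrib_left mult_ac)
  qed
  also have "\<dots> = smul (Sum_any (\<lambda>p. ?g p + ?h p)) v"
    by (rule smul_Sum_any_left, rule finite_subset[of _ "{p. ?g p \<noteq> 0} \<union> {p. ?h p \<noteq> 0}"])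
      (use fing finh in auto)
  also have "Sum_any (\<lambda>p. ?g p + ?h p) = Sum_any ?g + Sum_any ?h"
    by (rule Sum_any.distrib[OF fing finh])
  also have "Sum_any ?g = (\<Sum>p\<in>{m + n + 4}. ?g p)"
    by (rule Sum_any_sum) (auto split: if_splits)
  also have "Sum_any ?h = parity_sign n * fls_twisted_square \<chi> (m + n + 2)"
    unfolding fls_twisted_square_def by (rule Sum_any_right_distrib[OF finQ, symmetric])
  finally have 1: "Sum_any (?f (G_field \<chi> i m v)) + G_field \<chi> i m (Sum_any (?f v)) =
      smul (fls_nth \<chi> (m + n + 4) * (of_int (m + 2) / 2 * parity_sign m) +
        parity_sign n * fls_twisted_square \<chi> (m + n + 2)) v"
    by simp
  let ?c = "of_int (n + 2) / 2 :: complex"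
  have "smul ?c (Phi_field i (n + 2) (G_field \<chi> i m v)) + G_field \<chi> i m (smul ?c (Phi_field i (n + 2) v)) =
      smul ?c (G_field \<chi> i m (Phi_field i (n + 2) v) + Phi_field i (n + 2) (G_field \<chi> i m v))"
    by (simp only: linop_smul[OF linop_G_field] smul_add_right add.commute)
  also have "\<dots> = smul (?c * ((if m + n + 6 = 0 then of_int (m + 2) / 2 * parity_sign m else 0) +
      fls_nth \<chi> (m + n + 4) * parity_sign n)) v"
    unfolding G_field_Phi_field_anticommutator smul_smul by (simp add: algebra_simps)
  finally have 2: "smul ?c (Phi_field i (n + 2) (G_field \<chi> i m v)) + G_field \<chi> i m (smul ?c (Phi_field i (n + 2) v)) =
      smul (?c * ((if m + n + 6 = 0 then of_int (m + 2) / 2 * parity_sign m else 0) +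
      fls_nth \<chi> (m + n + 4) * parity_sign n)) v" .
  have "G_field \<chi> i m (G_field \<chi> i n v) + G_field \<chi> i n (G_field \<chi> i m v) =
      (smul ?c (Phi_field i (n + 2) (G_field \<chi> i m v)) + G_field \<chi> i m (smul ?c (Phi_field i (n + 2) v))) +
      (Sum_any (?f (G_field \<chi> i m v)) + G_field \<chi> i m (Sum_any (?f v)))"
    by (simp only: G_field_eq[of \<chi> i n] linop_add[OF linop_G_field] ac_simps)
  also have "\<dots> = smul (G_scalar \<chi> m n) v"
    unfolding 1 2 smul_add_same
    by (rule arg_cong2[where f = smul]) (simp_all add: G_scalar_def field_simps)
  finally show ?thesis .
qed

text \<open>The coefficients of \<open>(t + s) / (t - s) G(t) G(s)\<close>, expanded for \<open>|s| < |t|\<close>. The rational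
  factor is the contraction of two vertex operators; swapping the arguments expands it in the other
  region, and the difference of the two expansions is a scalar.\<close>

definition kernel_coeff :: "int \<Rightarrow> complex" where
  "kernel_coeff n = (if n < 0 then 0 else if n = 0 then 1 else 2)"

definition GG :: "complex fls \<Rightarrow> nat \<Rightarrow> int \<Rightarrow> int \<Rightarrow> (clifford_basis \<Rightarrow>\<^sub>0 complex) \<Rightarrow> (clifford_basis \<Rightarrow>\<^sub>0 complex)" where
  "GG \<chi> i p q v = Sum_any (\<lambda>n. smul (kernel_coeff n) (G_field \<chi> i (p + n) (G_field \<chi> i (q - n) v)))"

text \<open>Multiplication by \<open>1 - s/t\<close> clears the denominator and leaves
  \<open>(1 + s/t) G(t) G(s)\<close>.\<close>

lemma GG_step:
  "GG \<chi> i p q v - GG \<chi> i (p + 1) (q - 1) v =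
     G_field \<chi> i p (G_field \<chi> i q v) + G_field \<chi> i (p + 1) (G_field \<chi> i (q - 1) v)"
proof -
  define g where "g n = G_field \<chi> i (p + n) (G_field \<chi> i (q - n) v)" for n
  obtain N where N: "\<And>n. n < N \<Longrightarrow> G_field \<chi> i n v = 0" using truncatedE[OF truncated_G_field] by blast
  have g0: "g n = 0" if "q - n < N" for n
    using that by (simp add: g_def N linop_zero[OF linop_G_field])
  have fin: "finite {n. smul (kernel_coeff (n - k)) (g n) \<noteq> 0}" for k
  proof (rule finite_subset)
    have "smul (kernel_coeff (n - k)) (g n) = 0" if "n < k \<or> q - n < N" for n
      using that g0 by (auto simp: kernel_coeff_def)
    then show "{n. smul (kernel_coeff (n - k)) (g n) \<noteq> 0} \<subseteq> {k..q - N}" by force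
  qed simp
  have "GG \<chi> i (p + 1) (q - 1) v = Sum_any (\<lambda>n. smul (kernel_coeff ((n + 1) - 1)) (g (n + 1)))"
    by (simp add: GG_def g_def algebra_simps)
  also have "\<dots> = Sum_any (\<lambda>n. smul (kernel_coeff (n - 1)) (g n))"
    by (rule Sum_any_reindex[where h = "\<lambda>n. n + 1"]) (rule o_bij[of "\<lambda>n. n - 1"], auto)
  finally have "GG \<chi> i p q v - GG \<chi> i (p + 1) (q - 1) v =
      Sum_any (\<lambda>n. smul (kernel_coeff n) (g n) - smul (kernel_coeff (n - 1)) (g n))"
    using Sum_any_diff[OF fin[of 0] fin[of 1]] by (simp add: GG_def g_def)
  \<comment> \<open>The differences of the sequence 0, 1, 2, 2, ... are 1 at \<open>n = 0\<close>
    and \<open>n = 1\<close> and zero elsewhere.\<close>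
  also have "\<dots> = (\<Sum>n\<in>{0, 1}. smul (kernel_coeff n) (g n) - smul (kernel_coeff (n - 1)) (g n))"
    by (rule Sum_any_sum) (auto simp: kernel_coeff_def)
  also have "\<dots> = g 0 + g 1"
    by (simp add: kernel_coeff_def flip: smul_diff_left)
  finally show ?thesis by (simp add: g_def)
qed

text \<open>Both sides satisfy the same first-order difference equation along the lines
  \<open>p + q\<close> constant, so their difference is constant there; both are antisymmetric, so
  the constant is 0. The scalar on the right is the antisymmetric solution of that equation.\<close>

lemma GG_antisym:
  "GG \<chi> i p q v - GG \<chi> i q p v =
     smul (parity_sign p * ((if p + q + 6 = 0 then of_int (p + 3) / 4 else 0) -
       (if odd (p + q) then fls_nth \<chi> (p + q + 4) / 2 else 0))) v"
proof -
  define \<sigma> where "\<sigma> p q = parity_sign p * ((if p + q + 6 = 0 then of_int (p + 3) / 4 else 0) -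
       (if odd (p + q) then fls_nth \<chi> (p + q + 4) / 2 else 0))" for p q
  define D where "D p q = GG \<chi> i p q v - GG \<chi> i q p v - smul (\<sigma> p q) v" for p q
  have sigma_antisym: "\<sigma> q p = - \<sigma> p q" for p q
  proof -
    show ?thesis
    proof (cases "p + q + 6 = 0")
      case True
      then have "q = - p - 6" by simp
      then show ?thesis by (simp add: \<sigma>_def parity_sign_def)
    next
      case False
      then show ?thesis by (auto simp: \<sigma>_def parity_sign_def add.commute[of q p])
    qed
  qed
  \<comment> \<open>The terms \<open>fls_twisted_square\<close> have opposite parity signs at the
    two points and cancel. The mixed terms cancel for \<open>p + q\<close> even; what is left for
    \<open>p + q\<close> odd involves only the half-odd part of \<chi>, which is the origin of
    \<open>T(z)\<close>.\<close>
  have scalar: "G_scalar \<chi> p q + G_scalar \<chi> (p + 1) (q - 1) = \<sigma> p q - \<sigma> (p + 1) (q - 1)" for p q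
  proof -
    have q: "parity_sign (q - 1) = - parity_sign q" by (simp add: parity_sign_def)
    show ?thesis
    proof (cases "p + q + 6 = 0")
      case True
      then have q: "q = - p - 6" by simp
      show ?thesis
        unfolding q by (simp add: G_scalar_def \<sigma>_def parity_sign_def field_simps)
    next
      case False
      then show ?thesis
        by (simp add: G_scalar_def \<sigma>_def q parity_sign_def field_simps)
    qed
  qed
  have step: "D p q = D (p + 1) (q - 1)" for p q
  proof -
    have "(GG \<chi> i p q v - GG \<chi> i q p v) - (GG \<chi> i (p + 1) (q - 1) v - GG \<chi> i (q - 1) (p + 1) v) =
        (GG \<chi> i p q v - GG \<chi> i (p + 1) (q - 1) v) +
        (GG \<chi> i (q - 1) (p + 1) v - GG \<chi> i (q - 1 + 1) (p + 1 - 1) v)"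
      by simp
    also have "\<dots> = smul (G_scalar \<chi> p q + G_scalar \<chi> (p + 1) (q - 1)) v"
      unfolding GG_step smul_add_left G_field_anticommutator[of \<chi> i, symmetric] by (simp add: ac_simps)
    finally show ?thesis
      unfolding scalar smul_diff_left D_def by (simp add: algebra_simps)
  qed
  have iter: "D (p + n) (q - n) = D p q" for n
  proof (induction n rule: int_induct[of _ 0])
    case (step1 n)
    then show ?case using step[of "p + n" "q - n"] by (simp add: algebra_simps)
  next
    case (step2 n)
    then show ?case using step[of "p + (n - 1)" "q - (n - 1)"] by (simp add: algebra_simps)
  qed simp
  \<comment> \<open>Walking along the line from \<open>(p, q)\<close> to \<open>(q, p)\<close> shows
    that \<open>D\<close> is symmetric, while it is antisymmetric by construction.\<close>
  have "D q p = - D p q"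
    by (simp add: D_def sigma_antisym[of q p] smul_minus_left)
  moreover have "D q p = D p q" using iter[of "q - p"] by simp
  ultimately have "smul 2 (D p q) = 0"
    by (metis add.right_inverse one_add_one smul_add_left smul_one)
  then have "smul (1 / 2) (smul 2 (D p q)) = 0" by simp
  then have "D p q = 0" by simp
  then show ?thesis by (simp add: D_def \<sigma>_def)
qed

section \<open>The affine action\<close>

definition X_field :: "complex fls \<Rightarrow> nat \<Rightarrow> nat \<Rightarrow> FF_basis series" where
  "X_field \<chi> i j = ser_tens (G_field \<chi> i) (Y_tw j)"

lemma truncated_X_field: "truncated (X_field \<chi> i j)"
  unfolding X_field_def by (rule truncated_ser_tens[OF truncated_G_field truncated_Y_tw])

lemmas linop_X_field = truncated_linop[OF truncated_X_field]

lemma X_field_tens: "X_field \<chi> i j n (tens u v) = Sum_any (\<lambda>p. tens (G_field \<chi> i p u) (Y_tw j (n - p) v))"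
  unfolding X_field_def by (rule ser_tens_tens[OF truncated_G_field truncated_Y_tw])

lemma X_field_tens_finite: "finite {p. tens (G_field \<chi> i p u) (Y_tw j (n - p) v) \<noteq> 0}"
  using ser_tens_finite[OF truncated_G_field truncated_Y_tw, of \<chi> i j n "tens u v"]
  by (simp add: tens_op_tens linop_G_field linop_Y_tw)

lemma X_field_commutator:
  "tbeta l (X_field \<chi> i j n v) = X_field \<chi> i j n (tbeta l v) - X_field \<chi> i j (n - (2 * l + 1)) v"
proof (rule tens_ext[where f = "\<lambda>v. tbeta l (X_field \<chi> i j n v)"])
  show "linop (\<lambda>v. tbeta l (X_field \<chi> i j n v))"
    by (rule linop_comp[OF linop_tbeta linop_X_field])
  show "linop (\<lambda>v. X_field \<chi> i j n (tbeta l v) - X_field \<chi> i j (n - (2 * l + 1)) v)"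
    by (rule linop_minus_fun[OF linop_comp[OF linop_X_field linop_tbeta] linop_X_field])
next
  fix a b
  let ?u = "bvec a :: clifford_basis \<Rightarrow>\<^sub>0 complex" and ?v = "bvec b :: fock_basis \<Rightarrow>\<^sub>0 complex"
  have idx: "n - p - (2 * l + 1) = n - (2 * l + 1) - p" for p by simp
  have "tbeta l (X_field \<chi> i j n (tens ?u ?v)) =
      Sum_any (\<lambda>p. tens (G_field \<chi> i p ?u) (Y_tw j (n - p) (beta l ?v)) -
        tens (G_field \<chi> i p ?u) (Y_tw j (n - (2 * l + 1) - p) ?v))"
    unfolding X_field_tens linop_Sum_any[OF linop_tbeta X_field_tens_finite] tbeta_tens
      Y_tw_commutator idx linop_diff[OF linop_tens_right[OF linop_id]] ..
  also have "\<dots> = X_field \<chi> i j n (tbeta l (tens ?u ?v)) - X_field \<chi> i j (n - (2 * l + 1)) (tens ?u ?v)"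
    unfolding tbeta_tens X_field_tens by (rule Sum_any_diff[OF X_field_tens_finite X_field_tens_finite])
  finally show "tbeta l (X_field \<chi> i j n (tens ?u ?v)) =
      X_field \<chi> i j n (tbeta l (tens ?u ?v)) - X_field \<chi> i j (n - (2 * l + 1)) (tens ?u ?v)" .
qed

text \<open>The Fock factor contributes only at total exponent 2, which ties the exponents of the
  two \<open>G\<close> together, with -4 times a contraction coefficient. The shifts by 1 come from
  the prefactors of the vertex operators.\<close>

lemma lookup_X_field_X_field_vac:
  "Poly_Mapping.lookup (X_field \<chi> i j a (X_field \<chi> i j b (tens u (bvec 0)))) (T, 0) =
     - 4 * Poly_Mapping.lookup (GG \<chi> i (a - 1) (b - 1) u) T"
proof -
  let ?G = "G_field \<chi> i" and ?Y = "Y_tw j"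
  define f where "f p = tens (?G p u) (?Y (b - p) (bvec 0))" for p
  define g where "g p = Poly_Mapping.lookup (X_field \<chi> i j a (f p)) (T, 0)" for p
  have fin: "finite {p. f p \<noteq> 0}"
    unfolding f_def by (rule X_field_tens_finite)
  have fin': "finite {p. X_field \<chi> i j a (f p) \<noteq> 0}"
    by (rule finite_subset[OF _ fin]) (auto simp: linop_zero[OF linop_X_field])
  have "Poly_Mapping.lookup (X_field \<chi> i j a (X_field \<chi> i j b (tens u (bvec 0)))) (T, 0) = Sum_any g"
    unfolding X_field_tens[of _ _ _ b] f_def[symmetric] linop_Sum_any[OF linop_X_field fin]
      lookup_Sum_any[OF fin'] g_def ..
  \<comment> \<open>After this substitution \<open>n\<close> is the exponent of \<open>s/t\<close>
    in the contraction factor.\<close>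
  also have "\<dots> = Sum_any (\<lambda>n. g (b - 1 - n))"
    by (rule Sum_any_reindex[symmetric, of "\<lambda>n. b - 1 - n"]) (rule o_bij[of "\<lambda>n. b - 1 - n"], auto)
  also have "(\<lambda>n. g (b - 1 - n)) =
      (\<lambda>n. - 4 * Poly_Mapping.lookup (smul (kernel_coeff n) (?G (a - 1 + n) (?G (b - 1 - n) u))) T)"
  proof
    fix n
    have "g (b - 1 - n) = Sum_any (\<lambda>r. Poly_Mapping.lookup (?G r (?G (b - 1 - n) u)) T *
        Poly_Mapping.lookup (?Y (a - r) (?Y (b - (b - 1 - n)) (bvec 0))) 0)"
      unfolding g_def f_def X_field_tens lookup_Sum_any[OF X_field_tens_finite] lookup_tens ..
    also have "\<dots> = (\<Sum>r\<in>{a - 1 + n}. Poly_Mapping.lookup (?G r (?G (b - 1 - n) u)) T *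
        Poly_Mapping.lookup (?Y (a - r) (?Y (b - (b - 1 - n)) (bvec 0))) 0)"
      by (rule Sum_any_sum) (auto simp: lookup_Y_tw_Y_tw_vac)
    also have "\<dots> = - 4 * Poly_Mapping.lookup (smul (kernel_coeff n) (?G (a - 1 + n) (?G (b - 1 - n) u))) T"
      by (simp add: lookup_Y_tw_Y_tw_vac kernel_coeff_def)
    finally show "g (b - 1 - n) = \<dots>" .
  qed
  also have "Sum_any (\<lambda>n. - 4 * Poly_Mapping.lookup (smul (kernel_coeff n) (?G (a - 1 + n) (?G (b - 1 - n) u))) T) =
      - 4 * Poly_Mapping.lookup (GG \<chi> i (a - 1) (b - 1) u) T"
  proof -
    obtain N where N: "\<And>n. n < N \<Longrightarrow> ?G n u = 0" using truncatedE[OF truncated_G_field] by blast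
    have "smul (kernel_coeff n) (?G (a - 1 + n) (?G (b - 1 - n) u)) = 0" if "n < 0 \<or> b - 1 - n < N" for n
      using that N by (auto simp: kernel_coeff_def linop_zero[OF linop_G_field])
    then have "{n. smul (kernel_coeff n) (?G (a - 1 + n) (?G (b - 1 - n) u)) \<noteq> 0} \<subseteq> {0..b - 1 - N}"
      by force
    then have fin: "finite {n. smul (kernel_coeff n) (?G (a - 1 + n) (?G (b - 1 - n) u)) \<noteq> 0}"
      by (rule finite_subset) simp
    have "finite {n. Poly_Mapping.lookup (smul (kernel_coeff n) (?G (a - 1 + n) (?G (b - 1 - n) u))) T \<noteq> 0}"
      by (rule finite_subset[OF _ fin]) (auto simp del: lookup_smul)
    then show ?thesis
      unfolding GG_def lookup_Sum_any[OF fin] by (rule Sum_any_right_distrib[symmetric])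
  qed
  finally show ?thesis .
qed

section \<open>Commutation relations of the fields \<open>X_+\<close> and \<open>h\<close>\<close>

lemma FF_X_eq: "FF_X \<chi> i j n v = smul (1 / complex_of_real (sqrt 2)) (X_field \<chi> i j n v)"
  by (simp add: FF_X_def ser_scale_def X_field_def)

lemma linop_FF_X: "linop (FF_X \<chi> i j n)"
  unfolding FF_X_eq[abs_def] by (rule linop_scaled[OF linop_X_field])

lemma FF_X_commutator:
  "tbeta l (FF_X \<chi> i j n v) = FF_X \<chi> i j n (tbeta l v) - FF_X \<chi> i j (n - (2 * l + 1)) v"
  by (simp add: FF_X_eq linop_smul[OF linop_tbeta] X_field_commutator smul_diff_right)

lemma FF_h_eq:
  "FF_h \<chi> n v = (if odd n then smul (-2) (tbeta ((- n - 3) div 2) v) + smul (2 * fls_nth \<chi> n) v else 0)"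
proof -
  have 0: "tens_op (\<lambda>v. 0) B v = 0" "tens_op A (\<lambda>v. 0) v = 0"
    for v :: FF_space and A :: "(clifford_basis \<Rightarrow>\<^sub>0 complex) \<Rightarrow> (clifford_basis \<Rightarrow>\<^sub>0 complex)"
      and B :: "(fock_basis \<Rightarrow>\<^sub>0 complex) \<Rightarrow> (fock_basis \<Rightarrow>\<^sub>0 complex)"
    by (simp_all add: tens_op_def lin_def tens_bilinear case_prod_unfold)
  have one: "ser_one n = (\<lambda>v. if n = 0 then v else 0)" for n
    by (rule ext) (simp add: ser_one_def)
  have "ser_tens ser_one beta_field n v = (\<Sum>p\<in>{0}. tens_op (ser_one p) (beta_field (n - p)) v)"
    unfolding ser_tens_def by (rule Sum_any_sum) (auto simp: one 0)
  also have "\<dots> = (if odd n then tbeta ((- n - 3) div 2) v else 0)"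
    by (simp add: one tbeta_def beta_field_def[abs_def] 0)
  finally have 1: "ser_tens ser_one beta_field n v = (if odd n then tbeta ((- n - 3) div 2) v else 0)" .
  have "ser_tens (T_field \<chi>) ser_one n v = (\<Sum>p\<in>{n}. tens_op (T_field \<chi> p) (ser_one (n - p)) v)"
    unfolding ser_tens_def by (rule Sum_any_sum) (auto simp: one 0)
  also have "\<dots> = smul (if odd n then fls_nth \<chi> n else 0) v"
  proof -
    have "tens_op (T_field \<chi> n) (ser_one 0) v = smul (if odd n then fls_nth \<chi> n else 0) v"
      by (rule tens_ext[OF linop_tens_op linop_smul_const])
        (simp add: tens_op_bvec one T_field_def ser_fls_def[abs_def] fls_nth_half_part tens_bilinear)
    then show ?thesis by simp
  qed
  finally show ?thesis
    by (simp add: FF_h_def ser_add_def ser_scale_def 1)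
qed

lemma linop_FF_h: "linop (FF_h \<chi> n)"
  unfolding FF_h_eq[abs_def]
  by (intro linop_intros linop_scaled[OF linop_tbeta] linop_smul_const)

lemma FF_h_commutator:
  "tbeta l (FF_h \<chi> n v) = FF_h \<chi> n (tbeta l v) + smul (if n = 2 * l - 1 then of_int (2 * l + 1) else 0) v"
proof (cases "odd n")
  case True
  define m where "m = (- n - 3) div 2"
  have n: "n = - (2 * m) - 3" using True by (auto simp: m_def elim!: oddE)
  have "l + m + 1 = 0 \<longleftrightarrow> n = 2 * l - 1" by (auto simp: n)
  moreover have "- 2 * - (of_int l + 1 / 2) = (of_int (2 * l + 1) :: complex)" by simp
  ultimately have "smul (- 2) (smul (if l + m + 1 = 0 then - (of_int l + 1 / 2) else 0) v) =
      smul (if n = 2 * l - 1 then of_int (2 * l + 1) else 0) v"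
    by (simp only: smul_smul) (auto simp: add.commute)
  then show ?thesis
    using True by (simp only: FF_h_eq if_True not_False_eq_True linop_add[OF linop_tbeta] linop_smul[OF linop_tbeta]
        tbeta_commutator[of l m] smul_add_right m_def[symmetric] ac_simps)
next
  case False
  then show ?thesis by (auto simp: FF_h_eq linop_zero[OF linop_tbeta])
qed

lemma lookup_tbeta_vac: "Poly_Mapping.lookup (tbeta l (bvec (S, 0))) (T, 0) = 0"
  by (cases "l < 0") (simp_all add: lookup_tbeta_creat_zero tbeta_annih_vac)

text \<open>The defect is a covariant family indexed by pairs: commuting with \<open>tbeta l\<close>
  lowers \<open>a\<close> or \<open>b\<close> by \<open>2l + 1\<close>. Vacuum coefficients detect
  only the scalar part of \<open>h\<close>; its \<beta> part is forced by covariance.\<close>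

theorem FF_X_FF_X_commutator:
  "FF_X \<chi> i j a (FF_X \<chi> i j b v) - FF_X \<chi> i j b (FF_X \<chi> i j a v) =
     smul (if a + b + 4 = 0 then parity_sign a * of_int (a + 2) / 2 else 0) v -
     smul (parity_sign a / 2) (FF_h \<chi> (a + b + 2) v)"
proof -
  let ?X = "FF_X \<chi> i j"
  define \<delta> where "\<delta> a b = (if a + b + 4 = 0 then parity_sign a * of_int (a + 2) / 2 else 0)" for a b
  define Z where "Z = (\<lambda>(a, b) v. ?X a (?X b v) - ?X b (?X a v) -
     (smul (\<delta> a b) v - smul (parity_sign a / 2) (FF_h \<chi> (a + b + 2) v)))"
  have "Z (a, b) v = 0"
  proof (rule covariant_family_zero[of Z])
    fix x
    show "linop (Z x)"
      unfolding Z_def case_prod_unfold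
      by (intro linop_minus_fun linop_comp[OF linop_FF_X] linop_FF_X linop_smul_const
          linop_scaled[OF linop_FF_h])
  next
    fix x :: "int \<times> int" and l :: int
    obtain a b where x: "x = (a, b)" by force
    define k where "k = 2 * l + 1"
    have "tbeta l (Z (a, b) v) - Z (a, b) (tbeta l v) =
        smul (-1) (Z (a - k, b) v) + smul (-1) (Z (a, b - k) v)" for v
    proof -
      have sgn: "parity_sign (a - k) = - parity_sign a" by (simp add: parity_sign_def k_def)
      have eq: "a + b + 2 = 2 * l - 1 \<longleftrightarrow> a + b + 4 = k" by (auto simp: k_def)
      have X2: "tbeta l (?X p (?X q v)) = ?X p (?X q (tbeta l v)) - ?X p (?X (q - k) v) - ?X (p - k) (?X q v)"
        for p q
        unfolding FF_X_commutator linop_diff[OF linop_FF_X] k_def ..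
      have h: "tbeta l (FF_h \<chi> (a + b + 2) v) = FF_h \<chi> (a + b + 2) (tbeta l v) +
          smul (if a + b + 4 = k then of_int k else 0) v"
        using FF_h_commutator[of l \<chi> "a + b + 2" v] unfolding eq k_def[symmetric] .
      \<comment> \<open>The scalar produced by commuting \<open>tbeta l\<close> with
        \<open>h\<close> must split between the two shifted pairs; since \<open>k\<close> is odd,
        the sign changes in the first and the linear terms subtract to \<open>k\<close>.\<close>
      have sc: "parity_sign a / 2 * (if a + b + 4 = k then of_int k else 0) = \<delta> (a - k) b + \<delta> a (b - k)"
        by (auto simp: \<delta>_def sgn field_simps)
      have idx: "a - k + b + 2 = a + b + 2 - k" "a + (b - k) + 2 = a + b + 2 - k" by simp_all
      have "tbeta l (Z (a, b) v) - Z (a, b) (tbeta l v) =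
          - (?X (a - k) (?X b v) - ?X b (?X (a - k) v)) - (?X a (?X (b - k) v) - ?X (b - k) (?X a v)) +
          smul (parity_sign a / 2) (smul (if a + b + 4 = k then of_int k else 0) v)"
        unfolding Z_def prod.case
        by (simp only: linop_diff[OF linop_tbeta] linop_smul[OF linop_tbeta] X2 h smul_add_right)
          (simp add: algebra_simps)
      also have "smul (parity_sign a / 2) (smul (if a + b + 4 = k then of_int k else 0) v) =
          smul (\<delta> (a - k) b) v + smul (\<delta> a (b - k)) v"
        unfolding smul_smul sc smul_add_left ..
      finally show ?thesis
        unfolding Z_def prod.case idx sgn smul_minus_left smul_one
        by (simp add: smul_minus_left algebra_simps)
    qed
    then show "\<exists>c y c' y'. \<forall>v. tbeta l (Z x v) - Z x (tbeta l v) = smul c (Z y v) + smul c' (Z y' v)"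
      unfolding x by blast
  next
    fix x :: "int \<times> int" and S T
    obtain a b where x: "x = (a, b)" by force
    have 2: "1 / complex_of_real (sqrt 2) * (1 / complex_of_real (sqrt 2)) = 1 / 2"
      by (simp flip: of_real_mult)
    have XX: "Poly_Mapping.lookup (?X p (?X q (bvec (S, 0)))) (T, 0) =
        - 2 * Poly_Mapping.lookup (GG \<chi> i (p - 1) (q - 1) (bvec S)) T" for p q
      unfolding FF_X_eq linop_smul[OF linop_X_field] smul_smul 2 lookup_smul
        lookup_X_field_X_field_vac[of \<chi> i j p q "bvec S" T, unfolded tens_bvec] by simp
    have h: "Poly_Mapping.lookup (FF_h \<chi> n (bvec (S, 0))) (T, 0) =
        (if odd n then 2 * fls_nth \<chi> n else 0) * Poly_Mapping.lookup (bvec S) T" for n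
      by (auto simp: FF_h_eq lookup_add lookup_tbeta_vac lookup_single when_def)
    have "Poly_Mapping.lookup (?X a (?X b (bvec (S, 0)))) (T, 0) - Poly_Mapping.lookup (?X b (?X a (bvec (S, 0)))) (T, 0) =
        - 2 * Poly_Mapping.lookup (GG \<chi> i (a - 1) (b - 1) (bvec S) - GG \<chi> i (b - 1) (a - 1) (bvec S)) T"
      unfolding XX lookup_minus by (simp add: algebra_simps)
    also have "\<dots> = (\<delta> a b - (if odd (a + b) then parity_sign a * fls_nth \<chi> (a + b + 2) else 0)) *
        Poly_Mapping.lookup (bvec S) T"
    proof -
      have idx: "a - 1 + (b - 1) + 6 = a + b + 4" "a - 1 + 3 = a + 2" "a - 1 + (b - 1) + 4 = a + b + 2"
        "odd (a - 1 + (b - 1)) \<longleftrightarrow> odd (a + b)" "parity_sign (a - 1) = - parity_sign a"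
        by (simp_all add: parity_sign_def)
      have "- 2 * (- s * ((if P then c / 4 else 0) - (if Q then d / 2 else 0))) =
          (if P then s * c / 2 else 0) - (if Q then s * d else 0)" for s c d :: complex and P Q
        by (simp add: algebra_simps)
      then show ?thesis
        unfolding GG_antisym lookup_smul idx \<delta>_def mult.assoc[symmetric, of "- 2"] by (simp only:)
    qed
    finally show "Poly_Mapping.lookup (Z x (bvec (S, 0))) (T, 0) = 0"
      unfolding x Z_def prod.case lookup_minus lookup_smul h
      by (auto simp: lookup_single when_def)
  qed
  then show ?thesis by (simp add: Z_def \<delta>_def)
qed

lemma FF_h_FF_X_commutator:
  assumes "odd m"
  shows "FF_h \<chi> m (FF_X \<chi> i j n v) - FF_X \<chi> i j n (FF_h \<chi> m v) = smul 2 (FF_X \<chi> i j (n + m + 2) v)"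
proof -
  define l where "l = (- m - 3) div 2"
  have m: "m = - (2 * l) - 3" using assms by (auto simp: l_def elim!: oddE)
  have idx: "n - (2 * l + 1) = n + m + 2" by (simp add: m)
  have "tbeta l (FF_X \<chi> i j n v) = FF_X \<chi> i j n (tbeta l v) - FF_X \<chi> i j (n + m + 2) v"
    using FF_X_commutator[of l \<chi> i j n v] unfolding idx .
  with assms show ?thesis
    by (simp add: FF_h_eq l_def[symmetric] linop_add[OF linop_FF_X] linop_smul[OF linop_FF_X]
        linop_diff[OF linop_FF_X] smul_diff_right smul_minus_left)
qed

lemma FF_h_FF_h_commutator:
  assumes "odd m" "odd n"
  shows "FF_h \<chi> m (FF_h \<chi> n v) - FF_h \<chi> n (FF_h \<chi> m v) =
    smul (if m + n + 4 = 0 then 2 * of_int (m + 2) else 0) v"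
proof -
  define l where "l = (- m - 3) div 2"
  have m: "m = - (2 * l) - 3" using assms by (auto simp: l_def elim!: oddE)
  have eq: "n = 2 * l - 1 \<longleftrightarrow> m + n + 4 = 0" by (auto simp: m)
  have "2 * l + 1 = - (m + 2)" by (simp add: m)
  then have sc: "- 2 * (if m + n + 4 = 0 then of_int (2 * l + 1) else 0) =
      (if m + n + 4 = 0 then 2 * of_int (m + 2) else (0 :: complex))"
    by (simp only: of_int_minus) simp
  have "FF_h \<chi> m (FF_h \<chi> n v) - FF_h \<chi> n (FF_h \<chi> m v) =
      smul (- 2) (tbeta l (FF_h \<chi> n v)) - smul (- 2) (FF_h \<chi> n (tbeta l v))"
    using assms(1) by (simp add: FF_h_eq[of \<chi> m] l_def[symmetric] linop_add[OF linop_FF_h] linop_smul[OF linop_FF_h])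
  also have "\<dots> = smul (- 2 * (if m + n + 4 = 0 then of_int (2 * l + 1) else 0)) v"
    unfolding FF_h_commutator eq by (simp add: smul_add_right)
  finally show ?thesis unfolding sc .
qed

section \<open>The twisted module\<close>

lemma FF_bvec: "FF \<chi> i j (bvec b) v = FF_basis_act \<chi> i j b v"
  by (simp add: FF_def)

lemma FF_single: "FF \<chi> i j (Poly_Mapping.single b c) v = smul c (FF_basis_act \<chi> i j b v)"
  by (simp add: FF_def)

lemma linop_FF_basis_act: "linop (FF_basis_act \<chi> i j b)"
  by (cases b) (auto simp: linop_iff linop_add[OF linop_FF_h] linop_smul[OF linop_FF_h]
      linop_add[OF linop_FF_X] linop_smul[OF linop_FF_X] smul_add_right mult.commute)

lemma linop_FF: "linop (FF \<chi> i j x)"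
  unfolding FF_def[abs_def] lin_def by (intro linop_intros linop_scaled[OF linop_FF_basis_act])

lemma linop_FF_left: "linop (\<lambda>x. FF \<chi> i j x v)"
  by (simp add: FF_def linear_lin)

text \<open>Even and odd doubled exponents of \<open>X_+\<close> carry \<open>x^+\<close> and
  \<open>x^-\<close>, so one commutator formula gives all brackets between them, the parity sign
  accounting for their different signs. Two exponents of equal parity lead to an even exponent of
  \<open>h\<close>, where it vanishes; such brackets are central.\<close>

lemma FF_basis_bracket:
  "FF \<chi> i j (basis_bracket a b) v =
     FF_basis_act \<chi> i j a (FF_basis_act \<chi> i j b v) - FF_basis_act \<chi> i j b (FF_basis_act \<chi> i j a v)"
proof -
  let ?X = "FF_X \<chi> i j"
  \<comment> \<open>The modes are twice the coefficients of \<open>X_+\<close>, whence the factor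
    4.\<close>
  have XX: "smul 2 (?X p (smul 2 (?X q v))) - smul 2 (?X q (smul 2 (?X p v))) =
      smul (if p + q + 4 = 0 then 2 * parity_sign p * of_int (p + 2) else 0) v -
      smul (2 * parity_sign p) (FF_h \<chi> (p + q + 2) v)" for p q
  proof -
    have "smul 2 (?X p (smul 2 (?X q v))) - smul 2 (?X q (smul 2 (?X p v))) =
        smul 4 (?X p (?X q v) - ?X q (?X p v))"
      by (simp add: linop_smul[OF linop_FF_X] smul_diff_right)
    then show ?thesis unfolding FF_X_FF_X_commutator by (simp add: smul_diff_right mult.assoc)
  qed
  have hX: "FF_h \<chi> m (smul 2 (?X n v)) - smul 2 (?X n (FF_h \<chi> m v)) = smul 4 (?X (n + m + 2) v)"
    if "odd m" for m n
  proof -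
    have "FF_h \<chi> m (smul 2 (?X n v)) - smul 2 (?X n (FF_h \<chi> m v)) =
        smul 2 (FF_h \<chi> m (?X n v) - ?X n (FF_h \<chi> m v))"
      by (simp add: linop_smul[OF linop_FF_h] smul_diff_right)
    then show ?thesis by (simp add: FF_h_FF_X_commutator[OF that])
  qed
  have Xh: "smul 2 (?X n (FF_h \<chi> m v)) - FF_h \<chi> m (smul 2 (?X n v)) = - smul 4 (?X (n + m + 2) v)"
    if "odd m" for m n
    using hX[OF that, of n] by (metis minus_diff_eq)
  have K: "FF_basis_act \<chi> i j c (smul (- 2) w) = smul (- 2) (FF_basis_act \<chi> i j c w)" for c w
    by (rule linop_smul[OF linop_FF_basis_act])
  have h0: "FF_h \<chi> m v = 0" if "even m" for m
    using that by (simp add: FF_h_eq)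
  have zero: "FF \<chi> i j 0 v = 0" by (simp add: FF_def)
  show ?thesis
  proof (cases a)
    case K_elt
    then show ?thesis using K by (simp add: zero)
  next
    case a: (h_elt l)
    show ?thesis
    proof (cases b)
      case K_elt
      then show ?thesis using K[of "h_elt l" v] by (simp add: zero a)
    next
      case (h_elt m)
      have "- 2 * l - 3 + (- 2 * m - 3) + 4 = 0 \<longleftrightarrow> l + m + 1 = 0" by presburger
      then show ?thesis
        using FF_h_FF_h_commutator[of "- 2 * l - 3" "- 2 * m - 3" \<chi> v]
        by (simp add: a h_elt FF_single algebra_simps)
    next
      case (xm_elt m)
      have idx: "- 2 * m - 3 + (- 2 * l - 3) + 2 = - 2 * (l + m + 1) - 2" by simp
      show ?thesis
        using hX[of "- 2 * l - 3" "- 2 * m - 3", unfolded idx] by (simp add: a xm_elt FF_single)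
    next
      case (xp_elt r)
      have idx: "- 2 * r - 2 + (- 2 * l - 3) + 2 = - 2 * (l + r) - 3" by simp
      show ?thesis
        using hX[of "- 2 * l - 3" "- 2 * r - 2", unfolded idx] by (simp add: a xp_elt FF_single)
    qed
  next
    case a: (xm_elt l)
    show ?thesis
    proof (cases b)
      case K_elt
      then show ?thesis using K[of "xm_elt l" v] by (simp add: zero a)
    next
      case (h_elt m)
      have idx: "- 2 * l - 3 + (- 2 * m - 3) + 2 = - 2 * (m + l + 1) - 2" by simp
      show ?thesis
        using Xh[of "- 2 * m - 3" "- 2 * l - 3", unfolded idx]
        by (simp add: a h_elt FF_single smul_minus_left)
    next
      case (xm_elt m)
      have "- 2 * l - 3 + (- 2 * m - 3) + 4 = 0 \<longleftrightarrow> l + m + 1 = 0" by presburger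
      moreover have "of_int (- 2 * l - 3 + 2) = - 2 * (of_int l + 1 / 2 :: complex)" by simp
      ultimately show ?thesis
        using XX[of "- 2 * l - 3" "- 2 * m - 3"]
        by (simp add: a xm_elt FF_single h0 parity_sign_def add.commute[of 2])
    next
      case (xp_elt r)
      have idx: "- 2 * l - 3 + (- 2 * r - 2) + 2 = - 2 * (l + r) - 3"
        "(- 2 * l - 3 + (- 2 * r - 2) + 4 = 0) = False" by presburger+
      show ?thesis
        using XX[of "- 2 * l - 3" "- 2 * r - 2", unfolded idx]
        by (simp add: a xp_elt FF_single parity_sign_def smul_minus_left)
    qed
  next
    case a: (xp_elt r)
    show ?thesis
    proof (cases b)
      case K_elt
      then show ?thesis using K[of "xp_elt r" v] by (simp add: zero a)
    next
      case (h_elt m)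
      have idx: "- 2 * r - 2 + (- 2 * m - 3) + 2 = - 2 * (m + r) - 3" by simp
      show ?thesis
        using Xh[of "- 2 * m - 3" "- 2 * r - 2", unfolded idx] by (simp add: a h_elt FF_single smul_minus_left)
    next
      case (xm_elt m)
      have idx: "- 2 * r - 2 + (- 2 * m - 3) + 2 = - 2 * (m + r) - 3"
        "(- 2 * r - 2 + (- 2 * m - 3) + 4 = 0) = False" by presburger+
      show ?thesis
        using XX[of "- 2 * r - 2" "- 2 * m - 3", unfolded idx]
        by (simp add: a xm_elt FF_single parity_sign_def smul_minus_left)
    next
      case (xp_elt s)
      have "- 2 * r - 2 + (- 2 * s - 2) + 4 = 0 \<longleftrightarrow> r + s = 0" by presburger
      then show ?thesis
        using XX[of "- 2 * r - 2" "- 2 * s - 2"]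
        by (simp add: a xp_elt FF_single h0 parity_sign_def)
    qed
  qed
qed

lemma lie_module_FF: "lie_module smul (FF \<chi> i j)"
  unfolding lie_module_def
proof (intro conjI allI vector_space_smul linop_FF linop_FF_left)
  fix x y v
  have lin_bracket: "linop (\<lambda>x. bracket x y)" "linop (bracket x)" for x y
    by (simp_all add: linop_iff bracket_linear)
  have 1: "FF \<chi> i j (bracket (bvec a) y) v = FF \<chi> i j (bvec a) (FF \<chi> i j y v) - FF \<chi> i j y (FF \<chi> i j (bvec a) v)"
    for a y
  proof (rule lin_ext[where f = "\<lambda>y. FF \<chi> i j (bracket (bvec a) y) v"])
    show "linop (\<lambda>y. FF \<chi> i j (bracket (bvec a) y) v)"
      by (rule linop_comp[OF linop_FF_left lin_bracket(2)])
    show "linop (\<lambda>y. FF \<chi> i j (bvec a) (FF \<chi> i j y v) - FF \<chi> i j y (FF \<chi> i j (bvec a) v))"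
      by (rule linop_minus_fun[OF linop_comp[OF linop_FF linop_FF_left] linop_FF_left])
  qed (simp add: FF_bvec FF_basis_bracket)
  show "FF \<chi> i j (bracket x y) v = FF \<chi> i j x (FF \<chi> i j y v) - FF \<chi> i j y (FF \<chi> i j x v)"
  proof (rule lin_ext[where f = "\<lambda>x. FF \<chi> i j (bracket x y) v"])
    show "linop (\<lambda>x. FF \<chi> i j (bracket x y) v)"
      by (rule linop_comp[OF linop_FF_left lin_bracket(1)])
    show "linop (\<lambda>x. FF \<chi> i j x (FF \<chi> i j y v) - FF \<chi> i j y (FF \<chi> i j x v))"
      by (rule linop_minus_fun[OF linop_FF_left linop_comp[OF linop_FF linop_FF_left]])
  qed (rule 1)
qed

lemma tbeta_annih_bvec:
  "tbeta (int m) (bvec (a, e)) =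
     smul (- (of_nat m + 1 / 2) * of_nat (Poly_Mapping.lookup e m)) (bvec (a, e - Poly_Mapping.single m 1))"
proof -
  have single: "Poly_Mapping.single x c = smul c (bvec x)" for x :: fock_basis and c
    by (simp add: smul_single)
  have "beta (int m) (bvec e) =
      smul (- (of_nat m + 1 / 2) * of_nat (Poly_Mapping.lookup e m)) (bvec (e - Poly_Mapping.single m 1))"
    unfolding beta_def fock_deriv_single single[of _ "1 * of_nat _"] by simp
  then show ?thesis
    by (simp only: tbeta_def tens_op_bvec tens_bilinear tens_bvec)
qed

lemma truncated_FF_h: "truncated (FF_h \<chi>)"
proof (rule truncatedI)
  fix x :: FF_basis
  obtain S e where x: "x = (S, e)" by force
  obtain M where M: "\<forall>m\<in>Poly_Mapping.keys e. m \<le> M"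
    using finite_nat_set_iff_bounded_le[of "Poly_Mapping.keys e"] by auto
  obtain N where N: "\<forall>n<N. fls_nth \<chi> n = 0" using fls_nth_below by blast
  have "FF_h \<chi> n (bvec x) = 0" if n: "n < min N (- 2 * int M - 5)" for n
  proof (cases "odd n")
    case True
    define m where "m = nat ((- n - 3) div 2)"
    have m: "(- n - 3) div 2 = int m" "M < m" using n by (auto simp: m_def)
    then have "m \<notin> Poly_Mapping.keys e" using M by auto
    then have "Poly_Mapping.lookup e m = 0" by (simp add: in_keys_iff)
    then show ?thesis using N n by (simp add: FF_h_eq m x tbeta_annih_bvec)
  qed (simp add: FF_h_eq)
  then show "\<exists>N. \<forall>n<N. FF_h \<chi> n (bvec x) = 0" by blast
qed (rule linop_FF_h)

theorem twisted_module_FF: "twisted_module smul (FF \<chi> i j)"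
  unfolding twisted_module_def
proof (intro conjI lie_module_FF)
  show "has_level smul (FF \<chi> i j) (- 2)"
    by (simp add: has_level_def FF_bvec)
  show "restricted (FF \<chi> i j)"
    unfolding restricted_def
  proof
    fix v
    obtain N1 where N1: "\<And>n. n < N1 \<Longrightarrow> X_field \<chi> i j n v = 0"
      using truncatedE[OF truncated_X_field] by blast
    obtain N2 where N2: "\<And>n. n < N2 \<Longrightarrow> FF_h \<chi> n v = 0"
      using truncatedE[OF truncated_FF_h] by blast
    show "\<exists>N. \<forall>n\<ge>N. FF \<chi> i j (bvec (h_elt n)) v = 0 \<and> FF \<chi> i j (bvec (xm_elt n)) v = 0 \<and>
        FF \<chi> i j (bvec (xp_elt n)) v = 0"
      by (rule exI[of _ "\<bar>N1\<bar> + \<bar>N2\<bar>"]) (auto simp: FF_bvec FF_X_eq N1 N2)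
  qed
qed

lemma X_plus_FF: "X_plus (FF \<chi> i j) = FF_X \<chi> i j"
proof (intro ext)
  fix n :: int and v
  have "- 2 * ((- n - 2) div 2) - 2 = n" if "even n" using that by (auto elim!: evenE)
  moreover have "- 2 * ((- n - 3) div 2) - 3 = n" if "odd n" using that by (auto elim!: oddE)
  ultimately show "X_plus (FF \<chi> i j) n v = FF_X \<chi> i j n v"
    by (simp add: X_plus_def FF_bvec)
qed

lemma h_series_FF: "h_series (FF \<chi> i j) = FF_h \<chi>"
proof (intro ext)
  fix n :: int and v
  have "- 2 * ((- n - 3) div 2) - 3 = n" if "odd n" using that by (auto elim!: oddE)
  then show "h_series (FF \<chi> i j) n v = FF_h \<chi> n v"
    by (simp add: h_series_def FF_bvec FF_h_eq)
qed

section \<open>Irreducibility\<close>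

lemma lookup_Phi_annih:
  "Poly_Mapping.lookup (Phi i (int p + 1) v) S =
     (if p |\<in>| S then 0
      else - ((-1) powi (int p + 1)) * koszul_sign p S * Poly_Mapping.lookup v (finsert p S))"
proof (induction v rule: basis_induct)
  case (add u R c)
  have "Poly_Mapping.lookup (Phi i (int p + 1) (bvec R)) S =
     (if p |\<in>| S then 0
      else - ((-1) powi (int p + 1)) * koszul_sign p S * Poly_Mapping.lookup (bvec R) (finsert p S))"
  proof (cases "p |\<in>| R")
    case True
    have "R |-| {|p|} = S \<longleftrightarrow> p |\<notin>| S \<and> R = finsert p S" using True by auto
    moreover have "koszul_sign p (finsert p S) = koszul_sign p S" if "p |\<notin>| S"
      using koszul_sign_finsert[OF that, of p] by simp
    ultimately show ?thesis
      using True by (auto simp: Phi_annih lookup_single when_def)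
  next
    case False
    then show ?thesis by (auto simp: Phi_annih lookup_single when_def)
  qed
  with add show ?case by (simp add: Phi_add Phi_smul lookup_add algebra_simps)
qed simp

text \<open>At \<open>\<lambda> = 1/2\<close> the mode \<open>\<Phi>(0)\<close> does not occur in \<open>G\<close>, so \<open>Phi_irreducible\<close> cannot be
  applied.\<close>

lemma Phi_nonzero_modes_irreducible:
  assumes U: "module.subspace smul U" "\<And>n u. n \<noteq> 0 \<Longrightarrow> u \<in> U \<Longrightarrow> Phi i n u \<in> U"
    and u: "u \<in> U" "u \<noteq> 0"
  shows "U = UNIV"
proof -
  interpret vector_space smul by (rule vector_space_smul)
  have scaled: "bvec S \<in> U" if "smul c (bvec S) \<in> U" "c \<noteq> 0" for S :: "nat fset" and c
    using subspace_scale[OF U(1) that(1), of "1 / c"] that(2) by simp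
  \<comment> \<open>\<open>w\<close> arises from \<open>u\<close> by annihilating all elements of
    \<open>S\<close>. The nonzero factor may depend on \<open>R\<close>, which absorbs the Koszul
    signs.\<close>
  define contracted where "contracted S w \<longleftrightarrow> (\<forall>R. \<exists>c. c \<noteq> 0 \<and> Poly_Mapping.lookup w R =
      (if R |\<inter>| S = {||} then c * Poly_Mapping.lookup u (R |\<union>| S) else 0))" for S w
  have contract: "\<exists>w\<in>U. contracted S w" for S
  proof (induction S)
    case empty
    show ?case by (rule bexI[OF _ u(1)]) (auto simp: contracted_def intro!: exI[of _ 1])
  next
    case (insert p S)
    then obtain w where w: "w \<in> U" and lw: "contracted S w" by blast
    show ?case
    proof (rule bexI, unfold contracted_def, rule allI)
      show "Phi i (int p + 1) w \<in> U" by (rule U(2)[OF _ w]) simp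
      fix R
      obtain c where c: "c \<noteq> 0" "Poly_Mapping.lookup w (finsert p R) =
          (if finsert p R |\<inter>| S = {||} then c * Poly_Mapping.lookup u (finsert p R |\<union>| S) else 0)"
        using lw[unfolded contracted_def, THEN spec, of "finsert p R"] by (elim exE conjE)
      have eq: "finsert p R |\<inter>| S = {||} \<longleftrightarrow> R |\<inter>| S = {||}" "finsert p R |\<union>| S = R |\<union>| finsert p S"
        using insert.hyps by auto
      have eq': "R |\<inter>| finsert p S = {||} \<longleftrightarrow> p |\<notin>| R \<and> R |\<inter>| S = {||}" by auto
      let ?k = "- ((-1) powi (int p + 1)) * koszul_sign p R"
      have "?k \<noteq> 0" by (simp add: koszul_sign_def)
      then show "\<exists>c. c \<noteq> 0 \<and> Poly_Mapping.lookup (Phi i (int p + 1) w) R =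
          (if R |\<inter>| finsert p S = {||} then c * Poly_Mapping.lookup u (R |\<union>| finsert p S) else 0)"
        using c insert.hyps by (intro exI[of _ "?k * c"]) (auto simp: lookup_Phi_annih eq eq')
    qed
  qed
  \<comment> \<open>A largest monomial of \<open>u\<close>: after its elements are annihilated, only
    a nonzero multiple of the vacuum is left.\<close>
  obtain S where S: "S \<in> Poly_Mapping.keys u" "\<And>R. R \<in> Poly_Mapping.keys u \<Longrightarrow> fcard R \<le> fcard S"
  proof -
    have "Max (fcard ` Poly_Mapping.keys u) \<in> fcard ` Poly_Mapping.keys u"
      using u(2) by (intro Max_in) auto
    then obtain S where "S \<in> Poly_Mapping.keys u" "fcard S = Max (fcard ` Poly_Mapping.keys u)" by auto
    then show thesis using that by (metis Max_ge finite_imageI finite_keys imageI)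
  qed
  obtain w where w: "w \<in> U" and "contracted S w"
    using contract by blast
  note lw = this(2)[unfolded contracted_def, THEN spec]
  have "Poly_Mapping.lookup w R = 0" if "R \<noteq> {||}" for R
  proof (cases "R |\<inter>| S = {||}")
    case True
    have "fcard (R |\<union>| S) = fcard R + fcard S"
      using fcard_funion_finter[of R S] True by simp
    moreover have "fcard R \<noteq> 0" using that by (simp add: fcard_0_eq)
    ultimately have "R |\<union>| S \<notin> Poly_Mapping.keys u" using S(2) by force
    then show ?thesis using lw[of R] by (auto simp: in_keys_iff)
  qed (use lw[of R] in auto)
  then have "w = smul (Poly_Mapping.lookup w {||}) (bvec {||})"
    by (intro poly_mapping_eqI) (auto simp: lookup_single when_def)
  moreover have "Poly_Mapping.lookup w {||} \<noteq> 0"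
    using lw[of "{||}"] S(1) by (auto simp: in_keys_iff)
  ultimately have "bvec {||} \<in> U" using scaled w by metis
  then have basis: "bvec S \<in> U" for S
  proof (induction S)
    case (insert p S)
    then have "smul (koszul_sign p S) (bvec (finsert p S)) \<in> U"
      using U(2)[of "- int p - 1" "bvec S"] by (simp add: Phi_creat)
    then show ?case by (rule scaled) (simp add: koszul_sign_def)
  qed
  have "v \<in> U" for v
    by (subst lin_bvec[symmetric], unfold lin_def, intro subspace_sum subspace_scale U basis)
  then show ?thesis by auto
qed

section \<open>From Heisenberg-stable subspaces to their vacuum components\<close>

definition vac_part :: "('a \<times> fock_basis \<Rightarrow>\<^sub>0 complex) \<Rightarrow> ('a \<Rightarrow>\<^sub>0 complex)" where
  "vac_part = lin (\<lambda>(a, e). if e = 0 then bvec a else 0)"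

lemma lookup_vac_part [simp]: "Poly_Mapping.lookup (vac_part u) a = Poly_Mapping.lookup u (a, 0)"
proof (induction u rule: basis_induct)
  case (add u x c)
  then show ?case
    by (cases x) (auto simp: vac_part_def lin_add lin_smul lookup_add lookup_single when_def)
qed (simp add: vac_part_def)

text \<open>The number operator multiplies the component of a monomial by its degree, so polynomials in it
  cut out the component of degree zero.\<close>

lemma tens_vac_part_in_subspace:
  assumes U: "module.subspace smul U" "\<And>l u. u \<in> U \<Longrightarrow> tbeta l u \<in> U" and "u \<in> U"
  shows "tens (vac_part u) (bvec 0) \<in> U"
proof -
  interpret vector_space smul by (rule vector_space_smul)
  have "\<exists>M. Poly_Mapping.keys e \<subseteq> {..<M}" for e :: fock_basis
    using finite_nat_iff_bounded[of "Poly_Mapping.keys e"] by auto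
  \<comment> \<open>Only finitely many variables occur in \<open>u\<close>; restricting the number
    operator to these makes it a finite sum, and \<open>deg\<close> is still the full degree on the
    monomials of \<open>u\<close>.\<close>
  then obtain B where B: "\<And>e::fock_basis. Poly_Mapping.keys e \<subseteq> {..<B e}" by metis
  define M where "M = (\<Sum>x\<in>Poly_Mapping.keys u. B (snd x))"
  have M: "Poly_Mapping.keys e \<subseteq> {..<M}" if "(a, e) \<in> Poly_Mapping.keys u" for a e
  proof -
    have "B e \<le> M"
      unfolding M_def using member_le_sum[OF that, of "\<lambda>x. B (snd x)"] by simp
    with B[of e] show ?thesis by auto
  qed
  define deg where "deg e = (\<Sum>m<M. Poly_Mapping.lookup e m)" for e :: fock_basis
  \<comment> \<open>The normalisation turns \<open>\<beta>(-k) \<beta>(k)\<close>, which is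
    \<open>-k\<close> times multiplication after differentiation, into the count of one
    variable.\<close>
  define num where "num v = (\<Sum>m<M. smul (- (1 / (of_nat m + 1 / 2))) (tbeta (- int m - 1) (tbeta (int m) v)))"
    for v :: "'a \<times> fock_basis \<Rightarrow>\<^sub>0 complex"
  have linop_num: "linop num"
    unfolding num_def[abs_def] by (intro linop_intros linop_scaled[OF linop_comp[OF linop_tbeta linop_tbeta]])
  have cancel: "- (1 / c) * (- c * x) = x" if "c \<noteq> 0" for c x :: complex
    using that by simp
  have num_bvec: "num (bvec (a, e)) = smul (of_nat (deg e)) (bvec (a, e))" for a e
  proof -
    have "smul (- (1 / (of_nat m + 1 / 2))) (tbeta (- int m - 1) (tbeta (int m) (bvec (a, e)))) =
        smul (of_nat (Poly_Mapping.lookup e m)) (bvec (a, e))" for m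
    proof (cases "Poly_Mapping.lookup e m = 0")
      case False
      then have "e - Poly_Mapping.single m 1 + Poly_Mapping.single m 1 = e"
        by (intro poly_mapping_eqI) (auto simp: lookup_add lookup_minus lookup_single when_def)
      moreover have "of_nat m + 1 / 2 \<noteq> (0 :: complex)" by (simp add: complex_eq_iff)
      then have "- (1 / (of_nat m + 1 / 2)) * (- (of_nat m + 1 / 2) * x) = x" for x :: complex
        by (rule cancel)
      ultimately show ?thesis
        by (simp only: tbeta_annih_bvec linop_smul[OF linop_tbeta] tbeta_creat_bvec smul_smul)
    qed (simp add: tbeta_annih_bvec linop_zero[OF linop_tbeta])
    then have "num (bvec (a, e)) = (\<Sum>m<M. smul (of_nat (Poly_Mapping.lookup e m)) (bvec (a, e)))"
      unfolding num_def by simp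
    also have "\<dots> = smul (of_nat (deg e)) (bvec (a, e))"
      by (rule poly_mapping_eqI) (simp add: deg_def lookup_sum' sum_distrib_right)
    finally show ?thesis .
  qed
  have lookup_num: "Poly_Mapping.lookup (num v) (a, e) = of_nat (deg e) * Poly_Mapping.lookup v (a, e)" for v a e
  proof (induction v rule: basis_induct)
    case (add w x c)
    then show ?case
      by (cases x) (auto simp: linop_add[OF linop_num] linop_smul[OF linop_num] num_bvec lookup_add
          lookup_single when_def algebra_simps)
  qed (simp add: linop_zero[OF linop_num])
  have num_U: "num v \<in> U" if "v \<in> U" for v
    unfolding num_def by (intro subspace_sum subspace_scale U that)
  have "tens (vac_part v) (bvec 0) \<in> U"
    if "v \<in> U" "Poly_Mapping.keys v \<subseteq> Poly_Mapping.keys u" "\<forall>(a, e)\<in>Poly_Mapping.keys v. deg e \<le> D" for v D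
    using that
  proof (induction D arbitrary: v)
    case 0
    have "v = tens (vac_part v) (bvec 0)"
    proof (rule tens_eqI)
      fix a e
      have "e = 0" if "(a, e) \<in> Poly_Mapping.keys v"
      proof (rule poly_mapping_eqI)
        fix m
        have "deg e = 0" "Poly_Mapping.keys e \<subseteq> {..<M}" using 0 that M by blast+
        then show "Poly_Mapping.lookup e m = Poly_Mapping.lookup 0 m"
          by (cases "m < M") (auto simp: deg_def in_keys_iff subset_iff)
      qed
      then show "Poly_Mapping.lookup v (a, e) = Poly_Mapping.lookup (tens (vac_part v) (bvec 0)) (a, e)"
        by (auto simp: lookup_single when_def in_keys_iff)
    qed
    with 0 show ?case by simp
  next
    case (Suc D)
    \<comment> \<open>This removes the components of degree \<open>Suc D\<close>, rescales those in
      between, and fixes the component of degree 0.\<close>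
    define w where "w = v - smul (1 / of_nat (Suc D)) (num v)"
    have lw: "Poly_Mapping.lookup w (a, e) = (1 - of_nat (deg e) / of_nat (Suc D)) * Poly_Mapping.lookup v (a, e)" for a e
      unfolding w_def lookup_minus lookup_smul lookup_num by (simp add: algebra_simps)
    have sub: "(a, e) \<in> Poly_Mapping.keys v \<and> deg e \<noteq> Suc D" if "(a, e) \<in> Poly_Mapping.keys w" for a e
    proof -
      have "(1 - of_nat (deg e) / of_nat (Suc D)) * Poly_Mapping.lookup v (a, e) \<noteq> 0"
        using that unfolding in_keys_iff lw .
      then show ?thesis unfolding in_keys_iff by (auto simp del: of_nat_Suc)
    qed
    have "tens (vac_part w) (bvec 0) \<in> U"
    proof (rule Suc.IH)
      show "w \<in> U" unfolding w_def by (intro subspace_diff subspace_scale num_U U Suc.prems)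
      show "Poly_Mapping.keys w \<subseteq> Poly_Mapping.keys u" using sub Suc.prems(2) by auto
      show "\<forall>(a, e)\<in>Poly_Mapping.keys w. deg e \<le> D"
      proof clarify
        fix a e
        assume "(a, e) \<in> Poly_Mapping.keys w"
        from sub[OF this] Suc.prems(3) show "deg e \<le> D" by auto
      qed
    qed
    moreover have "vac_part w = vac_part v"
      by (rule poly_mapping_eqI) (simp add: lw deg_def)
    ultimately show ?case by simp
  qed
  moreover have "\<forall>(a, e)\<in>Poly_Mapping.keys u. deg e \<le> (\<Sum>x\<in>Poly_Mapping.keys u. deg (snd x))"
    using member_le_sum[of _ "Poly_Mapping.keys u" "\<lambda>x. deg (snd x)"] by force
  ultimately show ?thesis using assms(3) by blast
qed

lemma FF_X_in_submodule:
  assumes "submodule smul (FF \<chi> i j) U" "u \<in> U"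
  shows "FF_X \<chi> i j n u \<in> U"
proof -
  interpret vector_space smul by (rule vector_space_smul)
  have U: "subspace U" "\<And>x u. u \<in> U \<Longrightarrow> FF \<chi> i j x u \<in> U"
    using assms(1) by (auto simp: submodule_def)
  have "X_plus (FF \<chi> i j) n u \<in> U"
    unfolding X_plus_def using U assms(2) by (simp add: subspace_scale)
  then show ?thesis by (simp add: X_plus_FF)
qed

lemma tbeta_in_submodule:
  assumes "submodule smul (FF \<chi> i j) U" "u \<in> U"
  shows "tbeta l u \<in> U"
proof -
  interpret vector_space smul by (rule vector_space_smul)
  have U: "subspace U" "\<And>x u. u \<in> U \<Longrightarrow> FF \<chi> i j x u \<in> U"
    using assms(1) by (auto simp: submodule_def)
  let ?n = "- 2 * l - 3"
  have "FF \<chi> i j (bvec (h_elt l)) u = smul (- 2) (tbeta l u) + smul (2 * fls_nth \<chi> ?n) u"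
    by (simp add: FF_bvec FF_h_eq)
  then have "tbeta l u = smul (- 1 / 2) (FF \<chi> i j (bvec (h_elt l)) u - smul (2 * fls_nth \<chi> ?n) u)"
    by simp
  also have "\<dots> \<in> U"
    by (intro subspace_scale subspace_diff U assms(2))
  finally show ?thesis .
qed

text \<open>The source of the condition on \<lambda>: with \<open>k = - n - 3\<close> the factor at
  \<open>\<Phi>(k/2)\<close> is \<open>\<lambda> - (k + 1)/2\<close>. It never vanishes if
  \<open>2\<lambda>\<close> is not an integer, and for \<open>\<lambda> = 1/2\<close> it vanishes
  only at \<open>k = 0\<close>.\<close>

lemma G_field_over_z:
  "G_field (over_z l) i n v = smul (of_int (n + 2) / 2 + l) (Phi i (- n - 3) v)"
proof -
  have idx: "- (n + 2) - 1 = - n - 3" by simp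
  have "Sum_any (\<lambda>p. smul (fls_nth (over_z l) p) (Phi_field i (n - p) v)) =
      (\<Sum>p\<in>{- 2}. smul (fls_nth (over_z l) p) (Phi_field i (n - p) v))"
    by (rule Sum_any_sum) (auto simp: fls_nth_over_z)
  also have "\<dots> = smul l (Phi i (- n - 3) v)"
    unfolding idx[symmetric] by (simp add: fls_nth_over_z Phi_field_def)
  finally show ?thesis
    unfolding G_field_eq smul_add_left Phi_field_def idx by simp
qed

lemma vac_part_X_field:
  "vac_part (X_field \<chi> i j n (tens u (bvec 0))) = smul (Y_const j) (G_field \<chi> i (n - 1) u)"
proof (rule poly_mapping_eqI)
  fix S
  have "Poly_Mapping.lookup (vac_part (X_field \<chi> i j n (tens u (bvec 0)))) S =
      Sum_any (\<lambda>p. Poly_Mapping.lookup (G_field \<chi> i p u) S * (if n - p = 1 then Y_const j else 0))"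
    unfolding lookup_vac_part X_field_tens lookup_Sum_any[OF X_field_tens_finite] lookup_tens
      lookup_Y_tw_vac ..
  also have "\<dots> = (\<Sum>p\<in>{n - 1}. Poly_Mapping.lookup (G_field \<chi> i p u) S * (if n - p = 1 then Y_const j else 0))"
    by (rule Sum_any_sum) auto
  finally show "Poly_Mapping.lookup (vac_part (X_field \<chi> i j n (tens u (bvec 0)))) S =
      Poly_Mapping.lookup (smul (Y_const j) (G_field \<chi> i (n - 1) u)) S"
    by simp
qed

theorem irreducible_FF_over_z:
  assumes l: "l \<in> {1 / 2} \<union> (- range (\<lambda>n::int. of_int n / 2))"
  shows "irreducible_module smul (FF (over_z l) i j)"
  unfolding irreducible_module_def
proof (intro conjI allI impI lie_module_FF)
  interpret vector_space smul by (rule vector_space_smul)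
  show "\<exists>v :: FF_space. v \<noteq> 0"
    by (rule exI[of _ "bvec ({||}, 0)"]) (metis lookup_single_eq lookup_zero zero_neq_one)
  fix U
  assume sub: "submodule smul (FF (over_z l) i j) U"
  then have U: "subspace U" by (simp add: submodule_def)
  note tb = tbeta_in_submodule[OF sub]
  show "U = {0} \<or> U = UNIV"
  proof (cases "U = {0}")
    case False
    then obtain u where u: "u \<in> U" "u \<noteq> 0" using subspace_0[OF U] by auto
    then obtain S e where "Poly_Mapping.lookup u (S, e) \<noteq> 0"
      by (metis poly_mapping_eqI lookup_zero surj_pair)
    \<comment> \<open>Annihilation operators strip the variables of one monomial of
      \<open>u\<close>; its coefficient is multiplied by nonzero numbers and ends up at the
      vacuum.\<close>
    with u(1) have "\<exists>w\<in>U. Poly_Mapping.lookup w (S, 0) \<noteq> 0"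
    proof (induction e arbitrary: u rule: fock_basis_induct)
      case (add e m)
      then show ?case
        using add.IH[OF tb[OF add.prems(1), of "int m"]] by (simp only: lookup_tbeta_annih_eq_0 simp_thms)
    qed auto
    then obtain w where w: "w \<in> U" "Poly_Mapping.lookup w (S, 0) \<noteq> 0" by blast
    define F where "F = {f. tens f (bvec 0) \<in> U}"
    have F_subspace: "subspace F"
      unfolding F_def subspace_def
      using subspace_0[OF U] subspace_add[OF U] subspace_scale[OF U] by (simp add: tens_bilinear)
    have "vac_part w \<noteq> 0" using w(2) by (metis lookup_vac_part lookup_zero)
    moreover have "vac_part w \<in> F"
      unfolding F_def using tens_vac_part_in_subspace[OF U tb w(1)] by simp
    moreover have "Phi i k f \<in> F" if k: "k \<noteq> 0" and f: "f \<in> F" for k f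
    proof -
      \<comment> \<open>The exponent is chosen so that, after the lowest exponent 1 of the vertex
        operator is removed, the coefficient of \<open>G\<close> is a multiple of
        \<open>Phi i k\<close>.\<close>
      let ?x = "FF_X (over_z l) i j (- k - 2) (tens f (bvec 0))"
      define c where "c = 1 / complex_of_real (sqrt 2) * Y_const j * (of_int (- k - 1) / 2 + l)"
      have "?x \<in> U" using FF_X_in_submodule[OF sub] f by (simp add: F_def)
      then have "vac_part ?x \<in> F"
        unfolding F_def using tens_vac_part_in_subspace[OF U tb] by simp
      moreover have "vac_part ?x = smul (1 / complex_of_real (sqrt 2)) (vac_part (X_field (over_z l) i j (- k - 2) (tens f (bvec 0))))"
        by (rule poly_mapping_eqI) (simp add: FF_X_eq)
      moreover have "\<dots> = smul c (Phi i k f)"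
        by (simp add: vac_part_X_field G_field_over_z mult.assoc c_def)
      ultimately have "smul c (Phi i k f) \<in> F"
        by simp
      then have "smul (1 / c) (smul c (Phi i k f)) \<in> F"
        by (rule subspace_scale[OF F_subspace])
      moreover have "of_int (- k - 1) / 2 + l \<noteq> 0"
      proof
        assume "of_int (- k - 1) / 2 + l = 0"
        then have l': "l = of_int (k + 1) / 2" by (simp add: field_simps)
        with l have "l = 1 / 2" by blast
        with l' have "of_int (k + 1) = (of_int 1 :: complex)" by simp
        then show False using k by (simp only: of_int_eq_iff)
      qed
      then have "c \<noteq> 0" by (simp add: c_def Y_const_def)
      ultimately show ?thesis by simp
    qed
    ultimately have "F = UNIV"
      using Phi_nonzero_modes_irreducible[OF F_subspace] by blast
    then have vac: "bvec (T, 0) \<in> U" for T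
      unfolding F_def by (metis UNIV_I mem_Collect_eq tens_bvec)
    have basis: "bvec (T, e) \<in> U" for T e
    proof (induction e rule: fock_basis_induct)
      case (add e m)
      then show ?case using tb[of "bvec (T, e)" "- int m - 1"] by (simp only: tbeta_creat_bvec)
    qed (rule vac)
    have "v \<in> U" for v
      by (subst lin_bvec[symmetric], unfold lin_def, intro subspace_sum subspace_scale U)
        (use basis in auto)
    then show ?thesis by auto
  qed simp
qed

section \<open>The highest weight vector and the grading\<close>

definition clifford_energy :: "clifford_basis \<Rightarrow> complex" where
  "clifford_energy S = (\<Sum>p\<in>fset S. (of_nat p + 1) / 2)"

definition fock_energy :: "fock_basis \<Rightarrow> complex" where
  "fock_energy e = Sum_any (\<lambda>m. of_nat (Poly_Mapping.lookup e m) * (of_nat m + 1 / 2))"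

text \<open>The sign is that of \<open>t d/dt\<close>, for which creation operators have negative
  degree.\<close>

definition energy_op :: "FF_space \<Rightarrow> FF_space" where
  "energy_op = lin (\<lambda>(S, e). smul (- (clifford_energy S + fock_energy e)) (bvec (S, e)))"

lemma fock_energy_add_single:
  "fock_energy (e + Poly_Mapping.single m 1) = fock_energy e + (of_nat m + 1 / 2)"
proof -
  let ?f = "\<lambda>n. of_nat (Poly_Mapping.lookup e n) * (of_nat n + 1 / 2) :: complex"
  let ?g = "\<lambda>n. if n = m then of_nat n + 1 / 2 else 0 :: complex"
  have "finite {n. ?f n \<noteq> 0}"
    by (rule finite_subset[of _ "Poly_Mapping.keys e"]) (auto simp: in_keys_iff)
  moreover have "finite {n. ?g n \<noteq> 0}"
    by (rule finite_subset[of _ "{m}"]) auto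
  moreover have "of_nat (Poly_Mapping.lookup (e + Poly_Mapping.single m 1) n) * (of_nat n + 1 / 2) = ?f n + ?g n" for n
    by (simp add: lookup_add lookup_single when_def algebra_simps)
  moreover have "Sum_any ?g = (\<Sum>n\<in>{m}. ?g n)"
    by (rule Sum_any_sum) auto
  ultimately show ?thesis
    unfolding fock_energy_def by (simp add: Sum_any.distrib)
qed

lemma linop_energy_op: "linop energy_op"
  by (simp add: energy_op_def linear_lin)

lemma energy_op_bvec:
  "energy_op (bvec (S, e)) = smul (- (clifford_energy S + fock_energy e)) (bvec (S, e))"
  by (simp add: energy_op_def)

lemma lookup_energy_op:
  "Poly_Mapping.lookup (energy_op v) (S, e) =
     - (clifford_energy S + fock_energy e) * Poly_Mapping.lookup v (S, e)"
proof (induction v rule: basis_induct)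
  case zero
  show ?case by (simp add: linop_zero[OF linop_energy_op])
next
  case (add u x c)
  obtain R f where x: "x = (R, f)" by force
  have "Poly_Mapping.lookup (energy_op (bvec x)) (S, e) =
     - (clifford_energy S + fock_energy e) * Poly_Mapping.lookup (bvec x) (S, e)"
    unfolding x energy_op_bvec by (auto simp: lookup_single when_def)
  with add show ?case
    by (simp only: linop_add[OF linop_energy_op] linop_smul[OF linop_energy_op] lookup_add
        lookup_smul distrib_left mult.left_commute[of c])
qed

lemma energy_op_tbeta:
  "energy_op (tbeta l v) - tbeta l (energy_op v) = smul (of_int l + 1 / 2) (tbeta l v)"
proof (rule tens_ext[where f = "\<lambda>v. energy_op (tbeta l v) - tbeta l (energy_op v)"], unfold tens_bvec)
  show "linop (\<lambda>v. energy_op (tbeta l v) - tbeta l (energy_op v))"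
    by (rule linop_minus_fun[OF linop_comp[OF linop_energy_op linop_tbeta]
          linop_comp[OF linop_tbeta linop_energy_op]])
  show "linop (\<lambda>v. smul (of_int l + 1 / 2) (tbeta l v))"
    by (rule linop_scaled[OF linop_tbeta])
next
  fix S e
  show "energy_op (tbeta l (bvec (S, e))) - tbeta l (energy_op (bvec (S, e))) =
      smul (of_int l + 1 / 2) (tbeta l (bvec (S, e)))"
  proof (cases "l < 0")
    case True
    define m where "m = nat (- l - 1)"
    have l: "l = - int m - 1" using True by (simp add: m_def)
    show ?thesis
      unfolding l tbeta_creat_bvec energy_op_bvec linop_smul[OF linop_tbeta] fock_energy_add_single
        smul_diff_left[symmetric]
      by (simp add: algebra_simps)
  next
    case False
    then obtain m where l: "l = int m" by (metis int_eq_iff linorder_not_less)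
    show ?thesis
    proof (cases "Poly_Mapping.lookup e m = 0")
      case True
      then show ?thesis
        by (simp add: l tbeta_annih_bvec energy_op_bvec linop_smul[OF linop_tbeta] linop_zero[OF linop_energy_op])
    next
      case nz: False
      let ?e = "e - Poly_Mapping.single m 1"
      have "e = ?e + Poly_Mapping.single m 1"
        using nz by (intro poly_mapping_eqI) (auto simp: lookup_add lookup_minus lookup_single when_def)
      then have e: "fock_energy e = fock_energy ?e + (of_nat m + 1 / 2)"
        using fock_energy_add_single[of ?e m] by metis
      show ?thesis
        unfolding l tbeta_annih_bvec energy_op_bvec linop_smul[OF linop_tbeta]
          linop_smul[OF linop_energy_op] smul_smul smul_diff_left[symmetric] e
        by (rule arg_cong2[where f = smul]) (simp_all add: algebra_simps)
    qed
  qed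
qed

lemma clifford_energy_finsert:
  "p |\<notin>| S \<Longrightarrow> clifford_energy (finsert p S) = clifford_energy S + (of_nat p + 1) / 2"
  by (simp add: clifford_energy_def)

lemma clifford_energy_Phi:
  assumes "Poly_Mapping.lookup (Phi i k (bvec S)) T \<noteq> 0"
  shows "clifford_energy T = clifford_energy S - of_int k / 2"
proof -
  consider "k = 0" | p where "k = - int p - 1" | p where "k = int p + 1"
  proof -
    have "k < 0 \<Longrightarrow> k = - int (nat (- k - 1)) - 1" "k > 0 \<Longrightarrow> k = int (nat (k - 1)) + 1" by simp_all
    then show thesis using that by (metis linorder_neqE_linordered_idom)
  qed
  then show ?thesis
  proof cases
    case 1
    then show ?thesis using assms by (auto simp: Phi_zero lookup_single when_def split: if_splits)
  next
    case 2
    then have "p |\<notin>| S" "T = finsert p S"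
      using assms by (auto simp: Phi_creat lookup_single when_def split: if_splits)
    then show ?thesis unfolding 2 by (simp add: clifford_energy_finsert field_simps)
  next
    case 3
    then have T: "p |\<in>| S" "T = S |-| {|p|}"
      using assms by (auto simp: Phi_annih lookup_single when_def split: if_splits)
    then have "S = finsert p T" "p |\<notin>| T" by auto
    then have "clifford_energy S = clifford_energy T + (of_nat p + 1) / 2"
      using clifford_energy_finsert by metis
    then show ?thesis using 3 by simp
  qed
qed

text \<open>Since \<open>\<lambda>/z\<close> scales like the derivative, the modes of
  \<open>G\<close> are homogeneous, which settles the vacuum coefficients; homogeneity of
  \<open>tbeta\<close> makes the defect a covariant family.\<close>

lemma energy_op_FF_X:
  "energy_op (FF_X (over_z l) i j n v) - FF_X (over_z l) i j n (energy_op v) =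
     smul (- of_int (n + 2) / 2) (FF_X (over_z l) i j n v)"
proof -
  let ?X = "FF_X (over_z l) i j"
  define Z where "Z n v = energy_op (?X n v) - ?X n (energy_op v) - smul (- of_int (n + 2) / 2) (?X n v)"
    for n v
  have "Z n v = 0"
  proof (rule covariant_family_zero[of Z])
    fix n
    show "linop (Z n)"
      unfolding Z_def[abs_def]
      by (intro linop_minus_fun linop_comp[OF linop_energy_op] linop_comp[OF linop_FF_X]
          linop_energy_op linop_FF_X linop_scaled)
  next
    fix n m
    have "tbeta m (Z n v) - Z n (tbeta m v) = smul (- 1) (Z (n - (2 * m + 1)) v) + smul 0 (Z n v)" for v
    proof -
      have d: "tbeta m (energy_op w) = energy_op (tbeta m w) - smul (of_int m + 1 / 2) (tbeta m w)" for w
        using energy_op_tbeta[of m w] by (simp add: algebra_simps)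
      have sc: "- of_int (n - (2 * m + 1) + 2) / 2 = - of_int (n + 2) / 2 + (of_int m + 1 / 2 :: complex)"
        by (simp add: field_simps)
      show ?thesis
        unfolding Z_def sc
        by (simp only: linop_diff[OF linop_tbeta] linop_smul[OF linop_tbeta] d FF_X_commutator
            linop_diff[OF linop_energy_op] linop_diff[OF linop_FF_X] linop_smul[OF linop_FF_X]
            linop_add[OF linop_FF_X] smul_diff_right smul_add_left smul_minus_left smul_one smul_zero)
          (simp add: algebra_simps)
    qed
    then show "\<exists>c y c' y'. \<forall>v. tbeta m (Z n v) - Z n (tbeta m v) = smul c (Z y v) + smul c' (Z y' v)"
      by blast
  next
    fix n S T
    have X: "Poly_Mapping.lookup (?X n (bvec (S, 0))) (T, 0) =
        1 / complex_of_real (sqrt 2) * (Y_const j * ((of_int (n - 1 + 2) / 2 + l) * Poly_Mapping.lookup (Phi i (- (n - 1) - 3) (bvec S)) T))"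
      using arg_cong[OF vac_part_X_field[of "over_z l" i j n "bvec S"], of "\<lambda>w. Poly_Mapping.lookup w T"]
      unfolding FF_X_eq G_field_over_z tens_bvec lookup_vac_part lookup_smul by (rule arg_cong)
    have scalar: "- (t + f) * x - - (s + f) * x - - c / 2 * x = (- t + s + c / 2) * x"
      for t s f c x :: complex
      by (simp add: field_simps)
    have "(- clifford_energy T + clifford_energy S + of_int (n + 2) / 2) *
        Poly_Mapping.lookup (?X n (bvec (S, 0))) (T, 0) = 0"
    proof (cases "Poly_Mapping.lookup (Phi i (- (n - 1) - 3) (bvec S)) T = 0")
      case False
      from clifford_energy_Phi[OF this] show ?thesis by (simp add: field_simps)
    qed (simp only: X mult_zero_right)
    moreover have "Poly_Mapping.lookup (Z n (bvec (S, 0))) (T, 0) =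
        (- clifford_energy T + clifford_energy S + of_int (n + 2) / 2) *
        Poly_Mapping.lookup (?X n (bvec (S, 0))) (T, 0)"
      unfolding Z_def lookup_minus lookup_energy_op energy_op_bvec linop_smul[OF linop_FF_X] lookup_smul
      by (rule scalar)
    ultimately show "Poly_Mapping.lookup (Z n (bvec (S, 0))) (T, 0) = 0" by simp
  qed
  then show ?thesis by (simp add: Z_def)
qed

section \<open>The vacuum as a graded highest weight vector\<close>

definition FF_vac :: FF_space where
  "FF_vac = bvec ({||}, 0)"

lemma FF_h_over_z: "FF_h (over_z l) (- 2 * m - 3) v = smul (- 2) (tbeta m v)"
proof -
  have "- 2 * m - 3 \<noteq> - 2" by presburger
  then show ?thesis by (simp add: FF_h_eq fls_nth_over_z)
qed

lemma degree_operator_FF: "degree_operator smul (FF (over_z l) i j) FF_vac energy_op"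
  unfolding degree_operator_def
proof (intro conjI allI linop_energy_op)
  show "energy_op FF_vac = 0"
    by (simp add: FF_vac_def energy_op_bvec clifford_energy_def fock_energy_def)
next
  fix u
  show "energy_op (FF (over_z l) i j (bvec K_elt) u) = FF (over_z l) i j (bvec K_elt) (energy_op u)"
    by (simp add: FF_bvec linop_smul[OF linop_energy_op])
next
  fix r u
  have sc: "- of_int (- 2 * r - 2 + 2) / 2 = (of_int r :: complex)" by simp
  show "energy_op (FF (over_z l) i j (bvec (xp_elt r)) u) - FF (over_z l) i j (bvec (xp_elt r)) (energy_op u) =
      smul (of_int r) (FF (over_z l) i j (bvec (xp_elt r)) u)"
    unfolding FF_bvec FF_basis_act.simps linop_smul[OF linop_energy_op] smul_diff_right[symmetric]
      energy_op_FF_X sc by (simp add: mult.commute)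
next
  fix m u
  have sc: "- of_int (- 2 * m - 3 + 2) / 2 = (of_int m + 1 / 2 :: complex)" by (simp add: field_simps)
  show "energy_op (FF (over_z l) i j (bvec (xm_elt m)) u) - FF (over_z l) i j (bvec (xm_elt m)) (energy_op u) =
      smul (of_int m + 1 / 2) (FF (over_z l) i j (bvec (xm_elt m)) u)"
    unfolding FF_bvec FF_basis_act.simps linop_smul[OF linop_energy_op] smul_diff_right[symmetric]
      energy_op_FF_X sc by (simp add: mult.commute)
next
  fix m u
  show "energy_op (FF (over_z l) i j (bvec (h_elt m)) u) - FF (over_z l) i j (bvec (h_elt m)) (energy_op u) =
      smul (of_int m + 1 / 2) (FF (over_z l) i j (bvec (h_elt m)) u)"
    unfolding FF_bvec FF_basis_act.simps FF_h_over_z linop_smul[OF linop_energy_op]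
      smul_diff_right[symmetric] energy_op_tbeta by (simp add: mult.commute)
qed

text \<open>On the vacuum \<open>G\<close> starts at doubled exponent -3, with the mode \<Phi>(0),
  and the vertex operator at 1.\<close>

lemma X_field_vac_eq_zero:
  assumes "n < - 2"
  shows "X_field (over_z l) i j n FF_vac = 0"
proof -
  have "tens (G_field (over_z l) i p FT_vac) (Y_tw j (n - p) (bvec 0)) = 0" for p
  proof (cases "p < - 3")
    case True
    then show ?thesis by (simp add: G_field_over_z Phi_vac tens_bilinear)
  next
    case False
    then show ?thesis using assms by (simp add: Y_tw_vac_eq_zero tens_bilinear)
  qed
  then show ?thesis
    using X_field_tens[of "over_z l" i j n FT_vac "bvec 0"]
    by (simp add: FF_vac_def FT_vac_def)
qed

lemma X_field_vac:
  "X_field (over_z l) i j (- 2) FF_vac =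
     smul ((l - 1 / 2) * ((- 1) ^ i * (1 / (complex_of_real (sqrt 2) * \<i>))) * Y_const j) FF_vac"
proof -
  have "Sum_any (\<lambda>p. tens (G_field (over_z l) i p FT_vac) (Y_tw j (- 2 - p) (bvec 0))) =
      (\<Sum>p\<in>{- 3}. tens (G_field (over_z l) i p FT_vac) (Y_tw j (- 2 - p) (bvec 0)))"
  proof (rule Sum_any_sum)
    fix p :: int
    assume "p \<notin> {- 3}"
    then consider "p < - 3" | "- 2 - p < 1" by fastforce
    then show "tens (G_field (over_z l) i p FT_vac) (Y_tw j (- 2 - p) (bvec 0)) = 0"
      by cases (simp_all add: G_field_over_z Phi_vac Y_tw_vac_eq_zero tens_bilinear)
  qed simp
  also have "\<dots> = smul ((l - 1 / 2) * ((- 1) ^ i * (1 / (complex_of_real (sqrt 2) * \<i>))) * Y_const j)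
      (tens FT_vac (bvec 0))"
    by (simp add: G_field_over_z Phi_vac Y_tw_vac_1 tens_bilinear mult_ac)
  finally show ?thesis
    using X_field_tens[of "over_z l" i j "- 2" FT_vac "bvec 0"]
    by (simp add: FF_vac_def FT_vac_def)
qed

text \<open>At the lowest exponent only \<Phi>(0) and the leading term of the vertex operator
  contribute. The weight collects the factor \<open>\<lambda> - 1/2\<close>, the eigenvalue of
  \<Phi>(0), \<open>Y_const j\<close> and \<open>2 / sqrt 2\<close>; the signs of \<open>i\<close>
  and \<open>j\<close> enter only through their product.\<close>

lemma highest_weight_vector_FF:
  "highest_weight_vector smul (FF (over_z l) i j) ((1 - 2 * l) * (- 1) ^ (i + j)) FF_vac"
  unfolding highest_weight_vector_def
proof (intro conjI allI impI)
  show "FF_vac \<noteq> 0"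
    unfolding FF_vac_def by (metis lookup_single_eq lookup_zero zero_neq_one)
next
  fix m :: int
  assume m: "0 \<le> m"
  show "FF (over_z l) i j (bvec (xm_elt m)) FF_vac = 0"
    using m by (simp add: FF_bvec FF_X_eq X_field_vac_eq_zero)
  show "FF (over_z l) i j (bvec (h_elt m)) FF_vac = 0"
    unfolding FF_bvec FF_basis_act.simps FF_h_over_z using m by (simp add: FF_vac_def tbeta_annih_vac)
next
  fix n :: int
  assume "0 < n"
  then show "FF (over_z l) i j (bvec (xp_elt n)) FF_vac = 0"
    by (simp add: FF_bvec FF_X_eq X_field_vac_eq_zero)
next
  have "complex_of_real (sqrt 2) * complex_of_real (sqrt 2) = 2"
    by (simp flip: of_real_mult)
  then have "2 * (1 / complex_of_real (sqrt 2)) *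
      ((l - 1 / 2) * ((- 1) ^ i * (1 / (complex_of_real (sqrt 2) * \<i>))) * Y_const j) =
      (1 - 2 * l) * (- 1) ^ (i + j)"
    by (simp add: Y_const_def power_add field_simps)
  then show "FF (over_z l) i j (bvec (xp_elt 0)) FF_vac = smul ((1 - 2 * l) * (- 1) ^ (i + j)) FF_vac"
    by (simp add: FF_bvec FF_X_eq X_field_vac)
qed

lemma irreducible_module_generated_by:
  assumes "irreducible_module scl \<rho>" "v \<noteq> 0"
  shows "generated_by scl \<rho> v"
  using assms unfolding irreducible_module_def generated_by_def by blast

lemma is_L_FF_over_z:
  assumes "l \<in> {1 / 2} \<union> (- range (\<lambda>n::int. of_int n / 2))"
  shows "is_L smul (FF (over_z l) i j) (- 1 - (1 - 2 * l) * (- 1) ^ (i + j)) (- 1 + (1 - 2 * l) * (- 1) ^ (i + j))"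
  unfolding is_L_def
proof (intro exI conjI)
  let ?a = "(1 - 2 * l) * (- 1) ^ (i + j)"
  show "- 1 - ?a = - 2 / 2 - ?a" "- 1 + ?a = - 2 / 2 + ?a" by simp_all
  show irr: "irreducible_module smul (FF (over_z l) i j)"
    by (rule irreducible_FF_over_z[OF assms])
  show "has_level smul (FF (over_z l) i j) (- 2)"
    using twisted_module_FF by (simp add: twisted_module_def)
  show hw: "highest_weight_vector smul (FF (over_z l) i j) ?a FF_vac"
    by (rule highest_weight_vector_FF)
  show "generated_by smul (FF (over_z l) i j) FF_vac"
    by (rule irreducible_module_generated_by[OF irr]) (use hw in \<open>simp add: highest_weight_vector_def\<close>)
  show "degree_operator smul (FF (over_z l) i j) FF_vac energy_op"
    by (rule degree_operator_FF)
qed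

section \<open>Uniqueness of graded irreducible highest weight modules\<close>

fun double_degree :: "sl2_basis \<Rightarrow> int" where
  "double_degree K_elt = 0"
| "double_degree (h_elt l) = 2 * l + 1"
| "double_degree (xm_elt l) = 2 * l + 1"
| "double_degree (xp_elt r) = 2 * r"

locale graded_hw_module =
  fixes scl :: "complex \<Rightarrow> 'v::ab_group_add \<Rightarrow> 'v" and \<rho> :: "'v action"
    and k a :: complex and v :: 'v and d :: "'v \<Rightarrow> 'v"
  assumes irred: "irreducible_module scl \<rho>"
    and level: "has_level scl \<rho> k"
    and hw: "highest_weight_vector scl \<rho> a v"
    and degree: "degree_operator scl \<rho> v d"
begin

lemma lie_module: "lie_module scl \<rho>"
  using irred by (simp add: irreducible_module_def)

sublocale vector_space scl
  using lie_module by (simp add: lie_module_def)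

lemma act_linear: "Vector_Spaces.linear scl scl (\<rho> x)"
  and act_linear_left: "Vector_Spaces.linear smul scl (\<lambda>x. \<rho> x u)"
  using lie_module by (simp_all add: lie_module_def)

lemma act_add: "\<rho> x (u + w) = \<rho> x u + \<rho> x w"
  and act_scale: "\<rho> x (scl c u) = scl c (\<rho> x u)"
  using act_linear by (simp_all add: Vector_Spaces.linear_iff)

lemma act_add_left: "\<rho> (x + y) u = \<rho> x u + \<rho> y u"
  and act_scale_left: "\<rho> (smul c x) u = scl c (\<rho> x u)"
  using act_linear_left by (simp_all add: Vector_Spaces.linear_iff)

lemma act_zero: "\<rho> x 0 = 0"
  using act_scale[of x 0 0] by simp

lemma act_zero_left: "\<rho> 0 u = 0"
  using act_scale_left[of 0 0 u] by simp

lemma act_commute: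
  "\<rho> (bvec b) (\<rho> (bvec b') u) = \<rho> (bvec b') (\<rho> (bvec b) u) + \<rho> (basis_bracket b b') u"
proof -
  have "\<rho> (bracket (bvec b) (bvec b')) u = \<rho> (bvec b) (\<rho> (bvec b') u) - \<rho> (bvec b') (\<rho> (bvec b) u)"
    using lie_module unfolding lie_module_def by blast
  then show ?thesis by (simp add: diff_eq_eq add.commute)
qed

lemma v_nonzero: "v \<noteq> 0"
  using hw by (simp add: highest_weight_vector_def)

lemma act_hw:
  assumes "double_degree b \<ge> 0"
  shows "\<rho> (bvec b) v = scl (case b of K_elt \<Rightarrow> k | xp_elt r \<Rightarrow> if r = 0 then a else 0 | _ \<Rightarrow> 0) v"
  using hw level assms
  by (cases b) (auto simp: highest_weight_vector_def has_level_def)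

lemma d_linear: "d (u + w) = d u + d w" "d (scl c u) = scl c (d u)"
  using degree by (simp_all add: degree_operator_def Vector_Spaces.linear_iff)

lemma d_v: "d v = 0"
  using degree by (simp add: degree_operator_def)

lemma d_act: "d (\<rho> (bvec b) u) = \<rho> (bvec b) (d u) + scl (of_int (double_degree b) / 2) (\<rho> (bvec b) u)"
proof -
  have move: "x = y + z" if "x - y = z" for x y z :: 'v
    using that by (simp add: diff_eq_eq add.commute)
  have half: "of_int (2 * m + 1) / 2 = (of_int m + 1 / 2 :: complex)" for m
    by (simp add: add_divide_distrib)
  show ?thesis
  proof (cases b)
    case K_elt
    then show ?thesis using degree by (simp add: degree_operator_def)
  next
    case (h_elt l)
    have "d (\<rho> (bvec (h_elt l)) u) - \<rho> (bvec (h_elt l)) (d u) = scl (of_int l + 1 / 2) (\<rho> (bvec (h_elt l)) u)"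
      using degree by (simp only: degree_operator_def)
    then show ?thesis unfolding h_elt double_degree.simps half by (rule move)
  next
    case (xm_elt l)
    have "d (\<rho> (bvec (xm_elt l)) u) - \<rho> (bvec (xm_elt l)) (d u) = scl (of_int l + 1 / 2) (\<rho> (bvec (xm_elt l)) u)"
      using degree by (simp only: degree_operator_def)
    then show ?thesis unfolding xm_elt double_degree.simps half by (rule move)
  next
    case (xp_elt r)
    have "d (\<rho> (bvec (xp_elt r)) u) - \<rho> (bvec (xp_elt r)) (d u) = scl (of_int r) (\<rho> (bvec (xp_elt r)) u)"
      using degree by (simp only: degree_operator_def)
    moreover have "of_int (double_degree (xp_elt r)) / 2 = (of_int r :: complex)" by simp
    ultimately show ?thesis unfolding xp_elt by (simp only: move)
  qed
qed

lemma submodule_trivial: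
  assumes "\<And>u w. u \<in> U \<Longrightarrow> w \<in> U \<Longrightarrow> u + w \<in> U" "\<And>c u. u \<in> U \<Longrightarrow> scl c u \<in> U" "0 \<in> U"
    "\<And>x u. u \<in> U \<Longrightarrow> \<rho> x u \<in> U"
  shows "U = {0} \<or> U = UNIV"
proof -
  have "submodule scl \<rho> U"
    unfolding submodule_def subspace_def using assms by blast
  then show ?thesis using irred by (simp add: irreducible_module_def)
qed

text \<open>The operator \<open>degree_filter n\<close> kills the components of degree \<open>-1/2, \<dots>, -n/2\<close> and is
  injective on the component of degree \<open>0\<close>.\<close>

primrec degree_filter :: "nat \<Rightarrow> 'v \<Rightarrow> 'v" where
  "degree_filter 0 u = u"
| "degree_filter (Suc n) u = d (degree_filter n u) + scl (of_nat (Suc n) / 2) (degree_filter n u)"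

lemma degree_filter_linear:
  "degree_filter n (u + w) = degree_filter n u + degree_filter n w"
  "degree_filter n (scl c u) = scl c (degree_filter n u)"
  by (induction n) (simp_all add: d_linear scale_right_distrib mult.commute add_ac del: of_nat_Suc)

lemma degree_filter_eigenvector:
  assumes "d u = scl (- of_nat r / 2) u"
  shows "degree_filter n u = scl (\<Prod>m<n. of_nat (Suc m) / 2 - of_nat r / 2) u"
proof (induction n)
  case (Suc n)
  let ?p = "\<Prod>m<n. of_nat (Suc m) / 2 - of_nat r / 2 :: complex"
  have "degree_filter (Suc n) u = scl (?p * (- of_nat r / 2) + of_nat (Suc n) / 2 * ?p) u"
    by (simp only: degree_filter.simps Suc d_linear assms scale_scale scale_left_distrib)
  also have "?p * (- of_nat r / 2) + of_nat (Suc n) / 2 * ?p =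
      (\<Prod>m<Suc n. of_nat (Suc m) / 2 - of_nat r / 2)"
    by (simp add: field_simps del: of_nat_Suc)
  finally show ?case .
qed simp

end

section \<open>The graph of the isomorphism between two realisations\<close>

locale graded_hw_module_pair =
  V: graded_hw_module scl \<rho> k a v d + W: graded_hw_module scl' \<rho>' k a v' d'
  for scl :: "complex \<Rightarrow> 'v::ab_group_add \<Rightarrow> 'v" and \<rho> k a v d
    and scl' :: "complex \<Rightarrow> 'w::ab_group_add \<Rightarrow> 'w" and \<rho>' v' d'
begin

text \<open>The submodule generated by \<open>(v, v')\<close> in the direct sum is the span of the vectors obtained
  from \<open>(v, v')\<close> by the elements of negative degree; it turns out to be the graph of an
  isomorphism.\<close>

inductive monomial :: "nat \<Rightarrow> 'v \<Rightarrow> 'w \<Rightarrow> bool" where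
  vac: "monomial 0 v v'"
| act: "monomial r u u' \<Longrightarrow> double_degree b = - int (Suc s) \<Longrightarrow>
    monomial (r + Suc s) (\<rho> (bvec b) u) (\<rho>' (bvec b) u')"

text \<open>The span of the monomials, encoded as a relation so that the direct sum need not be
  formed as a module.\<close>

inductive R :: "'v \<Rightarrow> 'w \<Rightarrow> bool" where
  monomial: "monomial r u u' \<Longrightarrow> R u u'"
| add: "R u u' \<Longrightarrow> R w w' \<Longrightarrow> R (u + w) (u' + w')"
| scale: "R u u' \<Longrightarrow> R (scl c u) (scl' c u')"

lemma R_hw: "R v v'"
  by (rule R.monomial[OF monomial.vac])

lemma R_zero: "R 0 0"
  using R.scale[OF R_hw, of 0] by simp

lemma R_act_negative: "R u u' \<Longrightarrow> double_degree b < 0 \<Longrightarrow> R (\<rho> (bvec b) u) (\<rho>' (bvec b) u')"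
proof (induction rule: R.induct)
  case (monomial r u u')
  then have "double_degree b = - int (Suc (nat (- double_degree b - 1)))" by simp
  then show ?case by (rule R.monomial[OF monomial.act[OF monomial(1)]])
qed (simp_all only: V.act_add W.act_add V.act_scale W.act_scale R.add R.scale)

lemma R_act_extend:
  assumes "\<And>b. R (\<rho> (bvec b) u) (\<rho>' (bvec b) u')"
  shows "R (\<rho> x u) (\<rho>' x u')"
proof (induction x rule: basis_induct)
  case zero
  then show ?case by (simp add: V.act_zero_left W.act_zero_left R_zero)
next
  case (add y b c)
  then show ?case
    unfolding V.act_add_left W.act_add_left V.act_scale_left W.act_scale_left
    by (intro R.add R.scale assms)
qed

text \<open>\<open>b\<close> is commuted past the outermost factor \<open>b'\<close>. Both
  \<open>b\<close> and the bracket then act on the shorter monomial, and \<open>b'\<close>, of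
  negative degree, preserves \<open>R\<close>.\<close>

lemma R_act_monomial: "monomial r u u' \<Longrightarrow> R (\<rho> (bvec b) u) (\<rho>' (bvec b) u')"
proof (induction arbitrary: b rule: monomial.induct)
  case vac
  show ?case
  proof (cases "double_degree b \<ge> 0")
    case True
    show ?thesis unfolding V.act_hw[OF True] W.act_hw[OF True] by (rule R.scale[OF R_hw])
  qed (simp add: R_act_negative R_hw)
next
  case (act r u u' b' s)
  have "double_degree b' < 0" using act(2) by simp
  then show ?case
    unfolding V.act_commute[of b b'] W.act_commute[of b b']
    by (rule R.add[OF R_act_negative[OF act.IH] R_act_extend[OF act.IH]])
qed

lemma R_act: "R u u' \<Longrightarrow> R (\<rho> x u) (\<rho>' x u')"
proof (induction arbitrary: x rule: R.induct)
  case (monomial r u u')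
  show ?case by (rule R_act_extend[OF R_act_monomial[OF monomial]])
qed (simp_all only: V.act_add W.act_add V.act_scale W.act_scale R.add R.scale)

lemma monomial_degree:
  "monomial r u u' \<Longrightarrow> d u = scl (- of_nat r / 2) u \<and> d' u' = scl' (- of_nat r / 2) u'"
proof (induction rule: monomial.induct)
  case (act r u u' b s)
  have sc: "- of_nat r / 2 + of_int (double_degree b) / 2 = (- of_nat (r + Suc s) / 2 :: complex)"
    unfolding act(2) by (simp add: field_simps)
  show ?case
    using act.IH unfolding V.d_act W.d_act sc[symmetric]
    by (simp only: V.act_scale W.act_scale V.scale_left_distrib W.scale_left_distrib simp_thms)
qed (simp add: V.d_v W.d_v)

lemma monomial_zero: "monomial 0 u u' \<Longrightarrow> u = v \<and> u' = v'"
  by (auto elim: monomial.cases)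

text \<open>The point is the common scalar \<open>c\<close>: the degree zero part of
  \<open>R\<close> is the line through \<open>(v, v')\<close>. Quantifying over all large
  \<open>n\<close> lets sums share a filter.\<close>

lemma R_degree_filter:
  "R u u' \<Longrightarrow> \<exists>N. \<forall>n\<ge>N. \<exists>c. V.degree_filter n u = scl c v \<and> W.degree_filter n u' = scl' c v'"
proof (induction rule: R.induct)
  case (monomial r u u')
  let ?c = "\<lambda>n. \<Prod>m<n. of_nat (Suc m) / 2 - of_nat r / 2 :: complex"
  have eq: "V.degree_filter n u = scl (?c n) u" "W.degree_filter n u' = scl' (?c n) u'" for n
    using monomial_degree[OF monomial]
    by (simp_all only: V.degree_filter_eigenvector W.degree_filter_eigenvector)
  show ?case
  proof (cases r)
    case 0
    with monomial have "u = v" "u' = v'" using monomial_zero by auto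
    then show ?thesis using eq by auto
  next
    case (Suc s)
    \<comment> \<open>The factor at \<open>m = r - 1\<close> is zero.\<close>
    have "?c n = 0" if "n \<ge> r" for n
      by (rule prod_zero) (use that Suc in \<open>auto intro!: bexI[of _ s]\<close>)
    then have "\<forall>n\<ge>r. V.degree_filter n u = scl 0 v \<and> W.degree_filter n u' = scl' 0 v'"
      by (simp add: eq)
    then show ?thesis by blast
  qed
next
  case (add u u' w w')
  then obtain N M where
    N: "\<forall>n\<ge>N. \<exists>c. V.degree_filter n u = scl c v \<and> W.degree_filter n u' = scl' c v'" and
    M: "\<forall>n\<ge>M. \<exists>c. V.degree_filter n w = scl c v \<and> W.degree_filter n w' = scl' c v'" by (elim exE)
  show ?case
  proof (rule exI[of _ "max N M"], intro allI impI)
    fix n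
    assume "max N M \<le> n"
    then obtain c e where "V.degree_filter n u = scl c v \<and> W.degree_filter n u' = scl' c v'"
      "V.degree_filter n w = scl e v \<and> W.degree_filter n w' = scl' e v'"
      using N M by (metis max.bounded_iff)
    then show "\<exists>c. V.degree_filter n (u + w) = scl c v \<and> W.degree_filter n (u' + w') = scl' c v'"
      by (intro exI[of _ "c + e"])
        (simp add: V.degree_filter_linear W.degree_filter_linear V.scale_left_distrib W.scale_left_distrib)
  qed
next
  case (scale u u' c)
  then obtain N where
    N: "\<forall>n\<ge>N. \<exists>c. V.degree_filter n u = scl c v \<and> W.degree_filter n u' = scl' c v'" by (elim exE)
  show ?case
  proof (rule exI[of _ N], intro allI impI)
    fix n
    assume "N \<le> n"
    then obtain e where "V.degree_filter n u = scl e v \<and> W.degree_filter n u' = scl' e v'"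
      using N by blast
    then show "\<exists>e. V.degree_filter n (scl c u) = scl e v \<and> W.degree_filter n (scl' c u') = scl' e v'"
      by (intro exI[of _ "c * e"]) (simp add: V.degree_filter_linear W.degree_filter_linear)
  qed
qed

lemma hw_degree_filter:
  "\<exists>c. c \<noteq> 0 \<and> V.degree_filter n v = scl c v \<and> W.degree_filter n v' = scl' c v'"
proof -
  let ?c = "\<Prod>m<n. of_nat (Suc m) / 2 - of_nat 0 / 2 :: complex"
  have "V.degree_filter n v = scl ?c v" "W.degree_filter n v' = scl' ?c v'"
    by (rule V.degree_filter_eigenvector W.degree_filter_eigenvector, simp add: V.d_v W.d_v)+
  moreover have "?c \<noteq> 0" by (simp del: of_nat_Suc)
  ultimately show ?thesis by blast
qed

lemma degree_filter_zero: "V.degree_filter n 0 = 0" "W.degree_filter n 0 = 0"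
  using V.degree_filter_linear(2)[of n 0 0] W.degree_filter_linear(2)[of n 0 0] by simp_all

text \<open>The common scalar would be 0 because of the zero component and nonzero because of the
  highest weight vector.\<close>

lemma not_R_zero_hw: "\<not> R 0 v'" "\<not> R v 0"
proof -
  show "\<not> R 0 v'"
  proof
    assume "R 0 v'"
    then obtain n c where c: "V.degree_filter n 0 = scl c v" "W.degree_filter n v' = scl' c v'"
      using R_degree_filter by blast
    obtain e where e: "e \<noteq> 0" "W.degree_filter n v' = scl' e v'" using hw_degree_filter by blast
    have "c = 0" using c(1) V.v_nonzero by (simp add: degree_filter_zero)
    with c e W.v_nonzero show False by simp
  qed
  show "\<not> R v 0"
  proof
    assume "R v 0"
    then obtain n c where c: "V.degree_filter n v = scl c v" "W.degree_filter n 0 = scl' c v'"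
      using R_degree_filter by blast
    obtain e where e: "e \<noteq> 0" "V.degree_filter n v = scl e v" using hw_degree_filter by blast
    have "c = 0" using c(2) W.v_nonzero by (simp add: degree_filter_zero)
    with c e V.v_nonzero show False by simp
  qed
qed

text \<open>A Schur argument: the kernel is a submodule of an irreducible module, and it is proper
  because it misses \<open>v\<close>. The same dichotomy gives injectivity on the other side,
  totality and surjectivity.\<close>

lemma R_zero_right: "R u 0 \<Longrightarrow> u = 0"
proof -
  have "{u. R u 0} = {0} \<or> {u. R u 0} = UNIV"
  proof (rule V.submodule_trivial)
    show "u + w \<in> {u. R u 0}" if "u \<in> {u. R u 0}" "w \<in> {u. R u 0}" for u w
      using R.add[of u 0 w 0] that by simp
    show "scl c u \<in> {u. R u 0}" if "u \<in> {u. R u 0}" for c u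
      using R.scale[of u 0 c] that by simp
    show "\<rho> x u \<in> {u. R u 0}" if "u \<in> {u. R u 0}" for x u
      using R_act[of u 0 x] that by (simp add: W.act_zero)
  qed (simp add: R_zero)
  then show "R u 0 \<Longrightarrow> u = 0" using not_R_zero_hw by blast
qed

lemma R_zero_left: "R 0 u \<Longrightarrow> u = 0"
proof -
  have "{u. R 0 u} = {0} \<or> {u. R 0 u} = UNIV"
  proof (rule W.submodule_trivial)
    show "u + w \<in> {u. R 0 u}" if "u \<in> {u. R 0 u}" "w \<in> {u. R 0 u}" for u w
      using R.add[of 0 u 0 w] that by simp
    show "scl' c u \<in> {u. R 0 u}" if "u \<in> {u. R 0 u}" for c u
      using R.scale[of 0 u c] that by simp
    show "\<rho>' x u \<in> {u. R 0 u}" if "u \<in> {u. R 0 u}" for x u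
      using R_act[of 0 u x] that by (simp add: V.act_zero)
  qed (simp add: R_zero)
  then show "R 0 u \<Longrightarrow> u = 0" using not_R_zero_hw by blast
qed

lemma R_total: "\<exists>u'. R u u'"
proof -
  have "{u. \<exists>u'. R u u'} = {0} \<or> {u. \<exists>u'. R u u'} = UNIV"
    by (rule V.submodule_trivial) (auto intro: R.add R.scale R_zero R_act)
  then show ?thesis using R_hw V.v_nonzero by blast
qed

lemma R_surj: "\<exists>u. R u u'"
proof -
  have "{u'. \<exists>u. R u u'} = {0} \<or> {u'. \<exists>u. R u u'} = UNIV"
    by (rule W.submodule_trivial) (auto intro: R.add R.scale R_zero R_act)
  then show ?thesis using R_hw W.v_nonzero by blast
qed

lemma R_diff: "R u u' \<Longrightarrow> R w w' \<Longrightarrow> R (u - w) (u' - w')"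
  using R.add[OF _ R.scale[of w w' "- 1"], of u u'] by simp

theorem module_iso: "module_iso scl \<rho> scl' \<rho>'"
proof -
  obtain f where f: "\<And>u. R u (f u)" using R_total by metis
  have f_eq: "f u = u'" if "R u u'" for u u'
    using R_zero_left[of "f u - u'"] R_diff[OF f[of u] that] by simp
  have "Vector_Spaces.linear scl scl' f"
    by (simp add: Vector_Spaces.linear_iff V.vector_space_axioms W.vector_space_axioms
        f_eq R.add R.scale f)
  moreover have "bij f"
  proof (rule bijI)
    show "inj f"
    proof (rule injI)
      fix u w
      assume "f u = f w"
      then have "R (u - w) 0" using R_diff[OF f[of u] f[of w]] by simp
      then show "u = w" using R_zero_right by force
    qed
    show "surj f" unfolding surj_def using R_surj f_eq by metis
  qed
  moreover have "f (\<rho> x u) = \<rho>' x (f u)" for x u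
    by (rule f_eq[OF R_act[OF f]])
  ultimately show ?thesis unfolding module_iso_def by blast
qed

end

lemma is_L_unique:
  assumes "is_L scl \<rho> c0 c1" "is_L scl' \<rho>' c0 c1"
  shows "module_iso scl \<rho> scl' \<rho>'"
proof -
  obtain k a v d where 1: "c0 = k / 2 - a" "c1 = k / 2 + a"
    "irreducible_module scl \<rho>" "has_level scl \<rho> k"
    "highest_weight_vector scl \<rho> a v" "degree_operator scl \<rho> v d"
    using assms(1) by (auto simp: is_L_def)
  obtain k' a' v' d' where 2: "c0 = k' / 2 - a'" "c1 = k' / 2 + a'"
    "irreducible_module scl' \<rho>'" "has_level scl' \<rho>' k'"
    "highest_weight_vector scl' \<rho>' a' v'" "degree_operator scl' \<rho>' v' d'"
    using assms(2) by (auto simp: is_L_def)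
  \<comment> \<open>The two labels determine level and weight, so both realisations have the same
    \<open>k\<close> and \<open>a\<close>.\<close>
  have "c0 + c1 = k" unfolding 1(1,2) by simp
  moreover have "c0 + c1 = k'" unfolding 2(1,2) by simp
  ultimately have k: "k' = k" by simp
  with 1(1) 2(1) have a: "a' = a" by simp
  interpret graded_hw_module_pair scl \<rho> k a v d scl' \<rho>' v' d'
    by unfold_locales (use 1 2 k a in auto)
  show ?thesis by (rule module_iso)
qed

theorem theorem6p2:
  fixes \<chi> :: "complex fls" and i j :: nat
  assumes "i \<in> {1, 2}" and "j \<in> {1, 2}"
  shows
    "twisted_module smul (FF \<chi> i j) \<and>
     X_plus (FF \<chi> i j) =
       ser_scale (1 / complex_of_real (sqrt 2)) (ser_tens (G_field \<chi> i) (Y_tw j)) \<and>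
     h_series (FF \<chi> i j) =
       ser_add (ser_scale (-2) (ser_tens ser_one beta_field))
               (ser_scale 2 (ser_tens (T_field \<chi>) ser_one)) \<and>
     (\<forall>l::complex. l \<in> {1 / 2} \<union> (- range (\<lambda>n::int. of_int n / 2)) \<longrightarrow>
        irreducible_module smul (FF (over_z l) i j) \<and>
        has_level smul (FF (over_z l) i j) (-2) \<and>
        (i = j \<longrightarrow> iso_to_L TYPE('w::ab_group_add) smul (FF (over_z l) i j) (2 * l - 2) (- 2 * l)) \<and>
        (i \<noteq> j \<longrightarrow> iso_to_L TYPE('w) smul (FF (over_z l) i j) (- 2 * l) (2 * l - 2))) \<and>
     iso_to_L TYPE('w) smul (FF (over_z (1 / 2)) i j) (-1) (-1)"
proof -
  have iso: "iso_to_L TYPE('w) smul (FF (over_z l) i j) c0 c1"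
    if "is_L smul (FF (over_z l) i j) c0 c1" for l c0 c1
    unfolding iso_to_L_def using that is_L_unique by blast
  \<comment> \<open>For indices in \<open>{1, 2}\<close> the sum is even exactly when they
    agree.\<close>
  have sign: "(- 1) ^ (i + j) = (if i = j then 1 else - 1 :: complex)"
    using assms by auto
  have L: "iso_to_L TYPE('w) smul (FF (over_z l) i j)
      (if i = j then 2 * l - 2 else - 2 * l) (if i = j then - 2 * l else 2 * l - 2)"
    if "l \<in> {1 / 2} \<union> (- range (\<lambda>n::int. of_int n / 2))" for l
  proof -
    have "(if i = j then 2 * l - 2 else - 2 * l) = - 1 - (1 - 2 * l) * (- 1) ^ (i + j)"
      "(if i = j then - 2 * l else 2 * l - 2) = - 1 + (1 - 2 * l) * (- 1) ^ (i + j)"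
      unfolding sign by auto
    then show ?thesis using iso[OF is_L_FF_over_z[OF that]] by simp
  qed
  have "has_level smul (FF (over_z l) i j) (- 2)" for l
    using twisted_module_FF by (simp add: twisted_module_def)
  then have "\<forall>l::complex. l \<in> {1 / 2} \<union> (- range (\<lambda>n::int. of_int n / 2)) \<longrightarrow>
        irreducible_module smul (FF (over_z l) i j) \<and>
        has_level smul (FF (over_z l) i j) (-2) \<and>
        (i = j \<longrightarrow> iso_to_L TYPE('w) smul (FF (over_z l) i j) (2 * l - 2) (- 2 * l)) \<and>
        (i \<noteq> j \<longrightarrow> iso_to_L TYPE('w) smul (FF (over_z l) i j) (- 2 * l) (2 * l - 2))"
    using L irreducible_FF_over_z by (auto simp del: Un_iff)
  \<comment> \<open>At \<open>\<lambda> = 1/2\<close> the factor \<open>1 - 2\<lambda>\<close>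
    vanishes, so both cases have the same highest weight.\<close>
  moreover have "iso_to_L TYPE('w) smul (FF (over_z (1 / 2)) i j) (-1) (-1)"
    using L[of "1 / 2"] by (cases "i = j") simp_all
  ultimately show ?thesis
    using twisted_module_FF X_plus_FF[of \<chi> i j] h_series_FF[of \<chi> i j]
    unfolding FF_X_def[symmetric] FF_h_def[symmetric] by blast
qed

end
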